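(* Let $\chi\in\Pi_\infty$ have more than one point of support. The recursive tree system $(\chi,h)$ with automaton distribution map $\Psi$ is critical if and only if $\Psi'(0)=1$ and $\Psi''(0)\leq 0$.
   Context: A child distribution $\chi$ is a probability measure on $\mathbb{N}=\{0,1,2,\ldots\}$; write $\chi(n)=\chi(\{n\})$. A recursive tree system $(\chi,h)$ consists of a child distribution $\chi$ and a threshold function $h\colon\mathbb{N}\to\{1,2,3,\ldots\}$ (so $h(\ell)\geq 1$ for all $\ell\geq 0$). Its automaton distribution map is $\Psi\colon[0,1]\to[0,1]$, $\Psi(x)=\sum_{\ell=0}^\infty \chi(\ell)\,\mathbb{P}[\mathrm{Bin}(\ell,x)\geq h(\ell)]$, where $\mathrm{Bin}(\ell,x)$ is a binomial random variable. Derivatives at $0$ are one-sided. $\mathrm{GW}_\chi$ is the Galton--Watson measure with child distribution $\chi$ on the space of rooted trees. For a rooted tree $t$, $\ell(t)$ is the number of children of the root, and the root-child subtrees of $t$ are the subtrees originated by the children of the root. For a set of trees $\mathcal{T}$, $c(t,\mathcal{T})$ is the number of root-child subtrees of $t$ that are elements of $\mathcal{T}$. A $\mathrm{GW}_\chi$-measurable set of trees $\mathcal{T}$ is an interpretation of $(\chi,h)$ if, for $\mathrm{GW}_\chi$-a.e. rooted tree $t$, $t\in\mathcal{T}\iff c(t,\mathcal{T})\geq h(\ell(t))$. $\Pi_\infty$ is the space of probability measures on $\mathbb{N}$ with all moments finite. For $n\geq 0$ let $d_n(\chi_1,\chi_2)=\sum_{k=1}^\infty k^n|\chi_1(k)-\chi_2(k)|$.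 $\Pi_\infty$ carries the topology induced by the diagonal map $\Pi_\infty\to\prod_{n=0}^\infty(\Pi_\infty,d_n)$, so that $\chi_j\to\chi$ if and only if $d_n(\chi_j,\chi)\to0$ for all $n\geq 0$. For $\chi\in\Pi_\infty$, the system $(\chi,h)$ is critical if for any $\epsilon>0$, every neighborhood of $\chi$ in $\Pi_\infty$ contains a measure $\pi$ such that there is an interpretation $\mathcal{T}$ of $(\pi,h)$ satisfying $0<\mathrm{GW}_\pi(\mathcal{T})<\epsilon$. *)

theory Defs
  imports "HOL-Probability.Probability"
begin

section \<open>Galton--Watson measures\<close>

text \<open>
  Rooted trees are locally finite, possibly infinite, plane trees: the children of a vertex form
  a finite list, whose order plays no role in what follows.  For a tree \<open>t\<close>, the number
  \<open>l(t)\<close> is \<open>length (children t)\<close>, and \<open>children t\<close> is the list of root-child subtrees.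
\<close>

codatatype rtree = Node (children: "rtree list")

text \<open>
  Vertices are addressed by lists of child indices.  \<open>offspring u t\<close> is \<open>Some\<close> of the number of
  children of the vertex \<open>u\<close>, and \<open>None\<close> if \<open>t\<close> has no such vertex.
\<close>

primrec offspring :: "nat list \<Rightarrow> rtree \<Rightarrow> nat option" where
  "offspring [] t = Some (length (children t))"
| "offspring (i # u) t =
     (if i < length (children t) then offspring u (children t ! i) else None)"

definition rtree_space :: "rtree measure" where
  "rtree_space = vimage_algebra UNIV (\<lambda>t u. offspring u t)
     (\<Pi>\<^sub>M u\<in>(UNIV :: nat list set). (count_space UNIV :: nat option measure))"

text \<open>
  The tree in which each vertex \<open>u\<close> has \<open>\<omega> u\<close> children; the values of \<open>\<omega>\<close> at addresses that are
  not vertices are ignored.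
\<close>

primcorec tree_of :: "(nat list \<Rightarrow> nat) \<Rightarrow> rtree" where
  "tree_of \<omega> = Node (map (\<lambda>i. tree_of (\<lambda>u. \<omega> (i # u))) [0..<\<omega> []])"

definition GW :: "nat pmf \<Rightarrow> rtree measure" where
  "GW \<mu> = distr (\<Pi>\<^sub>M u\<in>(UNIV :: nat list set). measure_pmf \<mu>) rtree_space tree_of"

lemma space_rtree_space [simp]: "space rtree_space = UNIV"
  by (simp add: rtree_space_def)

lemma sets_GW [simp, measurable_cong]: "sets (GW \<mu>) = sets rtree_space"
  by (simp add: GW_def)

lemma space_GW [simp]: "space (GW \<mu>) = UNIV"
  by (simp add: GW_def)

lemma measurable_offspring [measurable]:
  "offspring u \<in> rtree_space \<rightarrow>\<^sub>M count_space UNIV"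
proof -
  have "(\<lambda>t u. offspring u t) \<in> rtree_space \<rightarrow>\<^sub>M
          (\<Pi>\<^sub>M u\<in>(UNIV :: nat list set). (count_space UNIV :: nat option measure))"
    unfolding rtree_space_def
    by (rule measurable_vimage_algebra1) (auto simp: space_PiM)
  then show ?thesis
    using measurable_component_singleton[of u UNIV "\<lambda>_. count_space UNIV :: nat option measure"]
    by (auto dest: measurable_compose)
qed

lemma measurable_offspring_tree_of:
  "(\<lambda>\<omega>. offspring u (tree_of \<omega>)) \<in>
     (\<Pi>\<^sub>M u\<in>(UNIV :: nat list set). measure_pmf \<mu>) \<rightarrow>\<^sub>M count_space UNIV"
proof (induction u)
  case Nil
  have "(\<lambda>\<omega>. \<omega> []) \<in> (\<Pi>\<^sub>M u\<in>(UNIV :: nat list set). measure_pmf \<mu>) \<rightarrow>\<^sub>M count_space UNIV"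
    by (rule measurable_compose[OF measurable_component_singleton]) auto
  then have "(\<lambda>\<omega>. Some (\<omega> [])) \<in>
      (\<Pi>\<^sub>M u\<in>(UNIV :: nat list set). measure_pmf \<mu>) \<rightarrow>\<^sub>M count_space UNIV"
    by (rule measurable_compose) simp
  then show ?case by simp
next
  case (Cons i u)
  let ?P = "\<Pi>\<^sub>M u\<in>(UNIV :: nat list set). measure_pmf \<mu>"
  have root: "(\<lambda>\<omega>. \<omega> []) \<in> ?P \<rightarrow>\<^sub>M count_space UNIV"
    by (rule measurable_compose[OF measurable_component_singleton]) auto
  have "(\<lambda>\<omega> u. \<omega> (i # u)) \<in> ?P \<rightarrow>\<^sub>M ?P"
    by (rule measurable_PiM_single') (auto intro: measurable_component_singleton)
  then have "(\<lambda>\<omega>. offspring u (tree_of (\<lambda>u. \<omega> (i # u)))) \<in> ?P \<rightarrow>\<^sub>M count_space UNIV"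
    by (rule measurable_compose) (rule Cons.IH)
  moreover have "Measurable.pred ?P (\<lambda>\<omega>. i < \<omega> [])"
    by (rule measurable_compose[OF root]) simp
  ultimately have "(\<lambda>\<omega>. if i < \<omega> [] then offspring u (tree_of (\<lambda>u. \<omega> (i # u))) else None)
      \<in> ?P \<rightarrow>\<^sub>M count_space UNIV"
    by measurable
  moreover have "(\<lambda>\<omega>. offspring (i # u) (tree_of \<omega>)) =
      (\<lambda>\<omega>. if i < \<omega> [] then offspring u (tree_of (\<lambda>u. \<omega> (i # u))) else None)"
    by (auto simp: fun_eq_iff)
  ultimately show ?case by (simp only:)
qed

lemma measurable_tree_of [measurable]:
  "tree_of \<in> (\<Pi>\<^sub>M u\<in>(UNIV :: nat list set). measure_pmf \<mu>) \<rightarrow>\<^sub>M rtree_space"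
  unfolding rtree_space_def
  by (rule measurable_vimage_algebra2)
     (auto intro!: measurable_PiM_single' measurable_offspring_tree_of)

lemma prob_space_GW: "prob_space (GW \<mu>)"
proof -
  interpret product_prob_space "\<lambda>_ :: nat list. measure_pmf \<mu>" UNIV
    by unfold_locales
  show ?thesis
    unfolding GW_def by (rule P.prob_space_distr) (rule measurable_tree_of)
qed


section \<open>Recursive tree systems\<close>

text \<open>Only meaningful for \<open>x \<in> {0..1}\<close>, the range in which \<open>binomial_pmf l x\<close> is specified.\<close>

definition automaton_map :: "nat pmf \<Rightarrow> (nat \<Rightarrow> nat) \<Rightarrow> real \<Rightarrow> real" where
  "automaton_map \<mu> h x =
     (\<Sum>l. pmf \<mu> l * measure_pmf.prob (binomial_pmf l x) {k. k \<ge> h l})"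

definition child_count :: "rtree \<Rightarrow> rtree set \<Rightarrow> nat" where
  "child_count t \<T> = length (filter (\<lambda>s. s \<in> \<T>) (children t))"

text \<open>Measurability with respect to \<open>GW\<^sub>\<mu>\<close> allows for \<open>GW\<^sub>\<mu>\<close>-null sets, whence the completion.\<close>

definition tree_interpretation :: "nat pmf \<Rightarrow> (nat \<Rightarrow> nat) \<Rightarrow> rtree set \<Rightarrow> bool" where
  "tree_interpretation \<mu> h \<T> \<longleftrightarrow>
     \<T> \<in> sets (completion (GW \<mu>)) \<and>
     (AE t in GW \<mu>. t \<in> \<T> \<longleftrightarrow> child_count t \<T> \<ge> h (length (children t)))"


section \<open>The space of child distributions and criticality\<close>

definition Pi_inf :: "nat pmf set" where
  "Pi_inf = {\<mu>. \<forall>n. integrable (measure_pmf \<mu>) (\<lambda>k. real k ^ n)}"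

definition d_moment :: "nat \<Rightarrow> nat pmf \<Rightarrow> nat pmf \<Rightarrow> real" where
  "d_moment n \<mu>\<^sub>1 \<mu>\<^sub>2 = (\<Sum>\<^sub>\<infinity>k\<in>{1..}. real k ^ n * \<bar>pmf \<mu>\<^sub>1 k - pmf \<mu>\<^sub>2 k\<bar>)"

definition Pi_inf_topology :: "nat pmf topology" where
  "Pi_inf_topology = pullback_topology Pi_inf (\<lambda>\<mu> n. \<mu>)
     (product_topology (\<lambda>n. Metric_space.mtopology Pi_inf (d_moment n)) (UNIV :: nat set))"

definition critical :: "nat pmf \<Rightarrow> (nat \<Rightarrow> nat) \<Rightarrow> bool" where
  "critical \<mu> h \<longleftrightarrow>
     (\<forall>\<epsilon>>0. \<forall>U. openin Pi_inf_topology U \<and> \<mu> \<in> U \<longrightarrow>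
        (\<exists>\<pi>\<in>U. \<exists>\<T>. tree_interpretation \<pi> h \<T> \<and>
           0 < measure (completion (GW \<pi>)) \<T> \<and> measure (completion (GW \<pi>)) \<T> < \<epsilon>))"

lemma d_moment_summable:
  assumes "\<mu>\<^sub>1 \<in> Pi_inf" "\<mu>\<^sub>2 \<in> Pi_inf"
  shows "(\<lambda>k. real k ^ n * \<bar>pmf \<mu>\<^sub>1 k - pmf \<mu>\<^sub>2 k\<bar>) summable_on A"
proof -
  have *: "(\<lambda>k. real k ^ n * pmf \<mu> k) summable_on UNIV" if "\<mu> \<in> Pi_inf" for \<mu>
  proof -
    have "integrable (measure_pmf \<mu>) (\<lambda>k. real k ^ n)"
      using that by (auto simp: Pi_inf_def)
    then have "integrable (count_space UNIV) (\<lambda>k. pmf \<mu> k * real k ^ n)"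
      by (subst (asm) measure_pmf_eq_density, subst (asm) integrable_density) auto
    then have "Infinite_Set_Sum.abs_summable_on (\<lambda>k. pmf \<mu> k * real k ^ n) UNIV"
      by (simp add: Infinite_Set_Sum.abs_summable_on_def)
    then show ?thesis
      using Infinite_Sum.abs_summable_summable[of "\<lambda>k. pmf \<mu> k * real k ^ n" UNIV]
      by (simp only: abs_summable_equivalent mult.commute)
  qed
  have "(\<lambda>k. real k ^ n * pmf \<mu>\<^sub>1 k + real k ^ n * pmf \<mu>\<^sub>2 k) summable_on UNIV"
    by (intro summable_on_add * assms)
  then have "(\<lambda>k. real k ^ n * \<bar>pmf \<mu>\<^sub>1 k - pmf \<mu>\<^sub>2 k\<bar>) summable_on UNIV"
  proof (rule summable_on_comparison_test)
    fix k :: nat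
    have "\<bar>pmf \<mu>\<^sub>1 k - pmf \<mu>\<^sub>2 k\<bar> \<le> pmf \<mu>\<^sub>1 k + pmf \<mu>\<^sub>2 k"
      using pmf_nonneg[of \<mu>\<^sub>1 k] pmf_nonneg[of \<mu>\<^sub>2 k] by linarith
    then show "real k ^ n * \<bar>pmf \<mu>\<^sub>1 k - pmf \<mu>\<^sub>2 k\<bar> \<le> real k ^ n * pmf \<mu>\<^sub>1 k + real k ^ n * pmf \<mu>\<^sub>2 k"
      by (metis mult_left_mono distrib_left of_nat_0_le_iff zero_le_power)
  qed auto
  then show ?thesis
    by (rule summable_on_subset_banach) auto
qed

lemma Metric_space_d_moment: "Metric_space Pi_inf (d_moment n)"
proof
  show "0 \<le> d_moment n x y" for x y
    unfolding d_moment_def by (rule infsum_nonneg) auto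
  show "d_moment n x y = d_moment n y x" for x y
    unfolding d_moment_def by (simp add: abs_minus_commute)
next
  fix x y assume xy: "x \<in> Pi_inf" "y \<in> Pi_inf"
  show "d_moment n x y = 0 \<longleftrightarrow> x = y"
  proof
    assume "d_moment n x y = 0"
    then have eq: "pmf x k = pmf y k" if "k \<noteq> 0" for k
      using nonneg_infsum_le_0D[of "\<lambda>k. real k ^ n * \<bar>pmf x k - pmf y k\<bar>" "{1..}" k]
        d_moment_summable[OF xy, of n "{1..}"] that
      by (auto simp: d_moment_def)
    have "measure_pmf.prob x (-{0}) = measure_pmf.prob y (-{0})"
      unfolding measure_pmf_conv_infsetsum by (rule infsetsum_cong) (auto simp: eq)
    then have "pmf x 0 = pmf y 0"
      using measure_pmf.prob_compl[of "{0}" x] measure_pmf.prob_compl[of "{0}" y]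
      by (simp add: measure_pmf_single Compl_eq_Diff_UNIV)
    with eq show "x = y"
      by (metis pmf_eqI)
  qed (simp add: d_moment_def)
next
  fix x y z assume xyz: "x \<in> Pi_inf" "y \<in> Pi_inf" "z \<in> Pi_inf"
  have "d_moment n x z \<le> (\<Sum>\<^sub>\<infinity>k\<in>{1..}. real k ^ n * \<bar>pmf x k - pmf y k\<bar>
                                  + real k ^ n * \<bar>pmf y k - pmf z k\<bar>)"
    unfolding d_moment_def
  proof (intro infsum_mono summable_on_add d_moment_summable xyz)
    fix k :: nat
    have "real k ^ n * \<bar>pmf x k - pmf z k\<bar>
        \<le> real k ^ n * (\<bar>pmf x k - pmf y k\<bar> + \<bar>pmf y k - pmf z k\<bar>)"
      by (intro mult_left_mono) auto
    then show "real k ^ n * \<bar>pmf x k - pmf z k\<bar>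
        \<le> real k ^ n * \<bar>pmf x k - pmf y k\<bar> + real k ^ n * \<bar>pmf y k - pmf z k\<bar>"
      by (simp add: distrib_left)
  qed
  also have "\<dots> = d_moment n x y + d_moment n y z"
    unfolding d_moment_def by (intro infsum_add d_moment_summable xyz)
  finally show "d_moment n x z \<le> d_moment n x y + d_moment n y z" .
qed

end

theory Submission
  imports Defs
begin

text \<open>
  Relax sets of trees to functions \<open>f\<close> from trees to the unit interval, read as random labellings:
  given everything else, a tree \<open>s\<close> is labelled 1 with probability \<open>f s\<close>.  One application of the
  automaton turns \<open>f\<close> into \<open>step h f\<close>, whose value at \<open>t\<close> is the probability that at least
  \<open>h (l(t))\<close> children of the root carry the label 1 when the children are labelled independently.
  Interpretations are the fixed points of \<open>step h\<close> with values in \<open>{0, 1}\<close>.  The root-child subtrees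
  are independent Galton--Watson trees (\<open>GW_branching\<close>), so \<open>step h\<close> acts on means as \<open>\<Psi>\<close>, and the
  measure \<open>x\<close> of an interpretation satisfies \<open>\<Psi>(x) = x\<close>.  Conversely, whether a fixed point \<open>x\<close>
  of \<open>\<Psi>\<close> comes from an interpretation is governed by \<open>\<Psi>'(x)\<close>, which is the mean number of pivotal
  children: those whose label, if flipped, flips the label of the root.

  If \<open>\<Psi>'(x) < 1\<close>, exchanging labels one child at a time shows that \<open>step h\<close> contracts the \<open>L\<^sup>1\<close>
  distance between functions of mean \<open>x\<close> by the factor \<open>\<Psi>'(x)\<close>, and an Efron--Stein inequality shows
  that it contracts the integral of \<open>f (1 - f)\<close> by the same factor.  The iterates of the constant \<open>x\<close>
  therefore converge to a fixed point that is almost surely 0 or 1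
  (\<open>stable_fixed_point_interpretation\<close>).

  If \<open>\<Psi>'(x) > 1\<close>, suppose that an interpretation of measure \<open>x\<close> exists.  The \<open>n\<close>-th iterate \<open>f\<^sub>n\<close> of
  the constant \<open>x\<close> is then its conditional probability given the first \<open>n\<close> levels of the tree, so
  \<open>e\<^sub>n = \<integral> f\<^sub>n (1 - f\<^sub>n)\<close> tends to 0.  But two independent labellings drawn from \<open>f\<^sub>n\<close> can disagree at a
  single child, and this child can be pivotal; counting only such events gives
  \<open>e\<^sub>n\<^sub>+\<^sub>1 \<ge> e\<^sub>n K(e\<^sub>n)\<close> with \<open>K\<close> lower semicontinuous and \<open>K(0) = \<Psi>'(x) > 1\<close>, so \<open>e\<^sub>n\<close> cannot tend
  to 0 (\<open>unstable_fixed_point_no_interpretation\<close>).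

  The theorem is now about small fixed points of \<open>\<Psi>\<close>.  The metrics \<open>d\<^sub>1\<close> and \<open>d\<^sub>2\<close> control \<open>\<Psi>'\<close> and
  \<open>\<Psi>''\<close> uniformly on the unit interval.  If fixed points \<open>x > 0\<close> tend to 0 as \<open>\<pi>\<close> tends to \<open>\<mu>\<close>, the
  mean value theorem between the fixed points 0 and \<open>x\<close> forces \<open>\<Psi>'(0) = 1\<close>; and if \<open>\<Psi>''(0)\<close> were
  positive, the maps of nearby \<open>\<pi>\<close> would be strictly convex near 0, so \<open>\<Psi>'(x) > 1\<close> at these fixed
  points, which excludes interpretations.  Conversely, let \<open>\<Psi>'(0) = 1\<close> and \<open>\<Psi>''(0) < 0\<close>.  As \<open>\<mu>\<close> has
  two points of support, it charges some \<open>k \<ge> 2\<close> with \<open>h k = 1\<close>, and moving a little mass to \<open>k\<close>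
  raises the slope at 0 above 1 while keeping concavity; this creates a small fixed point with
  slope below 1.  The case \<open>\<Psi>''(0) = 0\<close> is a limit of the previous one, reached by moving
  mass from some \<open>m\<close> with \<open>h m = 2\<close> to 0.
\<close>


section \<open>Recursions for threshold probabilities\<close>

text \<open>
The natural number argument is the threshold still to be met, the list the children still to be
examined.  Each child either lowers the threshold, with weight \<open>a s\<close>, or leaves it, with weight
\<open>b s\<close>; \<open>c\<close> scores the threshold that remains at the end.  With \<open>b = 1 - a\<close> these are
Poisson-binomial probabilities: of at least \<open>k\<close> ones for \<open>c = tail0\<close>, and of exactly \<open>k - 1\<close> ones
for \<open>c = pivot0\<close> and \<open>k \<ge> 1\<close>.  Truncated subtraction is
intended: a threshold that is met stays met.
\<close>

primrec wsum :: "('a \<Rightarrow> real) \<Rightarrow> ('a \<Rightarrow> real) \<Rightarrow> (nat \<Rightarrow> real) \<Rightarrow> 'a list \<Rightarrow> nat \<Rightarrow> real" where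
  "wsum a b c [] k = c k"
| "wsum a b c (s # ts) k = a s * wsum a b c ts (k - 1) + b s * wsum a b c ts k"

text \<open>
A sum over the choice of one distinguished child \<open>s\<close>, which receives the weight \<open>z s\<close> and leaves the
threshold alone.  Children before it are weighted by \<open>a\<close>, \<open>b\<close> and children after it by \<open>a'\<close>, \<open>b'\<close>, as
required when two labellings are exchanged child by child.  With \<open>c = pivot0\<close> the sum runs over the
configurations in which the distinguished child is pivotal.
\<close>

primrec pivot_sum :: "('a \<Rightarrow> real) \<Rightarrow> ('a \<Rightarrow> real) \<Rightarrow> ('a \<Rightarrow> real) \<Rightarrow> ('a \<Rightarrow> real) \<Rightarrow> ('a \<Rightarrow> real)
    \<Rightarrow> (nat \<Rightarrow> real) \<Rightarrow> 'a list \<Rightarrow> nat \<Rightarrow> real" where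
  "pivot_sum z a b a' b' c [] k = 0"
| "pivot_sum z a b a' b' c (s # ts) k = z s * wsum a' b' c ts k
     + (a s * pivot_sum z a b a' b' c ts (k - 1) + b s * pivot_sum z a b a' b' c ts k)"

text \<open>
The value of \<open>wsum\<close> on \<open>n\<close> children with the same constant weights.
\<close>

primrec bsum :: "real \<Rightarrow> real \<Rightarrow> (nat \<Rightarrow> real) \<Rightarrow> nat \<Rightarrow> nat \<Rightarrow> real" where
  "bsum \<alpha> \<beta> c 0 k = c k"
| "bsum \<alpha> \<beta> c (Suc n) k = \<alpha> * bsum \<alpha> \<beta> c n (k - 1) + \<beta> * bsum \<alpha> \<beta> c n k"

text \<open>
The tail indicator \<open>tail0\<close> generates upper tails.  Differencing it in the threshold gives
\<open>pivot0\<close>: a child is pivotal if and only if exactly one more label 1 is missing when the others have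
been counted.
\<close>

definition tail0 :: "nat \<Rightarrow> real" where "tail0 k = (if k = 0 then 1 else 0)"

definition bdiff :: "(nat \<Rightarrow> real) \<Rightarrow> nat \<Rightarrow> real" where "bdiff c k = c (k - 1) - c k"

abbreviation pivot0 :: "nat \<Rightarrow> real" where "pivot0 \<equiv> bdiff tail0"

lemma pivot0_eq: "pivot0 k = (if k = 1 then 1 else 0)"
  by (auto simp: bdiff_def tail0_def)

lemma bdiff_pivot0_eq: "bdiff pivot0 k = (if k = 1 then -1 else if k = 2 then 1 else 0)"
  by (auto simp: bdiff_def tail0_def)

lemma wsum_bdiff: "wsum a b (bdiff c) ts k = wsum a b c ts (k - 1) - wsum a b c ts k"
  by (induction ts arbitrary: k) (auto simp: bdiff_def right_diff_distrib)

lemma bsum_bdiff: "bsum \<alpha> \<beta> (bdiff c) n k = bsum \<alpha> \<beta> c n (k - 1) - bsum \<alpha> \<beta> c n k"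
  by (induction n arbitrary: k) (auto simp: bdiff_def right_diff_distrib)

text \<open>
Bounds on \<open>c\<close> are inherited by \<open>wsum\<close> and \<open>bsum\<close>, since each step of the recursion takes a convex combination, or a smaller one.
\<close>

lemma abs_convex_comb_le:
  fixes x y p m :: real
  assumes "0 \<le> p" "p \<le> 1" "\<bar>x\<bar> \<le> m" "\<bar>y\<bar> \<le> m"
  shows "\<bar>p * x + (1 - p) * y\<bar> \<le> m"
proof -
  have "\<bar>p * x + (1 - p) * y\<bar> \<le> p * \<bar>x\<bar> + (1 - p) * \<bar>y\<bar>"
    using assms by (intro abs_triangle_ineq[THEN order_trans]) (simp add: abs_mult)
  also have "\<dots> \<le> p * m + (1 - p) * m"
    using assms by (intro add_mono mult_left_mono) auto
  finally show ?thesis by (simp add: algebra_simps)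
qed

lemma wsum_abs_le:
  assumes "\<And>s. a s \<in> {0..1}" "\<And>k. \<bar>c k\<bar> \<le> m"
  shows "\<bar>wsum a (\<lambda>s. 1 - a s) c ts k\<bar> \<le> m"
proof (induction ts arbitrary: k)
  case (Cons s ts)
  then show ?case using assms(1)[of s] by (auto intro!: abs_convex_comb_le)
qed (use assms in auto)

lemma bsum_abs_le:
  assumes "0 \<le> \<alpha>" "0 \<le> \<beta>" "\<alpha> + \<beta> \<le> 1" "\<And>k. \<bar>c k\<bar> \<le> m"
  shows "\<bar>bsum \<alpha> \<beta> c n k\<bar> \<le> m"
proof (induction n arbitrary: k)
  case (Suc n)
  have "\<bar>bsum \<alpha> \<beta> c (Suc n) k\<bar> \<le> \<alpha> * \<bar>bsum \<alpha> \<beta> c n (k - 1)\<bar> + \<beta> * \<bar>bsum \<alpha> \<beta> c n k\<bar>"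
    using assms by (auto intro!: abs_triangle_ineq[THEN order_trans] simp: abs_mult)
  also have "\<dots> \<le> \<alpha> * m + \<beta> * m"
    using assms Suc by (intro add_mono mult_left_mono) auto
  also have "\<dots> \<le> m"
    using assms(3) order_trans[OF abs_ge_zero assms(4)[of 0]]
    by (simp add: mult_left_le_one_le assms flip: distrib_right)
  finally show ?case .
qed (use assms in auto)

lemma wsum_nonneg:
  assumes "\<And>s. 0 \<le> a s" "\<And>s. 0 \<le> b s" "\<And>k. 0 \<le> c k"
  shows "0 \<le> wsum a b c ts k"
  by (induction ts arbitrary: k) (auto simp: assms)

lemma bsum_nonneg:
  assumes "0 \<le> \<alpha>" "0 \<le> \<beta>" "\<And>k. 0 \<le> c k"
  shows "0 \<le> bsum \<alpha> \<beta> c n k"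
  by (induction n arbitrary: k) (auto simp: assms)

text \<open>
Positivity of a sum of products of weights does not depend on the sizes of the positive weights.
\<close>

lemma bsum_pos_transfer:
  assumes "0 < bsum \<alpha>' \<beta>' c n k" "0 \<le> \<alpha>'" "0 \<le> \<beta>'" "0 < \<alpha>" "0 < \<beta>" "\<And>k. 0 \<le> c k"
  shows "0 < bsum \<alpha> \<beta> c n k"
  using assms(1)
proof (induction n arbitrary: k)
  case (Suc n)
  have nn: "0 \<le> bsum \<alpha> \<beta> c n j" "0 \<le> bsum \<alpha>' \<beta>' c n j" for j
    using assms by (auto intro!: bsum_nonneg)
  have "0 < bsum \<alpha>' \<beta>' c n (k - 1) \<or> 0 < bsum \<alpha>' \<beta>' c n k"
    using Suc.prems nn by (auto simp: less_le)
  then have "0 < bsum \<alpha> \<beta> c n (k - 1) \<or> 0 < bsum \<alpha> \<beta> c n k"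
    using Suc.IH by blast
  then show ?case
  proof
    assume "0 < bsum \<alpha> \<beta> c n (k - 1)"
    then show ?thesis
      using assms(4,5) nn(1) by (simp add: add_pos_nonneg less_imp_le)
  next
    assume "0 < bsum \<alpha> \<beta> c n k"
    then show ?thesis
      using assms(4,5) nn(1) by (simp add: add_nonneg_pos less_imp_le)
  qed
qed simp

lemma bsum_0: "bsum 0 1 c n k = c k"
  by (induction n) auto

text \<open>
All \<open>n\<close> factors contribute equally to the derivative, and differentiating one of them replaces it by
the difference of \<open>c\<close>.  For \<open>c = tail0\<close> this is Russo's formula.
\<close>

lemma DERIV_bsum:
  "((\<lambda>x. bsum x (1 - x) c n k) has_real_derivative real n * bsum x (1 - x) (bdiff c) (n - 1) k) (at x within A)"
proof (induction n arbitrary: k)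
  case (Suc n)
  have e: "real n * (x * bsum x (1 - x) (bdiff c) (n - 1) (k - 1) + (1 - x) * bsum x (1 - x) (bdiff c) (n - 1) k)
     = real n * bsum x (1 - x) (bdiff c) n k"
    by (cases n) auto
  show ?case
    apply simp
    apply (rule derivative_eq_intros Suc refl)+
    using e by (simp add: bsum_bdiff algebra_simps)
qed simp

lemma continuous_on_bsum [continuous_intros]:
  assumes "continuous_on A \<alpha>" "continuous_on A \<beta>"
  shows "continuous_on A (\<lambda>x. bsum (\<alpha> x) (\<beta> x) c n k)"
  by (induction n arbitrary: k) (auto intro!: continuous_intros assms)

abbreviation ptail :: "('a \<Rightarrow> real) \<Rightarrow> 'a list \<Rightarrow> nat \<Rightarrow> real" where
  "ptail f \<equiv> wsum f (\<lambda>s. 1 - f s) tail0"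

lemma ptail_bounds:
  assumes "\<And>s. f s \<in> {0..1}"
  shows "ptail f ts k \<in> {0..1}"
proof -
  have "0 \<le> ptail f ts k"
    using assms by (intro wsum_nonneg) (auto simp: tail0_def)
  moreover have "\<bar>ptail f ts k\<bar> \<le> 1"
    using assms by (intro wsum_abs_le) (auto simp: tail0_def)
  ultimately show ?thesis by simp
qed

lemma ptail_pivot_bounds:
  assumes "\<And>s. f s \<in> {0..1}"
  shows "wsum f (\<lambda>s. 1 - f s) pivot0 ts k \<in> {0..1}"
proof -
  have "0 \<le> wsum f (\<lambda>s. 1 - f s) pivot0 ts k"
    using assms by (intro wsum_nonneg) (auto simp: pivot0_eq)
  moreover have "\<bar>wsum f (\<lambda>s. 1 - f s) pivot0 ts k\<bar> \<le> 1"
    using assms by (intro wsum_abs_le) (auto simp: pivot0_eq)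
  ultimately show ?thesis by simp
qed

text \<open>
This is the Efron--Stein inequality for the Bernoulli variable \<open>threshold met\<close>: its variance is at
most the expected sum of the variances from resampling one coordinate.  Conditioning on the first
label splits a variance exactly, \<open>a\<close> and \<open>b\<close> being the conditional probabilities; the inequality only
uses \<open>(a - b)\<^sup>2 \<le> a - b\<close>.
\<close>

lemma ptail_var_upper:
  assumes f: "\<And>s. f s \<in> {0..1}"
  shows "ptail f ts k * (1 - ptail f ts k)
    \<le> pivot_sum (\<lambda>s. f s * (1 - f s)) f (\<lambda>s. 1 - f s) f (\<lambda>s. 1 - f s) pivot0 ts k"
proof (induction ts arbitrary: k)
  case (Cons s ts)
  define p a b :: real where "p = f s" and "a = ptail f ts (k - 1)" and "b = ptail f ts k"
  have p: "0 \<le> p" "0 \<le> 1 - p" using f[of s] by (auto simp: p_def)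
  have "wsum f (\<lambda>s. 1 - f s) pivot0 ts k = a - b"
    by (simp add: wsum_bdiff a_def b_def)
  moreover from this have "0 \<le> a - b" "a - b \<le> 1"
    using ptail_pivot_bounds[of f ts k, OF f] by auto
  then have "p * (1 - p) * (a - b)\<^sup>2 \<le> p * (1 - p) * (a - b)"
    using p by (intro mult_left_mono) (auto simp: power2_eq_square mult_left_le)
  moreover have "p * (a * (1 - a)) \<le> p * pivot_sum (\<lambda>s. f s * (1 - f s)) f (\<lambda>s. 1 - f s) f (\<lambda>s. 1 - f s) pivot0 ts (k - 1)"
    using p Cons by (intro mult_left_mono) (auto simp: a_def)
  moreover have "(1 - p) * (b * (1 - b)) \<le> (1 - p) * pivot_sum (\<lambda>s. f s * (1 - f s)) f (\<lambda>s. 1 - f s) f (\<lambda>s. 1 - f s) pivot0 ts k"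
    using p Cons by (intro mult_left_mono) (auto simp: b_def)
  moreover have "(p * a + (1 - p) * b) * (1 - (p * a + (1 - p) * b))
     = p * (1 - p) * (a - b)\<^sup>2 + p * (a * (1 - a)) + (1 - p) * (b * (1 - b))"
    by (simp add: power2_eq_square algebra_simps)
  ultimately show ?case
    unfolding wsum.simps pivot_sum.simps p_def[symmetric] a_def[symmetric] b_def[symmetric] by simp
qed (simp add: tail0_def)

text \<open>
On the left stands the probability that two independent labellings agree and have the pivotal
number of ones; on the right, that both have this number of ones.
\<close>

lemma pivot_square_lower:
  assumes f: "\<And>s. f s \<in> {0..1}"
  shows "wsum (\<lambda>s. (f s)\<^sup>2) (\<lambda>s. (1 - f s)\<^sup>2) pivot0 ts k \<le> (wsum f (\<lambda>s. 1 - f s) pivot0 ts k)\<^sup>2"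
proof (induction ts arbitrary: k)
  case (Cons s ts)
  define p a b :: real where "p = f s" and "a = wsum f (\<lambda>s. 1 - f s) pivot0 ts (k - 1)"
    and "b = wsum f (\<lambda>s. 1 - f s) pivot0 ts k"
  have p: "0 \<le> p" "0 \<le> 1 - p" using f[of s] by (auto simp: p_def)
  have ab: "0 \<le> a" "0 \<le> b"
    using ptail_pivot_bounds[of f ts, OF f] by (auto simp: a_def b_def)
  have "p\<^sup>2 * wsum (\<lambda>s. (f s)\<^sup>2) (\<lambda>s. (1 - f s)\<^sup>2) pivot0 ts (k - 1) \<le> p\<^sup>2 * a\<^sup>2"
    "(1 - p)\<^sup>2 * wsum (\<lambda>s. (f s)\<^sup>2) (\<lambda>s. (1 - f s)\<^sup>2) pivot0 ts k \<le> (1 - p)\<^sup>2 * b\<^sup>2"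
    using Cons by (auto intro!: mult_left_mono simp: a_def b_def)
  moreover have "(p * a + (1 - p) * b)\<^sup>2 = p\<^sup>2 * a\<^sup>2 + (1 - p)\<^sup>2 * b\<^sup>2 + 2 * ((p * a) * ((1 - p) * b))"
    by (simp add: power2_eq_square algebra_simps)
  moreover have "0 \<le> (p * a) * ((1 - p) * b)" using p ab by simp
  ultimately show ?case
    unfolding wsum.simps pivot_sum.simps p_def[symmetric] a_def[symmetric] b_def[symmetric] by simp
qed (simp add: pivot0_eq)

lemma pivot_sum_nonneg:
  assumes "\<And>s. 0 \<le> z s" "\<And>s. 0 \<le> a s" "\<And>s. 0 \<le> b s" "\<And>s. 0 \<le> a' s" "\<And>s. 0 \<le> b' s" "\<And>k. 0 \<le> c k"
  shows "0 \<le> pivot_sum z a b a' b' c ts k"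
  by (induction ts arbitrary: k) (auto intro!: add_nonneg_nonneg mult_nonneg_nonneg wsum_nonneg assms)

text \<open>
The right-hand side is half the probability that two independent labellings give the root different
labels.  The bound keeps only the event that they disagree at a single child and that this child is
pivotal.
\<close>

lemma ptail_var_lower:
  assumes f: "\<And>s. f s \<in> {0..1}"
  shows "pivot_sum (\<lambda>s. f s * (1 - f s)) (\<lambda>s. (f s)\<^sup>2) (\<lambda>s. (1 - f s)\<^sup>2) (\<lambda>s. (f s)\<^sup>2) (\<lambda>s. (1 - f s)\<^sup>2) pivot0 ts k
    \<le> ptail f ts k * (1 - ptail f ts k)"
proof (induction ts arbitrary: k)
  case (Cons s ts)
  let ?P = "pivot_sum (\<lambda>s. f s * (1 - f s)) (\<lambda>s. (f s)\<^sup>2) (\<lambda>s. (1 - f s)\<^sup>2) (\<lambda>s. (f s)\<^sup>2) (\<lambda>s. (1 - f s)\<^sup>2) pivot0 ts :: nat \<Rightarrow> real"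
  have f': "0 \<le> f s" "0 \<le> 1 - f s" "f s \<le> 1" for s using f[of s] by auto
  have P0: "0 \<le> ?P k" for k
    by (rule pivot_sum_nonneg) (auto simp: pivot0_eq f' mult_nonneg_nonneg)
  define p a b :: real where "p = f s" and "a = ptail f ts (k - 1)" and "b = ptail f ts k"
  have p: "0 \<le> p" "0 \<le> 1 - p" "p\<^sup>2 \<le> p" "(1 - p)\<^sup>2 \<le> 1 - p"
    using f'[of s] by (auto simp: p_def power2_eq_square mult_left_le)
  have "wsum (\<lambda>s. (f s)\<^sup>2) (\<lambda>s. (1 - f s)\<^sup>2) pivot0 ts k \<le> (a - b)\<^sup>2"
    using pivot_square_lower[of f ts k, OF f] by (simp add: wsum_bdiff a_def b_def)
  then have "p * (1 - p) * wsum (\<lambda>s. (f s)\<^sup>2) (\<lambda>s. (1 - f s)\<^sup>2) pivot0 ts k \<le> p * (1 - p) * (a - b)\<^sup>2"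
    using p by (intro mult_left_mono) auto
  moreover have "p\<^sup>2 * ?P (k - 1) \<le> p * (a * (1 - a))"
    using p Cons P0 by (intro mult_mono) (auto simp: a_def)
  moreover have "(1 - p)\<^sup>2 * ?P k \<le> (1 - p) * (b * (1 - b))"
    using p Cons P0 by (intro mult_mono) (auto simp: b_def)
  moreover have "(p * a + (1 - p) * b) * (1 - (p * a + (1 - p) * b))
     = p * (1 - p) * (a - b)\<^sup>2 + p * (a * (1 - a)) + (1 - p) * (b * (1 - b))"
    by (simp add: power2_eq_square algebra_simps)
  ultimately show ?case
    unfolding wsum.simps pivot_sum.simps p_def[symmetric] a_def[symmetric] b_def[symmetric] by simp
qed (simp add: tail0_def)

text \<open>
A hybrid argument: pass from the labelling \<open>g\<close> to \<open>f\<close> one child at a time.  The exchange at a child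
matters only if this child is pivotal, with \<open>g\<close> used before it and \<open>f\<close> after it.
\<close>

lemma ptail_diff_le:
  assumes f: "\<And>s. f s \<in> {0..1}" and g: "\<And>s. g s \<in> {0..1}"
  shows "\<bar>ptail f ts k - ptail g ts k\<bar>
    \<le> pivot_sum (\<lambda>s. \<bar>f s - g s\<bar>) g (\<lambda>s. 1 - g s) f (\<lambda>s. 1 - f s) pivot0 ts k"
proof (induction ts arbitrary: k)
  case (Cons s ts)
  let ?P = "pivot_sum (\<lambda>s. \<bar>f s - g s\<bar>) g (\<lambda>s. 1 - g s) f (\<lambda>s. 1 - f s) pivot0 ts"
  define a b a' b' :: real where "a = ptail f ts (k - 1)" and "b = ptail f ts k"
    and "a' = ptail g ts (k - 1)" and "b' = ptail g ts k"
  have q: "0 \<le> g s" "0 \<le> 1 - g s" using g[of s] by auto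
  have w: "wsum f (\<lambda>s. 1 - f s) pivot0 ts k = a - b"
    by (simp add: wsum_bdiff a_def b_def)
  have ab: "0 \<le> a - b" using w ptail_pivot_bounds[of f ts k, OF f] by auto
  have "(f s * a + (1 - f s) * b) - (g s * a' + (1 - g s) * b')
      = (f s - g s) * (a - b) + (g s * (a - a') + (1 - g s) * (b - b'))"
    by (simp add: algebra_simps)
  also have "\<bar>\<dots>\<bar> \<le> \<bar>f s - g s\<bar> * (a - b) + (g s * \<bar>a - a'\<bar> + (1 - g s) * \<bar>b - b'\<bar>)"
    using q ab by (intro abs_triangle_ineq[THEN order_trans] add_mono) (auto simp: abs_mult)
  also have "\<dots> \<le> \<bar>f s - g s\<bar> * (a - b) + (g s * ?P (k - 1) + (1 - g s) * ?P k)"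
    using q Cons by (intro add_mono mult_left_mono order_refl) (auto simp: a_def b_def a'_def b'_def)
  finally show ?case
    unfolding wsum.simps pivot_sum.simps w a_def[symmetric] b_def[symmetric] a'_def[symmetric] b'_def[symmetric]
    by simp
qed simp

lemma ptail_indicator:
  assumes "\<And>s. s \<in> set ts \<Longrightarrow> f s = (if s \<in> T then 1 else 0)"
  shows "ptail f ts k = (if k \<le> length (filter (\<lambda>s. s \<in> T) ts) then 1 else 0)"
  using assms by (induction ts arbitrary: k) (auto simp: tail0_def)


section \<open>Measurability and the branching property\<close>

lemma measurable_rtree_spaceI:
  assumes "\<And>u. (\<lambda>x. offspring u (f x)) \<in> M \<rightarrow>\<^sub>M count_space UNIV"
  shows "f \<in> M \<rightarrow>\<^sub>M rtree_space"
  unfolding rtree_space_def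
  by (rule measurable_vimage_algebra2) (auto intro!: measurable_PiM_single' assms)

definition num_children :: "rtree \<Rightarrow> nat" where "num_children t = length (children t)"

text \<open>
The default value \<open>t\<close> makes \<open>child i\<close> a total function that is still measurable.
\<close>

definition child :: "nat \<Rightarrow> rtree \<Rightarrow> rtree" where
  "child i t = (if i < num_children t then children t ! i else t)"

lemma children_eq_map_child: "children t = map (\<lambda>i. child i t) [0..<num_children t]"
  by (auto intro!: nth_equalityI simp: child_def num_children_def)

lemma measurable_num_children [measurable]: "num_children \<in> rtree_space \<rightarrow>\<^sub>M count_space UNIV"
proof -
  have "(\<lambda>t. the (offspring [] t)) \<in> rtree_space \<rightarrow>\<^sub>M count_space UNIV"
    by (rule measurable_compose[OF measurable_offspring]) simp
  then show ?thesis by (simp add: num_children_def[abs_def])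
qed

lemma measurable_child [measurable]: "child i \<in> rtree_space \<rightarrow>\<^sub>M rtree_space"
proof (rule measurable_rtree_spaceI)
  fix u
  have "(\<lambda>t. offspring u (child i t)) = (\<lambda>t. if i < num_children t then offspring (i # u) t else offspring u t)"
    by (auto simp: child_def num_children_def fun_eq_iff)
  then show "(\<lambda>t. offspring u (child i t)) \<in> rtree_space \<rightarrow>\<^sub>M count_space UNIV"
    by simp
qed

lemma measurable_wsum:
  assumes "\<And>i. X i \<in> M \<rightarrow>\<^sub>M N" "a \<in> borel_measurable N" "b \<in> borel_measurable N"
  shows "(\<lambda>x. wsum a b c (map (\<lambda>i. X i x) is) k) \<in> borel_measurable M"
proof (induction "is" arbitrary: k)
  case (Cons i "is")
  show ?case
    unfolding list.map wsum.simps
    by (intro borel_measurable_add borel_measurable_times Cons.IH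
          measurable_compose[OF assms(1,2)] measurable_compose[OF assms(1,3)])
qed simp

lemma measurable_pivot_sum:
  assumes "\<And>i. X i \<in> M \<rightarrow>\<^sub>M N" "z \<in> borel_measurable N" "a \<in> borel_measurable N" "b \<in> borel_measurable N"
    "a' \<in> borel_measurable N" "b' \<in> borel_measurable N"
  shows "(\<lambda>x. pivot_sum z a b a' b' c (map (\<lambda>i. X i x) is) k) \<in> borel_measurable M"
proof (induction "is" arbitrary: k)
  case (Cons i "is")
  show ?case
    unfolding list.map pivot_sum.simps
    by (intro borel_measurable_add borel_measurable_times Cons.IH measurable_wsum[OF assms(1,5,6)]
          measurable_compose[OF assms(1,2)] measurable_compose[OF assms(1,3)] measurable_compose[OF assms(1,4)])
qed simp

definition step :: "(nat \<Rightarrow> nat) \<Rightarrow> (rtree \<Rightarrow> real) \<Rightarrow> rtree \<Rightarrow> real" where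
  "step h f t = ptail f (children t) (h (num_children t))"

lemma measurable_step [measurable]:
  assumes [measurable]: "f \<in> borel_measurable rtree_space"
  shows "step h f \<in> borel_measurable rtree_space"
proof -
  have "(\<lambda>t. ptail f (map (\<lambda>i. child i t) [0..<n]) (h n)) \<in> borel_measurable rtree_space" for n
    by (rule measurable_wsum[OF measurable_child]) simp_all
  then have "(\<lambda>t. (\<lambda>n t. ptail f (map (\<lambda>i. child i t) [0..<n]) (h n)) (num_children t) t) \<in> borel_measurable rtree_space"
    by (rule measurable_compose_countable[OF _ measurable_num_children])
  also have "(\<lambda>t. (\<lambda>n t. ptail f (map (\<lambda>i. child i t) [0..<n]) (h n)) (num_children t) t) = step h f"
    by (rule ext) (simp only: step_def children_eq_map_child[symmetric])
  finally show ?thesis .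
qed

lemma step_bounds: "(\<And>s. f s \<in> {0..1}) \<Longrightarrow> step h f t \<in> {0..1}"
  unfolding step_def by (rule ptail_bounds)

text \<open>
Infinitely many independent trees, of which a root with \<open>n\<close> children uses the first \<open>n\<close>.  One
index set for all \<open>n\<close> lets the forest be peeled off one tree at a time.
\<close>

definition forest :: "nat pmf \<Rightarrow> (nat \<Rightarrow> rtree) measure" where
  "forest \<mu> = (\<Pi>\<^sub>M i\<in>(UNIV :: nat set). GW \<mu>)"

lemma prob_space_forest: "prob_space (forest \<mu>)"
  unfolding forest_def by (rule prob_space_PiM) (rule prob_space_GW)

lemma measurable_forest_component: "(\<lambda>\<tau>. \<tau> i) \<in> forest \<mu> \<rightarrow>\<^sub>M rtree_space"
proof -
  have "(\<lambda>\<tau>. \<tau> i) \<in> (\<Pi>\<^sub>M i\<in>(UNIV :: nat set). GW \<mu>) \<rightarrow>\<^sub>M GW \<mu>"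
    by (rule measurable_component_singleton) simp
  then show ?thesis
    by (simp add: forest_def cong: measurable_cong_sets)
qed

lemma measurable_graft:
  "(\<lambda>\<tau>. Node (map \<tau> [0..<n])) \<in> forest \<mu> \<rightarrow>\<^sub>M rtree_space"
proof (rule measurable_rtree_spaceI)
  note measurable_forest_component [measurable]
  fix u show "(\<lambda>\<tau>. offspring u (Node (map \<tau> [0..<n]))) \<in> forest \<mu> \<rightarrow>\<^sub>M count_space UNIV"
  proof (cases u)
    case (Cons i v)
    then have "(\<lambda>\<tau>. offspring u (Node (map \<tau> [0..<n]))) = (\<lambda>\<tau>. if i < n then offspring v (\<tau> i) else None)"
      by (auto simp: fun_eq_iff)
    then show ?thesis by simp
  qed simp
qed

lemma measurable_graft_pair [measurable]:
  "(\<lambda>(n, \<tau>). Node (map \<tau> [0..<n])) \<in> measure_pmf \<mu> \<Otimes>\<^sub>M forest \<mu> \<rightarrow>\<^sub>M rtree_space"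
proof -
  have "(\<lambda>x. (\<lambda>n x. Node (map (snd x) [0..<n])) (fst x) x) \<in> count_space UNIV \<Otimes>\<^sub>M forest \<mu> \<rightarrow>\<^sub>M rtree_space"
    by (rule measurable_compose_countable) (auto intro: measurable_compose[OF measurable_snd measurable_graft])
  also have "measurable (count_space UNIV \<Otimes>\<^sub>M forest \<mu>) rtree_space = measurable (measure_pmf \<mu> \<Otimes>\<^sub>M forest \<mu>) rtree_space"
    by (intro measurable_cong_sets sets_pair_measure_cong) auto
  finally show ?thesis by (simp add: case_prod_unfold)
qed

lemma mem_prod_emb_UNIV:
  "x \<in> prod_emb UNIV (\<lambda>_. N) J (Pi\<^sub>E J F) \<longleftrightarrow> (\<forall>j. x j \<in> space N) \<and> (\<forall>j\<in>J. x j \<in> F j)"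
  by (auto simp: prod_emb_def PiE_iff Pi_iff)

text \<open>
Vertices other than the root are grouped by their first step \<open>i\<close>; independence over all vertices
is the same as independence of the root from countably many independent families.  The inverse map
\<open>glue\<close> is the one to analyse, because cylinder sets are pulled back along it to rectangles.
\<close>

lemma PiM_root_split:
  fixes N :: "'b measure"
  assumes "prob_space N"
  defines "E \<equiv> \<Pi>\<^sub>M u\<in>(UNIV :: nat list set). N"
  shows "distr E (N \<Otimes>\<^sub>M (\<Pi>\<^sub>M i\<in>(UNIV :: nat set). E)) (\<lambda>\<omega>. (\<omega> [], \<lambda>i u. \<omega> (i # u)))
    = N \<Otimes>\<^sub>M (\<Pi>\<^sub>M i\<in>(UNIV :: nat set). E)"
proof -
  interpret N: prob_space N by fact
  interpret E: product_prob_space "\<lambda>_ :: nat list. N" UNIV by unfold_locales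
  have EP: "prob_space E" unfolding E_def by unfold_locales
  interpret EE: prob_space E by fact
  interpret EN: product_prob_space "\<lambda>_ :: nat. E" UNIV by unfold_locales
  define P where "P = N \<Otimes>\<^sub>M (\<Pi>\<^sub>M i\<in>(UNIV :: nat set). E)"
  define glue :: "'b \<times> (nat \<Rightarrow> nat list \<Rightarrow> 'b) \<Rightarrow> nat list \<Rightarrow> 'b" where
    "glue = (\<lambda>p u. case u of [] \<Rightarrow> fst p | i # v \<Rightarrow> snd p i v)"
  define unglue :: "(nat list \<Rightarrow> 'b) \<Rightarrow> 'b \<times> (nat \<Rightarrow> nat list \<Rightarrow> 'b)" where
    "unglue = (\<lambda>\<omega>. (\<omega> [], \<lambda>i u. \<omega> (i # u)))"
  have glue_meas: "glue \<in> P \<rightarrow>\<^sub>M E"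
    unfolding E_def glue_def
  proof (rule measurable_PiM_single')
    fix u :: "nat list"
    show "(\<lambda>p. case u of [] \<Rightarrow> fst p | i # v \<Rightarrow> snd p i v) \<in> P \<rightarrow>\<^sub>M N"
    proof (cases u)
      case (Cons i v)
      have "(\<lambda>p. snd p i) \<in> P \<rightarrow>\<^sub>M E" by (simp add: P_def)
      then have "(\<lambda>p. snd p i v) \<in> P \<rightarrow>\<^sub>M N"
        by (rule measurable_compose) (simp add: E_def)
      then show ?thesis using Cons by simp
    qed (simp add: P_def)
  qed (auto simp: P_def E_def space_PiM space_pair_measure PiE_iff split: list.split)
  have unglue_meas: "unglue \<in> E \<rightarrow>\<^sub>M P"
    unfolding P_def unglue_def
  proof (rule measurable_Pair)
    show "(\<lambda>\<omega>. \<omega> []) \<in> E \<rightarrow>\<^sub>M N" unfolding E_def by simp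
    show "(\<lambda>\<omega> i u. \<omega> (i # u)) \<in> E \<rightarrow>\<^sub>M (\<Pi>\<^sub>M i\<in>UNIV. E)"
      unfolding E_def by (intro measurable_PiM_single') (auto simp: space_PiM)
  qed
  have "distr P E glue = E"
    unfolding E_def
  proof (rule E.PiM_eq)
    fix J :: "nat list set" and F assume J: "finite J" "\<And>j. j \<in> J \<Longrightarrow> F j \<in> sets N"
    define H where "H = {i. \<exists>u. i # u \<in> J}"
    define B where "B i = {u. i # u \<in> J}" for i
    have "H \<subseteq> hd ` J" by (auto simp: H_def intro: rev_image_eqI)
    then have finH: "finite H" using J(1) by (meson finite_imageI finite_subset)
    have finB: "finite (B i)" for i
      by (rule finite_subset[OF _ finite_imageI[OF J(1), of tl]]) (auto simp: B_def intro: rev_image_eqI)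
    have Jeq: "J = (J \<inter> {[]}) \<union> (\<lambda>(i, u). i # u) ` (SIGMA i:H. B i)"
    proof (intro set_eqI)
      fix u show "u \<in> J \<longleftrightarrow> u \<in> (J \<inter> {[]}) \<union> (\<lambda>(i, u). i # u) ` (SIGMA i:H. B i)"
        by (cases u) (auto simp: H_def B_def image_iff)
    qed
    have FN: "F j \<in> sets N" if "j \<in> J" for j using J(2) that .
    define C where "C i = prod_emb UNIV (\<lambda>_. N) (B i) (\<Pi>\<^sub>E u\<in>B i. F (i # u))" for i
    have C: "C i \<in> sets E" for i
      unfolding C_def E_def by (rule sets_PiM_I) (use finB in \<open>auto simp: B_def FN\<close>)
    have emC: "emeasure E (C i) = (\<Prod>u\<in>B i. emeasure N (F (i # u)))" for i
      unfolding C_def E_def by (rule E.emeasure_PiM_emb) (use finB in \<open>auto simp: B_def FN\<close>)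
    define A where "A = (if [] \<in> J then F [] else space N)"
    have A: "A \<in> sets N" by (auto simp: A_def FN)
    define D where "D = prod_emb UNIV (\<lambda>_. E) H (\<Pi>\<^sub>E i\<in>H. C i)"
    have D: "D \<in> sets (\<Pi>\<^sub>M i\<in>(UNIV :: nat set). E)"
      unfolding D_def by (rule sets_PiM_I) (auto simp: finH C)
    \<comment> \<open>a cylinder set factors into a condition on the root and one condition for each subtree in \<open>H\<close>\<close>
    have "glue p \<in> prod_emb UNIV (\<lambda>_. N) J (Pi\<^sub>E J F) \<longleftrightarrow> p \<in> A \<times> D" if p: "p \<in> space P" for p
    proof -
      have p1: "fst p \<in> space N" and p2: "\<And>i u. snd p i u \<in> space N"
        using p by (auto simp: P_def E_def space_pair_measure space_PiM PiE_iff)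
      have "glue p \<in> prod_emb UNIV (\<lambda>_. N) J (Pi\<^sub>E J F) \<longleftrightarrow> (\<forall>j\<in>J. glue p j \<in> F j)"
        using p1 p2 by (auto simp: mem_prod_emb_UNIV glue_def split: list.split)
      also have "\<dots> \<longleftrightarrow> ([] \<in> J \<longrightarrow> fst p \<in> F []) \<and> (\<forall>i\<in>H. \<forall>u\<in>B i. snd p i u \<in> F (i # u))"
      proof (intro iffI conjI ballI impI)
        fix i u assume "\<forall>j\<in>J. glue p j \<in> F j" "u \<in> B i"
        then have "glue p (i # u) \<in> F (i # u)" by (simp add: B_def)
        then show "snd p i u \<in> F (i # u)" by (simp add: glue_def)
      next
        fix j assume a: "([] \<in> J \<longrightarrow> fst p \<in> F []) \<and> (\<forall>i\<in>H. \<forall>u\<in>B i. snd p i u \<in> F (i # u))" "j \<in> J"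
        then show "glue p j \<in> F j"
          by (cases j) (auto simp: glue_def H_def B_def)
      qed (auto simp: glue_def)
      also have "\<dots> \<longleftrightarrow> fst p \<in> A \<and> (\<forall>i\<in>H. snd p i \<in> C i)"
        using p1 p2 by (auto simp: A_def C_def mem_prod_emb_UNIV)
      also have "\<dots> \<longleftrightarrow> p \<in> A \<times> D"
        using p2 by (cases p) (auto simp: D_def mem_prod_emb_UNIV E_def space_PiM PiE_iff)
      finally show ?thesis .
    qed
    then have "glue -` prod_emb UNIV (\<lambda>_. N) J (Pi\<^sub>E J F) \<inter> space P = (A \<times> D) \<inter> space P"
      by auto
    also have "\<dots> = A \<times> D"
      using sets.sets_into_space[OF pair_measureI[OF A D]] by (auto simp: P_def)
    finally have pre: "glue -` prod_emb UNIV (\<lambda>_. N) J (Pi\<^sub>E J F) \<inter> space P = A \<times> D" .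
    have "emeasure (distr P (Pi\<^sub>M UNIV (\<lambda>_. N)) glue) (prod_emb UNIV (\<lambda>_. N) J (Pi\<^sub>E J F)) = emeasure P (A \<times> D)"
      using glue_meas J by (subst emeasure_distr) (auto simp: pre E_def intro!: sets_PiM_I)
    also have "\<dots> = emeasure N A * emeasure (\<Pi>\<^sub>M i\<in>(UNIV :: nat set). E) D"
      unfolding P_def by (rule EN.P.emeasure_pair_measure_Times[OF A D])
    also have "emeasure (\<Pi>\<^sub>M i\<in>(UNIV :: nat set). E) D = (\<Prod>i\<in>H. emeasure E (C i))"
      unfolding D_def by (rule EN.emeasure_PiM_emb) (auto simp: finH C)
    also have "emeasure N A = (\<Prod>j\<in>J \<inter> {[]}. emeasure N (F j))"
      by (auto simp: A_def N.emeasure_space_1)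
    also have "(\<Prod>i\<in>H. emeasure E (C i)) = (\<Prod>(i, u)\<in>(SIGMA i:H. B i). emeasure N (F (i # u)))"
      using finH finB by (simp add: emC prod.Sigma)
    also have "\<dots> = (\<Prod>j\<in>(\<lambda>(i, u). i # u) ` (SIGMA i:H. B i). emeasure N (F j))"
      by (subst prod.reindex) (auto simp: inj_on_def case_prod_unfold)
    also have "(\<Prod>j\<in>J \<inter> {[]}. emeasure N (F j)) * \<dots>
        = (\<Prod>j\<in>(J \<inter> {[]}) \<union> (\<lambda>(i, u). i # u) ` (SIGMA i:H. B i). emeasure N (F j))"
      using finH finB J(1) by (intro prod.union_disjoint[symmetric]) auto
    also have "\<dots> = (\<Prod>j\<in>J. emeasure N (F j))"
      by (simp flip: Jeq)
    finally show "emeasure (distr P (Pi\<^sub>M UNIV (\<lambda>_. N)) glue) (prod_emb UNIV (\<lambda>_. N) J (Pi\<^sub>E J F))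
      = (\<Prod>j\<in>J. emeasure N (F j))" .
  qed (simp add: E_def)
  then have "distr E P unglue = distr (distr P E glue) P unglue" by simp
  also have "\<dots> = distr P P (unglue \<circ> glue)"
    by (rule distr_distr[OF unglue_meas glue_meas])
  also have "\<dots> = distr P P (\<lambda>x. x)"
    by (rule distr_cong) (auto simp: glue_def unglue_def)
  finally show ?thesis by (simp add: P_def unglue_def distr_id)
qed

lemma PiM_distr_seq:
  assumes "prob_space N" and [measurable]: "f \<in> N \<rightarrow>\<^sub>M L"
  shows "distr (\<Pi>\<^sub>M i\<in>(UNIV :: nat set). N) (\<Pi>\<^sub>M i\<in>(UNIV :: nat set). distr N L f) (\<lambda>\<omega> i. f (\<omega> i))
    = (\<Pi>\<^sub>M i\<in>(UNIV :: nat set). distr N L f)"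
proof -
  interpret N: prob_space N by fact
  interpret NN: product_prob_space "\<lambda>_ :: nat. N" UNIV by unfold_locales
  interpret L: prob_space "distr N L f" by (rule N.prob_space_distr) simp
  interpret LL: product_prob_space "\<lambda>_ :: nat. distr N L f" UNIV by unfold_locales
  let ?g = "\<lambda>\<omega> i. f (\<omega> i)"
  have g: "?g \<in> (\<Pi>\<^sub>M i\<in>(UNIV :: nat set). N) \<rightarrow>\<^sub>M (\<Pi>\<^sub>M i\<in>(UNIV :: nat set). distr N L f)"
    by (rule measurable_PiM_single') (auto simp: space_PiM intro: measurable_space[OF assms(2)])
  show ?thesis
  proof (rule LL.PiM_eq)
    fix J :: "nat set" and F assume J: "finite J" "\<And>j. j \<in> J \<Longrightarrow> F j \<in> sets (distr N L f)"
    have "?g -` prod_emb UNIV (\<lambda>_. distr N L f) J (Pi\<^sub>E J F) \<inter> space (\<Pi>\<^sub>M i\<in>(UNIV :: nat set). N)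
       = prod_emb UNIV (\<lambda>_. N) J (\<Pi>\<^sub>E j\<in>J. f -` F j \<inter> space N)"
      using measurable_space[OF assms(2)] by (auto simp: mem_prod_emb_UNIV space_PiM PiE_iff)
    then show "emeasure (distr (\<Pi>\<^sub>M i\<in>(UNIV :: nat set). N) (\<Pi>\<^sub>M i\<in>(UNIV :: nat set). distr N L f) ?g)
        (prod_emb UNIV (\<lambda>_. distr N L f) J (Pi\<^sub>E J F)) = (\<Prod>j\<in>J. emeasure (distr N L f) (F j))"
      using J by (subst emeasure_distr[OF g])
        (auto intro!: sets_PiM_I prod.cong simp: NN.emeasure_PiM_emb emeasure_distr)
  qed simp
qed

text \<open>
The branching property: the root degree and the root-child subtrees are independent, and each
subtree is again a Galton--Watson tree.
\<close>

lemma GW_branching: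
  "GW \<mu> = distr (measure_pmf \<mu> \<Otimes>\<^sub>M forest \<mu>) rtree_space (\<lambda>(n, \<tau>). Node (map \<tau> [0..<n]))"
proof -
  define E where "E = (\<Pi>\<^sub>M u\<in>(UNIV :: nat list set). measure_pmf \<mu>)"
  have E: "prob_space E" unfolding E_def by (rule prob_space_PiM) (rule prob_space_measure_pmf)
  define S where "S = (\<Pi>\<^sub>M i\<in>(UNIV :: nat set). E)"
  have S: "prob_space S" unfolding S_def by (rule prob_space_PiM) (rule E)
  let ?split = "\<lambda>\<omega>. (\<omega> [], \<lambda>i u. \<omega> (i # u))"
  let ?graft = "\<lambda>(n, \<tau>). Node (map \<tau> [0..<n])"
  have t[measurable]: "tree_of \<in> E \<rightarrow>\<^sub>M rtree_space" unfolding E_def by (rule measurable_tree_of)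
  have GWE: "GW \<mu> = distr E rtree_space tree_of" by (simp add: GW_def E_def)
  have sp: "?split \<in> E \<rightarrow>\<^sub>M measure_pmf \<mu> \<Otimes>\<^sub>M S"
  proof (rule measurable_Pair)
    show "(\<lambda>\<omega>. \<omega> []) \<in> E \<rightarrow>\<^sub>M measure_pmf \<mu>" unfolding E_def by simp
    show "(\<lambda>\<omega> i u. \<omega> (i # u)) \<in> E \<rightarrow>\<^sub>M S"
      unfolding E_def S_def by (intro measurable_PiM_single') (auto simp: space_PiM)
  qed
  have gr: "(\<lambda>\<Omega> i. tree_of (\<Omega> i)) \<in> S \<rightarrow>\<^sub>M forest \<mu>"
    unfolding S_def forest_def by (rule measurable_PiM_single') (auto simp: space_PiM)
  have forest_eq: "forest \<mu> = distr S (forest \<mu>) (\<lambda>\<Omega> i. tree_of (\<Omega> i))"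
    using PiM_distr_seq[OF E t] by (simp add: S_def forest_def GWE)
  have pair: "(\<lambda>(n, \<Omega>). (n, \<lambda>i. tree_of (\<Omega> i))) \<in> measure_pmf \<mu> \<Otimes>\<^sub>M S \<rightarrow>\<^sub>M measure_pmf \<mu> \<Otimes>\<^sub>M forest \<mu>"
    using measurable_compose[OF measurable_snd gr, of "measure_pmf \<mu>"]
    by (auto simp: case_prod_unfold intro!: measurable_Pair)
  interpret S: prob_space S by (rule S)
  interpret F: prob_space "forest \<mu>" by (rule prob_space_forest)
  interpret D: prob_space "distr S (forest \<mu>) (\<lambda>\<Omega> i. tree_of (\<Omega> i))" by (rule S.prob_space_distr[OF gr])
  have "measure_pmf \<mu> \<Otimes>\<^sub>M forest \<mu>
      = distr (measure_pmf \<mu>) (measure_pmf \<mu>) (\<lambda>n. n) \<Otimes>\<^sub>M distr S (forest \<mu>) (\<lambda>\<Omega> i. tree_of (\<Omega> i))"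
    by (simp add: distr_id flip: forest_eq)
  also have "\<dots> = distr (measure_pmf \<mu> \<Otimes>\<^sub>M S) (measure_pmf \<mu> \<Otimes>\<^sub>M forest \<mu>) (\<lambda>(n, \<Omega>). (n, \<lambda>i. tree_of (\<Omega> i)))"
    by (rule pair_measure_distr) (auto simp: gr D.sigma_finite_measure_axioms)
  also have "distr \<dots> rtree_space ?graft
      = distr (measure_pmf \<mu> \<Otimes>\<^sub>M S) rtree_space (?graft \<circ> (\<lambda>(n, \<Omega>). (n, \<lambda>i. tree_of (\<Omega> i))))"
    by (rule distr_distr[OF measurable_graft_pair pair])
  also have "measure_pmf \<mu> \<Otimes>\<^sub>M S = distr E (measure_pmf \<mu> \<Otimes>\<^sub>M S) ?split"
    unfolding S_def E_def by (rule PiM_root_split[symmetric]) (rule prob_space_measure_pmf)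
  also have "distr \<dots> rtree_space (?graft \<circ> (\<lambda>(n, \<Omega>). (n, \<lambda>i. tree_of (\<Omega> i))))
      = distr E rtree_space (?graft \<circ> (\<lambda>(n, \<Omega>). (n, \<lambda>i. tree_of (\<Omega> i))) \<circ> ?split)"
    by (rule distr_distr[OF measurable_comp[OF pair measurable_graft_pair] sp])
  also have "\<dots> = distr E rtree_space tree_of"
  proof (rule distr_cong)
    fix \<omega>
    show "(?graft \<circ> (\<lambda>(n, \<Omega>). (n, \<lambda>i. tree_of (\<Omega> i))) \<circ> ?split) \<omega> = tree_of \<omega>"
      unfolding comp_def prod.case by (rule tree_of.code[symmetric])
  qed (rule refl)+
  finally show ?thesis unfolding GWE ..
qed


section \<open>Expectations over i.i.d. forests\<close>

lemma measure_GW_UNIV: "measure (GW \<mu>) UNIV = 1"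
  using prob_space.prob_space[OF prob_space_GW] by simp

lemma integral_GW_compl:
  fixes f :: "rtree \<Rightarrow> real"
  assumes "integrable (GW \<mu>) f"
  shows "(\<integral>s. 1 - f s \<partial>GW \<mu>) = 1 - integral\<^sup>L (GW \<mu>) f"
proof -
  interpret prob_space "GW \<mu>" by (rule prob_space_GW)
  show ?thesis using assms by (simp add: measure_GW_UNIV)
qed

text \<open>
Crude bounds, growing with the number of children, that serve only to make the integrands over
forests integrable.
\<close>

lemma unit_mult_mono:
  fixes x y :: real
  assumes "x \<in> {0..1}" "\<bar>y\<bar> \<le> m"
  shows "\<bar>x * y\<bar> \<le> m"
  using assms by (auto simp: abs_mult intro: mult_left_le_one_le[THEN order_trans])

lemma wsum_bounded:
  assumes "\<And>s. a s \<in> {0..1}" "\<And>s. b s \<in> {0..1}" "\<And>k. c k \<in> {0..1}"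
  shows "\<bar>wsum a b c ts k\<bar> \<le> 2 ^ length ts"
proof (induction ts arbitrary: k)
  case (Cons s ts)
  show ?case
    using unit_mult_mono[OF assms(1) Cons, of s "k - 1"] unit_mult_mono[OF assms(2) Cons, of s k]
    by simp
qed (use assms(3) in auto)

lemma pivot_sum_bounded:
  assumes "\<And>s. z s \<in> {0..1}" "\<And>s. a s \<in> {0..1}" "\<And>s. b s \<in> {0..1}"
    "\<And>s. a' s \<in> {0..1}" "\<And>s. b' s \<in> {0..1}" "\<And>k. c k \<in> {0..1}"
  shows "\<bar>pivot_sum z a b a' b' c ts k\<bar> \<le> 3 ^ length ts"
proof (induction ts arbitrary: k)
  case (Cons s ts)
  have "\<bar>wsum a' b' c ts k\<bar> \<le> 2 ^ length ts"
    by (rule wsum_bounded) (rule assms)+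
  also have "(2::real) ^ length ts \<le> 3 ^ length ts"
    by (rule power_mono) auto
  finally have "\<bar>wsum a' b' c ts k\<bar> \<le> 3 ^ length ts" .
  from unit_mult_mono[OF assms(1) this, of s] show ?case
    using unit_mult_mono[OF assms(2) Cons, of s "k - 1"] unit_mult_mono[OF assms(3) Cons, of s k]
    by simp
qed simp

lemma integrable_bounded:
  fixes f :: "'a \<Rightarrow> real"
  assumes "prob_space M" "f \<in> borel_measurable M" "\<And>x. \<bar>f x\<bar> \<le> C"
  shows "integrable M f"
proof -
  interpret prob_space M by fact
  show ?thesis using assms by (intro integrable_const_bound[of _ C]) auto
qed

lemma measurable_case_nat_forest:
  "(\<lambda>(s, \<omega>). case_nat s \<omega>) \<in> GW \<mu> \<Otimes>\<^sub>M forest \<mu> \<rightarrow>\<^sub>M forest \<mu>"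
  unfolding forest_def by measurable

text \<open>
Peeling the first tree off the forest leaves a forest with the same law.  Every expectation over
the children is computed by induction along this decomposition.
\<close>

lemma forest_iter: "distr (GW \<mu> \<Otimes>\<^sub>M forest \<mu>) (forest \<mu>) (\<lambda>(s, \<omega>). case_nat s \<omega>) = forest \<mu>"
proof -
  interpret prob_space "GW \<mu>" by (rule prob_space_GW)
  interpret sequence_space "GW \<mu>" by unfold_locales
  show ?thesis unfolding forest_def by (rule PiM_iter)
qed

lemma borel_measurable_GW_iff: "borel_measurable (GW \<mu>) = borel_measurable rtree_space"
  by (rule measurable_cong_sets) auto

lemma measurable_case_nat_fixed: "case_nat s \<in> forest \<mu> \<rightarrow>\<^sub>M forest \<mu>"
  unfolding forest_def by measurable

lemma
  fixes F :: "(nat \<Rightarrow> rtree) \<Rightarrow> real"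
  assumes F: "F \<in> borel_measurable (forest \<mu>)" and bound: "\<And>\<tau>. \<bar>F \<tau>\<bar> \<le> C"
  shows integral_forest_head_inner: "integral\<^sup>L (forest \<mu>) F = (\<integral>\<omega>. (\<integral>s. F (case_nat s \<omega>) \<partial>GW \<mu>) \<partial>forest \<mu>)"
    and integral_forest_head_outer: "integral\<^sup>L (forest \<mu>) F = (\<integral>s. (\<integral>\<omega>. F (case_nat s \<omega>) \<partial>forest \<mu>) \<partial>GW \<mu>)"
    and measurable_forest_head: "(\<lambda>s. (\<integral>\<omega>. F (case_nat s \<omega>) \<partial>forest \<mu>)) \<in> borel_measurable (GW \<mu>)"
proof -
  interpret G: prob_space "GW \<mu>" by (rule prob_space_GW)
  interpret T: prob_space "forest \<mu>" by (rule prob_space_forest)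
  interpret P: pair_prob_space "GW \<mu>" "forest \<mu>" ..
  have meas: "(\<lambda>(s, \<omega>). F (case_nat s \<omega>)) \<in> borel_measurable (GW \<mu> \<Otimes>\<^sub>M forest \<mu>)"
    using measurable_compose[OF measurable_case_nat_forest F] by (simp add: case_prod_unfold)
  then have int: "integrable (GW \<mu> \<Otimes>\<^sub>M forest \<mu>) (\<lambda>(s, \<omega>). F (case_nat s \<omega>))"
    by (rule integrable_bounded[OF P.prob_space_axioms]) (auto intro: bound)
  have "integral\<^sup>L (forest \<mu>) F = integral\<^sup>L (GW \<mu> \<Otimes>\<^sub>M forest \<mu>) (\<lambda>(s, \<omega>). F (case_nat s \<omega>))"
    by (subst forest_iter[symmetric], subst integral_distr[OF measurable_case_nat_forest F])
       (simp add: case_prod_unfold)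
  then show "integral\<^sup>L (forest \<mu>) F = (\<integral>\<omega>. (\<integral>s. F (case_nat s \<omega>) \<partial>GW \<mu>) \<partial>forest \<mu>)"
    "integral\<^sup>L (forest \<mu>) F = (\<integral>s. (\<integral>\<omega>. F (case_nat s \<omega>) \<partial>forest \<mu>) \<partial>GW \<mu>)"
    using P.integral_fst'[OF int] P.integral_snd[OF int] by simp_all
  show "(\<lambda>s. (\<integral>\<omega>. F (case_nat s \<omega>) \<partial>forest \<mu>)) \<in> borel_measurable (GW \<mu>)"
    using meas by (rule T.borel_measurable_lebesgue_integral)
qed

lemma map_case_nat_upt: "map (case_nat s \<omega>) [0..<Suc n] = s # map \<omega> [0..<n]"
  by (simp only: map_upt_Suc nat.case)

lemma forest_wsum_measurable:
  assumes "a \<in> borel_measurable rtree_space" "b \<in> borel_measurable rtree_space"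
  shows "(\<lambda>\<tau>. wsum a b c (map \<tau> [0..<n]) k) \<in> borel_measurable (forest \<mu>)"
  by (rule measurable_wsum[OF measurable_forest_component assms])

lemma forest_pivot_sum_measurable:
  assumes "z \<in> borel_measurable rtree_space" "a \<in> borel_measurable rtree_space" "b \<in> borel_measurable rtree_space"
    "a' \<in> borel_measurable rtree_space" "b' \<in> borel_measurable rtree_space"
  shows "(\<lambda>\<tau>. pivot_sum z a b a' b' c (map \<tau> [0..<n]) k) \<in> borel_measurable (forest \<mu>)"
  by (rule measurable_pivot_sum[OF measurable_forest_component assms])

lemma integrable_GW_unit:
  assumes "f \<in> borel_measurable rtree_space" "\<And>s. f s \<in> {0..1::real}"
  shows "integrable (GW \<mu>) f"
  using assms by (intro integrable_bounded[OF prob_space_GW, of _ _ 1]) (auto simp: borel_measurable_GW_iff)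

lemma integrable_forest_wsum:
  assumes "a \<in> borel_measurable rtree_space" "b \<in> borel_measurable rtree_space"
    "\<And>s. a s \<in> {0..1}" "\<And>s. b s \<in> {0..1}" "\<And>k. c k \<in> {0..1}"
  shows "integrable (forest \<mu>) (\<lambda>\<tau>. wsum a b c (map \<tau> [0..<n]) k)"
proof (rule integrable_bounded[OF prob_space_forest forest_wsum_measurable[OF assms(1,2)]])
  show "\<bar>wsum a b c (map \<tau> [0..<n]) k\<bar> \<le> 2 ^ n" for \<tau>
    using wsum_bounded[OF assms(3-5), where ts = "map \<tau> [0..<n]" and k = k] by simp
qed

lemma integrable_forest_pivot_sum:
  assumes "z \<in> borel_measurable rtree_space" "a \<in> borel_measurable rtree_space" "b \<in> borel_measurable rtree_space"
    "a' \<in> borel_measurable rtree_space" "b' \<in> borel_measurable rtree_space"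
    "\<And>s. z s \<in> {0..1}" "\<And>s. a s \<in> {0..1}" "\<And>s. b s \<in> {0..1}" "\<And>s. a' s \<in> {0..1}" "\<And>s. b' s \<in> {0..1}"
    "\<And>k. c k \<in> {0..1}"
  shows "integrable (forest \<mu>) (\<lambda>\<tau>. pivot_sum z a b a' b' c (map \<tau> [0..<n]) k)"
proof (rule integrable_bounded[OF prob_space_forest forest_pivot_sum_measurable[OF assms(1-5)]])
  show "\<bar>pivot_sum z a b a' b' c (map \<tau> [0..<n]) k\<bar> \<le> 3 ^ n" for \<tau>
    using pivot_sum_bounded[OF assms(6-11), where ts = "map \<tau> [0..<n]" and k = k] by simp
qed

text \<open>
The weights of different children are independent, and \<open>wsum\<close> is affine in the weights of each
child, so weights may be replaced by their means.
\<close>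

lemma integral_forest_wsum:
  assumes ab: "a \<in> borel_measurable rtree_space" "b \<in> borel_measurable rtree_space"
    "\<And>s. a s \<in> {0..1}" "\<And>s. b s \<in> {0..1}" "\<And>k. c k \<in> {0..1}"
    and A: "integral\<^sup>L (GW \<mu>) a = \<alpha>" and B: "integral\<^sup>L (GW \<mu>) b = \<beta>"
  shows "(\<integral>\<tau>. wsum a b c (map \<tau> [0..<n]) k \<partial>forest \<mu>) = bsum \<alpha> \<beta> c n k"
proof (induction n arbitrary: k)
  case 0
  interpret prob_space "forest \<mu>" by (rule prob_space_forest)
  show ?case by (simp add: prob_space)
next
  case (Suc n)
  let ?W = "\<lambda>k \<omega>. wsum a b c (map \<omega> [0..<n]) k"
  have iW: "integrable (forest \<mu>) (?W k)" for k by (rule integrable_forest_wsum[OF ab])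
  note ia = integrable_GW_unit[OF ab(1,3)] and ib = integrable_GW_unit[OF ab(2,4)]
  have "(\<integral>\<tau>. wsum a b c (map \<tau> [0..<Suc n]) k \<partial>forest \<mu>)
      = (\<integral>\<omega>. (\<integral>s. wsum a b c (map (case_nat s \<omega>) [0..<Suc n]) k \<partial>GW \<mu>) \<partial>forest \<mu>)"
  proof (rule integral_forest_head_inner[OF forest_wsum_measurable[OF ab(1,2)]])
    show "\<bar>wsum a b c (map \<tau> [0..<Suc n]) k\<bar> \<le> 2 ^ Suc n" for \<tau>
      using wsum_bounded[OF ab(3-5), where ts = "map \<tau> [0..<Suc n]" and k = k] by simp
  qed
  also have "\<dots> = (\<integral>\<omega>. (\<integral>s. a s * ?W (k - 1) \<omega> + b s * ?W k \<omega> \<partial>GW \<mu>) \<partial>forest \<mu>)"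
    by (simp only: map_case_nat_upt wsum.simps)
  also have "\<dots> = (\<integral>\<omega>. \<alpha> * ?W (k - 1) \<omega> + \<beta> * ?W k \<omega> \<partial>forest \<mu>)"
    by (simp add: ia ib A B)
  also have "\<dots> = \<alpha> * (\<integral>\<omega>. ?W (k - 1) \<omega> \<partial>forest \<mu>) + \<beta> * (\<integral>\<omega>. ?W k \<omega> \<partial>forest \<mu>)"
    by (simp add: iW)
  finally show ?case by (simp add: Suc)
qed

text \<open>
The distinguished child may be any of the \<open>n\<close> children, and each choice contributes the same amount
once the weights before and after it have equal means.
\<close>

lemma integral_forest_pivot_sum:
  assumes m: "z \<in> borel_measurable rtree_space" "a \<in> borel_measurable rtree_space" "b \<in> borel_measurable rtree_space"
    "a' \<in> borel_measurable rtree_space" "b' \<in> borel_measurable rtree_space"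
    "\<And>s. z s \<in> {0..1}" "\<And>s. a s \<in> {0..1}" "\<And>s. b s \<in> {0..1}" "\<And>s. a' s \<in> {0..1}" "\<And>s. b' s \<in> {0..1}"
    "\<And>k. c k \<in> {0..1}"
    and Z: "integral\<^sup>L (GW \<mu>) z = \<zeta>" and A: "integral\<^sup>L (GW \<mu>) a = \<alpha>" and B: "integral\<^sup>L (GW \<mu>) b = \<beta>"
    and A': "integral\<^sup>L (GW \<mu>) a' = \<alpha>" and B': "integral\<^sup>L (GW \<mu>) b' = \<beta>"
  shows "(\<integral>\<tau>. pivot_sum z a b a' b' c (map \<tau> [0..<n]) k \<partial>forest \<mu>) = \<zeta> * (real n * bsum \<alpha> \<beta> c (n - 1) k)"
proof (induction n arbitrary: k)
  case (Suc n)
  let ?W = "\<lambda>k \<omega>. wsum a' b' c (map \<omega> [0..<n]) k"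
  let ?P = "\<lambda>k \<omega>. pivot_sum z a b a' b' c (map \<omega> [0..<n]) k"
  have iW: "integrable (forest \<mu>) (?W k)" for k by (rule integrable_forest_wsum[OF m(4,5,9-11)])
  have iP: "integrable (forest \<mu>) (?P k)" for k by (rule integrable_forest_pivot_sum[OF m])
  note i = integrable_GW_unit[OF m(1,6)] integrable_GW_unit[OF m(2,7)] integrable_GW_unit[OF m(3,8)]
  have "(\<integral>\<tau>. pivot_sum z a b a' b' c (map \<tau> [0..<Suc n]) k \<partial>forest \<mu>)
      = (\<integral>\<omega>. (\<integral>s. pivot_sum z a b a' b' c (map (case_nat s \<omega>) [0..<Suc n]) k \<partial>GW \<mu>) \<partial>forest \<mu>)"
  proof (rule integral_forest_head_inner[OF forest_pivot_sum_measurable[OF m(1-5)]])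
    show "\<bar>pivot_sum z a b a' b' c (map \<tau> [0..<Suc n]) k\<bar> \<le> 3 ^ Suc n" for \<tau>
      using pivot_sum_bounded[OF m(6-11), where ts = "map \<tau> [0..<Suc n]" and k = k] by simp
  qed
  also have "\<dots> = (\<integral>\<omega>. (\<integral>s. z s * ?W k \<omega> + (a s * ?P (k - 1) \<omega> + b s * ?P k \<omega>) \<partial>GW \<mu>) \<partial>forest \<mu>)"
    by (simp only: map_case_nat_upt pivot_sum.simps)
  also have "\<dots> = (\<integral>\<omega>. \<zeta> * ?W k \<omega> + (\<alpha> * ?P (k - 1) \<omega> + \<beta> * ?P k \<omega>) \<partial>forest \<mu>)"
    by (simp add: i Z A B)
  also have "\<dots> = \<zeta> * (\<integral>\<omega>. ?W k \<omega> \<partial>forest \<mu>) + (\<alpha> * (\<integral>\<omega>. ?P (k - 1) \<omega> \<partial>forest \<mu>) + \<beta> * (\<integral>\<omega>. ?P k \<omega> \<partial>forest \<mu>))"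
    by (simp add: iW iP)
  also have "\<dots> = \<zeta> * bsum \<alpha> \<beta> c n k
      + \<zeta> * (real n * (\<alpha> * bsum \<alpha> \<beta> c (n - 1) (k - 1) + \<beta> * bsum \<alpha> \<beta> c (n - 1) k))"
    by (simp add: Suc integral_forest_wsum[OF m(4,5,9-11) A' B'] algebra_simps)
  also have "real n * (\<alpha> * bsum \<alpha> \<beta> c (n - 1) (k - 1) + \<beta> * bsum \<alpha> \<beta> c (n - 1) k) = real n * bsum \<alpha> \<beta> c n k"
    by (cases n) auto
  finally show ?case by (simp add: algebra_simps)
qed simp

lemma
  fixes F :: "rtree \<Rightarrow> real"
  assumes F: "F \<in> borel_measurable rtree_space" and bound: "\<And>t. \<bar>F t\<bar> \<le> C"
  shows integral_GW_branching: "integral\<^sup>L (GW \<mu>) F = (\<integral>n. (\<integral>\<tau>. F (Node (map \<tau> [0..<n])) \<partial>forest \<mu>) \<partial>measure_pmf \<mu>)"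
    and integrable_GW_branching: "integrable (measure_pmf \<mu>) (\<lambda>n. (\<integral>\<tau>. F (Node (map \<tau> [0..<n])) \<partial>forest \<mu>))"
proof -
  interpret G: prob_space "measure_pmf \<mu>" by (rule prob_space_measure_pmf)
  interpret T: prob_space "forest \<mu>" by (rule prob_space_forest)
  interpret P: pair_prob_space "measure_pmf \<mu>" "forest \<mu>" ..
  have "(\<lambda>(n, \<tau>). F (Node (map \<tau> [0..<n]))) \<in> borel_measurable (measure_pmf \<mu> \<Otimes>\<^sub>M forest \<mu>)"
    using measurable_compose[OF measurable_graft_pair F] by (simp add: case_prod_unfold)
  then have int: "integrable (measure_pmf \<mu> \<Otimes>\<^sub>M forest \<mu>) (\<lambda>(n, \<tau>). F (Node (map \<tau> [0..<n])))"
    by (rule integrable_bounded[OF P.prob_space_axioms]) (auto intro: bound)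
  have "integral\<^sup>L (GW \<mu>) F = integral\<^sup>L (measure_pmf \<mu> \<Otimes>\<^sub>M forest \<mu>) (\<lambda>(n, \<tau>). F (Node (map \<tau> [0..<n])))"
    by (subst GW_branching, subst integral_distr[OF measurable_graft_pair F]) (simp add: case_prod_unfold)
  then show "integral\<^sup>L (GW \<mu>) F = (\<integral>n. (\<integral>\<tau>. F (Node (map \<tau> [0..<n])) \<partial>forest \<mu>) \<partial>measure_pmf \<mu>)"
    using P.integral_fst'[OF int] by simp
  show "integrable (measure_pmf \<mu>) (\<lambda>n. (\<integral>\<tau>. F (Node (map \<tau> [0..<n])) \<partial>forest \<mu>))"
    using P.integrable_fst'[OF int] by simp
qed

lemma measurable_at_graft:
  "F \<in> borel_measurable rtree_space \<Longrightarrow> (\<lambda>\<tau>. F (Node (map \<tau> [0..<n]))) \<in> borel_measurable (forest \<mu>)"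
  by (rule measurable_compose[OF measurable_graft])

lemma integrable_at_graft:
  fixes F :: "rtree \<Rightarrow> real"
  assumes "F \<in> borel_measurable rtree_space" "\<And>t. \<bar>F t\<bar> \<le> C"
  shows "integrable (forest \<mu>) (\<lambda>\<tau>. F (Node (map \<tau> [0..<n])))"
  by (rule integrable_bounded[OF prob_space_forest measurable_at_graft[OF assms(1)] assms(2)])

lemma integrable_degree_bsum:
  assumes "\<mu> \<in> Pi_inf" "0 \<le> \<alpha>" "0 \<le> \<beta>" "\<alpha> + \<beta> \<le> 1" "\<And>k. \<bar>c k\<bar> \<le> 1"
  shows "integrable (measure_pmf \<mu>) (\<lambda>n. real n * bsum \<alpha> \<beta> c (n - 1) (h n))"
proof (rule Bochner_Integration.integrable_bound)
  have "integrable (measure_pmf \<mu>) (\<lambda>k. real k ^ 1)"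
    using assms(1) unfolding Pi_inf_def by blast
  then show "integrable (measure_pmf \<mu>) real" by simp
  show "AE n in measure_pmf \<mu>. norm (real n * bsum \<alpha> \<beta> c (n - 1) (h n)) \<le> norm (real n)"
  proof (rule AE_I2)
    fix n show "norm (real n * bsum \<alpha> \<beta> c (n - 1) (h n)) \<le> norm (real n)"
      using bsum_abs_le[of \<alpha> \<beta> c 1 "n - 1" "h n", OF assms(2-5)] by (simp add: abs_mult mult_left_le)
  qed
qed simp

text \<open>
The mean number of pivotal children of the root if labels are drawn with total weights \<open>\<alpha>\<close> for 1 and
\<open>\<beta>\<close> for 0.  For \<open>\<beta> = 1 - \<alpha>\<close> it is \<open>\<Psi>'(\<alpha>)\<close>; the defective case \<open>\<alpha> + \<beta> < 1\<close> describes labels on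
which two labellings agree.
\<close>

definition pivotal_mean :: "nat pmf \<Rightarrow> (nat \<Rightarrow> nat) \<Rightarrow> real \<Rightarrow> real \<Rightarrow> real" where
  "pivotal_mean \<mu> h \<alpha> \<beta> = (\<integral>n. real n * bsum \<alpha> \<beta> pivot0 (n - 1) (h n) \<partial>measure_pmf \<mu>)"

lemma
  assumes m: "z \<in> borel_measurable rtree_space" "a \<in> borel_measurable rtree_space" "b \<in> borel_measurable rtree_space"
    "a' \<in> borel_measurable rtree_space" "b' \<in> borel_measurable rtree_space"
    "\<And>s. z s \<in> {0..1}" "\<And>s. a s \<in> {0..1}" "\<And>s. b s \<in> {0..1}" "\<And>s. a' s \<in> {0..1}" "\<And>s. b' s \<in> {0..1}"
    and A: "integral\<^sup>L (GW \<mu>) a = \<alpha>" and B: "integral\<^sup>L (GW \<mu>) b = \<beta>"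
    and A': "integral\<^sup>L (GW \<mu>) a' = \<alpha>" and B': "integral\<^sup>L (GW \<mu>) b' = \<beta>"
    and le1: "\<alpha> + \<beta> \<le> 1" and \<mu>: "\<mu> \<in> Pi_inf"
    and F: "F \<in> borel_measurable rtree_space" and bound: "\<And>t. \<bar>F t\<bar> \<le> C"
  shows integral_le_pivotal_mean: "(\<And>t. F t \<le> pivot_sum z a b a' b' pivot0 (children t) (h (num_children t))) \<Longrightarrow>
      integral\<^sup>L (GW \<mu>) F \<le> integral\<^sup>L (GW \<mu>) z * pivotal_mean \<mu> h \<alpha> \<beta>" (is "PROP ?up \<Longrightarrow> _")
    and pivotal_mean_le_integral: "(\<And>t. pivot_sum z a b a' b' pivot0 (children t) (h (num_children t)) \<le> F t) \<Longrightarrow>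
      integral\<^sup>L (GW \<mu>) z * pivotal_mean \<mu> h \<alpha> \<beta> \<le> integral\<^sup>L (GW \<mu>) F" (is "PROP ?lo \<Longrightarrow> _")
proof -
  let ?P = "\<lambda>n \<tau>. pivot_sum z a b a' b' pivot0 (map \<tau> [0..<n]) (h n)"
  let ?b = "\<lambda>n. real n * bsum \<alpha> \<beta> pivot0 (n - 1) (h n)"
  let ?F = "\<lambda>n. (\<integral>\<tau>. F (Node (map \<tau> [0..<n])) \<partial>forest \<mu>)"
  have p01: "pivot0 k \<in> {0..1}" for k by (auto simp: pivot0_eq)
  have "0 \<le> \<alpha>" "0 \<le> \<beta>"
    using m(7,8) unfolding A[symmetric] B[symmetric] by (auto intro!: integral_nonneg_AE)
  then have ib: "integrable (measure_pmf \<mu>) ?b"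
    by (intro integrable_degree_bsum \<mu> le1) (auto simp: pivot0_eq)
  have P: "(\<integral>\<tau>. ?P n \<tau> \<partial>forest \<mu>) = integral\<^sup>L (GW \<mu>) z * ?b n" for n
    by (rule integral_forest_pivot_sum[OF m(1-10) p01 refl A B A' B'])
  have iP: "integrable (forest \<mu>) (?P n)" for n
    by (rule integrable_forest_pivot_sum[OF m(1-10) p01])
  note iF = integrable_at_graft[OF F bound] and iF' = integrable_GW_branching[OF F bound]
  note GF = integral_GW_branching[OF F bound]
  have eq: "integral\<^sup>L (GW \<mu>) z * pivotal_mean \<mu> h \<alpha> \<beta> = (\<integral>n. integral\<^sup>L (GW \<mu>) z * ?b n \<partial>measure_pmf \<mu>)"
    by (simp add: pivotal_mean_def ib)
  {
    assume "PROP ?up"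
    then have "?F n \<le> integral\<^sup>L (GW \<mu>) z * ?b n" for n
      unfolding P[symmetric]
      by (intro integral_mono iP iF) (metis num_children_def rtree.sel length_map diff_zero length_upt)
    then show "integral\<^sup>L (GW \<mu>) F \<le> integral\<^sup>L (GW \<mu>) z * pivotal_mean \<mu> h \<alpha> \<beta>"
      unfolding GF eq by (intro integral_mono iF' integrable_mult_right ib)
  next
    assume "PROP ?lo"
    then have "integral\<^sup>L (GW \<mu>) z * ?b n \<le> ?F n" for n
      unfolding P[symmetric]
      by (intro integral_mono iP iF) (metis num_children_def rtree.sel length_map diff_zero length_upt)
    then show "integral\<^sup>L (GW \<mu>) z * pivotal_mean \<mu> h \<alpha> \<beta> \<le> integral\<^sup>L (GW \<mu>) F"
      unfolding GF eq by (intro integral_mono iF' integrable_mult_right ib)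
  }
qed

text \<open>
This is \<open>automaton_map\<close> in terms of \<open>bsum\<close>; the two agree on the unit interval
(\<open>automaton_map_eq_Psi\<close>).
\<close>

definition Psi :: "nat pmf \<Rightarrow> (nat \<Rightarrow> nat) \<Rightarrow> real \<Rightarrow> real" where
  "Psi \<mu> h x = (\<integral>n. bsum x (1 - x) tail0 n (h n) \<partial>measure_pmf \<mu>)"

lemma integral_step:
  assumes f: "f \<in> borel_measurable rtree_space" "\<And>s. f s \<in> {0..1}" and x: "integral\<^sup>L (GW \<mu>) f = x"
  shows "integral\<^sup>L (GW \<mu>) (step h f) = Psi \<mu> h x"
proof -
  have "integral\<^sup>L (GW \<mu>) (step h f)
      = (\<integral>n. (\<integral>\<tau>. step h f (Node (map \<tau> [0..<n])) \<partial>forest \<mu>) \<partial>measure_pmf \<mu>)"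
  proof (rule integral_GW_branching)
    show "\<bar>step h f t\<bar> \<le> 1" for t using step_bounds[of f h t, OF f(2)] by auto
  qed (use f in simp)
  also have "\<dots> = (\<integral>n. bsum x (1 - x) tail0 n (h n) \<partial>measure_pmf \<mu>)"
  proof (rule Bochner_Integration.integral_cong[OF refl])
    fix n
    have "(\<integral>\<tau>. step h f (Node (map \<tau> [0..<n])) \<partial>forest \<mu>)
        = (\<integral>\<tau>. ptail f (map \<tau> [0..<n]) (h n) \<partial>forest \<mu>)"
      by (simp add: step_def num_children_def)
    also have "\<dots> = bsum x (1 - x) tail0 n (h n)"
      using integrable_GW_unit[OF f, of \<mu>] f
      by (intro integral_forest_wsum) (auto simp: tail0_def x integral_GW_compl)
    finally show "(\<integral>\<tau>. step h f (Node (map \<tau> [0..<n])) \<partial>forest \<mu>) = bsum x (1 - x) tail0 n (h n)" .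
  qed
  finally show ?thesis by (simp add: Psi_def)
qed




section \<open>Stable fixed points have interpretations\<close>

text \<open>
Every root-child subtree has the law of the whole tree, so null sets can be avoided by all of the
countably many potential children at once.
\<close>

lemma AE_children:
  assumes "AE t in GW \<mu>. P t"
  shows "AE t in GW \<mu>. \<forall>s\<in>set (children t). P s"
proof -
  interpret M: prob_space "measure_pmf \<mu>" by (rule prob_space_measure_pmf)
  interpret T: prob_space "forest \<mu>" by (rule prob_space_forest)
  interpret pair_prob_space "measure_pmf \<mu>" "forest \<mu>" ..
  obtain N where N: "N \<in> null_sets (GW \<mu>)" "{t. \<not> P t} \<subseteq> N"
    using assms by (auto elim!: AE_E2 simp: eventually_ae_filter)
  then have Nm[measurable]: "N \<in> sets rtree_space" by (auto dest: null_setsD2)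
  have "AE t in GW \<mu>. t \<notin> N" using N by (auto intro: AE_not_in)
  then have "AE \<tau> in forest \<mu>. \<tau> i \<notin> N" for i
    unfolding forest_def by (rule AE_PiM_component[OF prob_space_GW UNIV_I])
  then have *: "AE \<tau> in forest \<mu>. \<forall>i. \<tau> i \<notin> N"
    by (simp add: AE_all_countable)
  let ?g = "\<lambda>(n, \<tau>). Node (map \<tau> [0..<n])"
  let ?A = "{t. \<forall>s\<in>set (children t). s \<notin> N}"
  have A_eq: "?A = {t \<in> space rtree_space. \<forall>i. i < num_children t \<longrightarrow> child i t \<notin> N}"
    by (subst children_eq_map_child) auto
  have A: "?A \<in> sets rtree_space"
    unfolding A_eq by measurable
  have "AE p in measure_pmf \<mu> \<Otimes>\<^sub>M forest \<mu>. ?g p \<in> ?A"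
  proof (rule AE_pair_measure)
    have "?g -` ?A \<inter> space (measure_pmf \<mu> \<Otimes>\<^sub>M forest \<mu>) \<in> sets (measure_pmf \<mu> \<Otimes>\<^sub>M forest \<mu>)"
      by (rule measurable_sets[OF measurable_graft_pair A])
    then show "{p \<in> space (measure_pmf \<mu> \<Otimes>\<^sub>M forest \<mu>). ?g p \<in> ?A} \<in> sets (measure_pmf \<mu> \<Otimes>\<^sub>M forest \<mu>)"
      by (simp add: vimage_def Int_def conj_commute)
    show "AE n in measure_pmf \<mu>. AE \<tau> in forest \<mu>. ?g (n, \<tau>) \<in> ?A"
      by (rule AE_I2, rule eventually_mono[OF *]) auto
  qed
  then have "AE t in distr (measure_pmf \<mu> \<Otimes>\<^sub>M forest \<mu>) rtree_space ?g. t \<in> ?A"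
    using A by (subst AE_distr_iff[OF measurable_graft_pair]) (auto simp del: mem_Collect_eq)
  then have "AE t in GW \<mu>. t \<in> ?A"
    by (simp only: GW_branching[of \<mu>, symmetric])
  then show ?thesis
    by (rule eventually_mono) (use N(2) in auto)
qed

lemma tendsto_ptail:
  assumes "\<And>s. s \<in> set ts \<Longrightarrow> (\<lambda>n. f n s) \<longlonglongrightarrow> g s"
  shows "(\<lambda>n. ptail (f n) ts k) \<longlonglongrightarrow> ptail g ts k"
  using assms by (induction ts arbitrary: k) (auto intro!: tendsto_intros)

text \<open>
The hybrid bound in expectation: the label of a child changes with probability equal to the \<open>L\<^sup>1\<close>
distance, independently of whether the child is pivotal.
\<close>

lemma step_contraction:
  assumes f: "f \<in> borel_measurable rtree_space" "\<And>s. f s \<in> {0..1}" "integral\<^sup>L (GW \<mu>) f = x"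
    and g: "g \<in> borel_measurable rtree_space" "\<And>s. g s \<in> {0..1}" "integral\<^sup>L (GW \<mu>) g = x"
    and \<mu>: "\<mu> \<in> Pi_inf"
  shows "(\<integral>t. \<bar>step h f t - step h g t\<bar> \<partial>GW \<mu>) \<le> (\<integral>t. \<bar>f t - g t\<bar> \<partial>GW \<mu>) * pivotal_mean \<mu> h x (1 - x)"
proof (rule integral_le_pivotal_mean[where a = g and b = "\<lambda>s. 1 - g s" and a' = f and b' = "\<lambda>s. 1 - f s" and C = 1])
  note [measurable] = f(1) g(1)
  show "(\<lambda>s. \<bar>f s - g s\<bar>) \<in> borel_measurable rtree_space" "(\<lambda>s. 1 - f s) \<in> borel_measurable rtree_space"
    "(\<lambda>s. 1 - g s) \<in> borel_measurable rtree_space" "f \<in> borel_measurable rtree_space" "g \<in> borel_measurable rtree_space"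
    "(\<lambda>t. \<bar>step h f t - step h g t\<bar>) \<in> borel_measurable rtree_space"
    by measurable
  show "\<bar>f s - g s\<bar> \<in> {0..1}" "1 - f s \<in> {0..1}" "1 - g s \<in> {0..1}" "f s \<in> {0..1}" "g s \<in> {0..1}" for s
    using f(2)[of s] g(2)[of s] by auto
  show "\<bar>\<bar>step h f t - step h g t\<bar>\<bar> \<le> 1" for t
    using step_bounds[of f h t, OF f(2)] step_bounds[of g h t, OF g(2)] by auto
  show "\<bar>step h f t - step h g t\<bar> \<le> pivot_sum (\<lambda>s. \<bar>f s - g s\<bar>) g (\<lambda>s. 1 - g s) f (\<lambda>s. 1 - f s) pivot0 (children t) (h (num_children t))" for t
    unfolding step_def by (rule ptail_diff_le[OF f(2) g(2)])
qed (simp_all add: f(3) g(3) \<mu> integral_GW_compl integrable_GW_unit[OF f(1,2)] integrable_GW_unit[OF g(1,2)])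

lemma step_variance_le:
  assumes f: "f \<in> borel_measurable rtree_space" "\<And>s. f s \<in> {0..1}" "integral\<^sup>L (GW \<mu>) f = x"
    and \<mu>: "\<mu> \<in> Pi_inf"
  shows "(\<integral>t. step h f t * (1 - step h f t) \<partial>GW \<mu>) \<le> (\<integral>t. f t * (1 - f t) \<partial>GW \<mu>) * pivotal_mean \<mu> h x (1 - x)"
proof (rule integral_le_pivotal_mean[where a = f and b = "\<lambda>s. 1 - f s" and a' = f and b' = "\<lambda>s. 1 - f s" and C = 1])
  note [measurable] = f(1)
  show "(\<lambda>s. f s * (1 - f s)) \<in> borel_measurable rtree_space" "(\<lambda>s. 1 - f s) \<in> borel_measurable rtree_space"
    "f \<in> borel_measurable rtree_space" "(\<lambda>s. 1 - f s) \<in> borel_measurable rtree_space" "f \<in> borel_measurable rtree_space"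
    "(\<lambda>t. step h f t * (1 - step h f t)) \<in> borel_measurable rtree_space"
    by measurable
  show "f s * (1 - f s) \<in> {0..1}" "1 - f s \<in> {0..1}" "f s \<in> {0..1}" "1 - f s \<in> {0..1}" "f s \<in> {0..1}" for s
    using f(2)[of s] by (auto intro: mult_le_one)
  show "\<bar>step h f t * (1 - step h f t)\<bar> \<le> 1" for t
    using step_bounds[of f h t, OF f(2)] by (auto intro: mult_le_one simp: abs_mult)
  show "step h f t * (1 - step h f t) \<le> pivot_sum (\<lambda>s. f s * (1 - f s)) f (\<lambda>s. 1 - f s) f (\<lambda>s. 1 - f s) pivot0 (children t) (h (num_children t))" for t
    unfolding step_def by (rule ptail_var_upper[OF f(2)])
qed (simp_all add: f(3) \<mu> integral_GW_compl integrable_GW_unit[OF f(1,2)])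

lemma pivotal_mean_nonneg:
  assumes "0 \<le> \<alpha>" "0 \<le> \<beta>"
  shows "0 \<le> pivotal_mean \<mu> h \<alpha> \<beta>"
  unfolding pivotal_mean_def
  by (intro integral_nonneg_AE AE_I2 mult_nonneg_nonneg bsum_nonneg assms) (auto simp: pivot0_eq)

text \<open>
Labels are drawn independently with mean \<open>x\<close> at depth \<open>n\<close> and propagated to the root; the value is
the conditional probability of the label 1 at the root.
\<close>

fun level_iterate :: "(nat \<Rightarrow> nat) \<Rightarrow> real \<Rightarrow> nat \<Rightarrow> rtree \<Rightarrow> real" where
  "level_iterate h x 0 = (\<lambda>_. x)"
| "level_iterate h x (Suc n) = step h (level_iterate h x n)"

lemma measurable_level_iterate [measurable]: "level_iterate h x n \<in> borel_measurable rtree_space"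
  by (induction n) auto

lemma level_iterate_bounds: "x \<in> {0..1} \<Longrightarrow> level_iterate h x n t \<in> {0..1}"
proof (induction n arbitrary: t)
  case (Suc n)
  show ?case unfolding level_iterate.simps by (rule step_bounds) (rule Suc.IH[OF Suc.prems])
qed simp

lemma integral_level_iterate:
  assumes "x \<in> {0..1}" "Psi \<mu> h x = x"
  shows "integral\<^sup>L (GW \<mu>) (level_iterate h x n) = x"
proof (induction n)
  case 0
  then show ?case by (simp add: measure_GW_UNIV)
next
  case (Suc n)
  show ?case
    using integral_step[OF measurable_level_iterate level_iterate_bounds[OF assms(1)] Suc] assms(2) by simp
qed

text \<open>
The iterates are Cauchy in \<open>L\<^sup>1\<close> with geometric rate, hence converge almost surely.  Their limit is a
fixed point of \<open>step h\<close>, and for a fixed point the variance contraction gives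
\<open>\<integral> g (1 - g) \<le> c \<integral> g (1 - g)\<close> with \<open>c < 1\<close>.
\<close>

theorem stable_fixed_point_interpretation:
  assumes \<mu>: "\<mu> \<in> Pi_inf" and x: "x \<in> {0..1}" and fixed: "Psi \<mu> h x = x"
    and stable: "pivotal_mean \<mu> h x (1 - x) < 1"
  shows "\<exists>\<T>\<in>sets rtree_space. tree_interpretation \<mu> h \<T> \<and> measure (GW \<mu>) \<T> = x"
proof -
  interpret prob_space "GW \<mu>" by (rule prob_space_GW)
  define c where "c = pivotal_mean \<mu> h x (1 - x)"
  have c: "0 \<le> c" "c < 1" using pivotal_mean_nonneg[of x "1 - x"] x stable by (auto simp: c_def)
  let ?f = "level_iterate h x"
  note fm = measurable_level_iterate[of h x] and fb = level_iterate_bounds[OF x, of h] and fi = integral_level_iterate[OF x fixed]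
  \<comment> \<open>geometric decay of the increments, starting from the trivial bound 1\<close>
  have contr: "(\<integral>t. \<bar>?f (Suc n) t - ?f n t\<bar> \<partial>GW \<mu>) \<le> c ^ n" for n
  proof (induction n)
    case 0
    have "(\<integral>t. \<bar>?f (Suc 0) t - ?f 0 t\<bar> \<partial>GW \<mu>) \<le> (\<integral>t. 1 \<partial>GW \<mu>)"
    proof (intro integral_mono integrable_GW_unit)
      show "\<bar>?f (Suc 0) t - ?f 0 t\<bar> \<in> {0..1}" "\<bar>?f (Suc 0) t - ?f 0 t\<bar> \<le> 1" for t
        using fb[of "Suc 0" t] fb[of 0 t] by auto
      show "(\<lambda>t. \<bar>?f (Suc 0) t - ?f 0 t\<bar>) \<in> borel_measurable rtree_space"
        by measurable
    qed auto
    then show ?case by (simp add: measure_GW_UNIV)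
  next
    case (Suc n)
    have "(\<integral>t. \<bar>step h (?f (Suc n)) t - step h (?f n) t\<bar> \<partial>GW \<mu>) \<le> (\<integral>t. \<bar>?f (Suc n) t - ?f n t\<bar> \<partial>GW \<mu>) * c"
      unfolding c_def by (rule step_contraction[OF fm fb fi fm fb fi \<mu>])
    also have "\<dots> \<le> c ^ n * c" using Suc c by (intro mult_right_mono) auto
    finally show ?case by (simp add: mult.commute[of c])
  qed
  \<comment> \<open>clamping keeps \<open>g\<close> in the unit interval on the null set where the limit need not exist\<close>
  define g where "g t = max 0 (min 1 (lim (\<lambda>n. ?f n t)))" for t
  have gm[measurable]: "g \<in> borel_measurable rtree_space"
    unfolding g_def[abs_def]
    by (intro borel_measurable_max borel_measurable_min borel_measurable_const borel_measurable_lim_metric fm)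
  have gb: "g t \<in> {0..1}" for t by (auto simp: g_def)
  have conv: "AE t in GW \<mu>. (\<lambda>n. ?f n t) \<longlonglongrightarrow> g t"
  proof -
    have "(\<integral>\<^sup>+t. (\<Sum>n. ennreal \<bar>?f (Suc n) t - ?f n t\<bar>) \<partial>GW \<mu>) = (\<Sum>n. (\<integral>\<^sup>+t. ennreal \<bar>?f (Suc n) t - ?f n t\<bar> \<partial>GW \<mu>))"
      by (rule nn_integral_suminf) (use fm in \<open>simp add: borel_measurable_GW_iff del: level_iterate.simps\<close>)
    also have "\<dots> \<le> (\<Sum>n. ennreal (c ^ n))"
    proof (intro suminf_le)
      fix n
      have "(\<integral>\<^sup>+t. ennreal \<bar>?f (Suc n) t - ?f n t\<bar> \<partial>GW \<mu>) = ennreal (\<integral>t. \<bar>?f (Suc n) t - ?f n t\<bar> \<partial>GW \<mu>)"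
      proof (intro nn_integral_eq_integral integrable_GW_unit)
        show "(\<lambda>t. \<bar>?f (Suc n) t - ?f n t\<bar>) \<in> borel_measurable rtree_space"
          by measurable
        show "\<bar>?f (Suc n) t - ?f n t\<bar> \<in> {0..1}" for t
          using fb[of "Suc n" t] fb[of n t] by auto
      qed auto
      also have "\<dots> \<le> ennreal (c ^ n)" by (intro ennreal_leI contr)
      finally show "(\<integral>\<^sup>+t. ennreal \<bar>?f (Suc n) t - ?f n t\<bar> \<partial>GW \<mu>) \<le> ennreal (c ^ n)" .
    qed auto
    also have "\<dots> < \<infinity>"
      using c by (subst suminf_ennreal2) (auto intro: summable_geometric)
    finally have "AE t in GW \<mu>. (\<Sum>n. ennreal \<bar>?f (Suc n) t - ?f n t\<bar>) \<noteq> \<infinity>"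
      by (intro nn_integral_PInf_AE) auto
    then show ?thesis
    proof (rule eventually_mono)
      fix t assume "(\<Sum>n. ennreal \<bar>?f (Suc n) t - ?f n t\<bar>) \<noteq> \<infinity>"
      then have "summable (\<lambda>n. \<bar>?f (Suc n) t - ?f n t\<bar>)"
        by (intro summable_suminf_not_top) auto
      then have "summable (\<lambda>n. ?f (Suc n) t - ?f n t)" by (rule summable_rabs_cancel)
      then have "convergent (\<lambda>n. \<Sum>i<n. ?f (Suc i) t - ?f i t)" by (simp add: summable_iff_convergent)
      then have "convergent (\<lambda>n. ?f n t - x)"
        unfolding sum_lessThan_telescope[of "\<lambda>i. ?f i t"] by simp
      then have "convergent (\<lambda>n. ?f n t)"
        using convergent_add[of "\<lambda>n. ?f n t - x" "\<lambda>_. x"] by (simp add: convergent_const)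
      then have l: "(\<lambda>n. ?f n t) \<longlonglongrightarrow> lim (\<lambda>n. ?f n t)" by (simp add: convergent_LIMSEQ_iff)
      then have "0 \<le> lim (\<lambda>n. ?f n t)" "lim (\<lambda>n. ?f n t) \<le> 1"
        using fb[of _ t] by (auto intro!: LIMSEQ_le_const[OF l] LIMSEQ_le_const2[OF l])
      with l show "(\<lambda>n. ?f n t) \<longlonglongrightarrow> g t" by (simp add: g_def)
    qed
  qed
  have gi: "integral\<^sup>L (GW \<mu>) g = x"
  proof -
    have "(\<lambda>n. integral\<^sup>L (GW \<mu>) (?f n)) \<longlonglongrightarrow> integral\<^sup>L (GW \<mu>) g"
    proof (rule integral_dominated_convergence[where w = "\<lambda>_. 1"])
      show "AE t in GW \<mu>. norm (?f n t) \<le> 1" for n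
        using fb[of n] by (intro AE_I2) auto
    qed (use conv in auto)
    then show ?thesis by (simp add: fi LIMSEQ_const_iff)
  qed
  have fp: "AE t in GW \<mu>. step h g t = g t"
    using conv AE_children[OF conv]
  proof eventually_elim
    fix t assume t: "(\<lambda>n. ?f n t) \<longlonglongrightarrow> g t" "\<forall>s\<in>set (children t). (\<lambda>n. ?f n s) \<longlonglongrightarrow> g s"
    then have "(\<lambda>n. ?f (Suc n) t) \<longlonglongrightarrow> step h g t"
      unfolding level_iterate.simps step_def by (intro tendsto_ptail) auto
    moreover have "(\<lambda>n. ?f (Suc n) t) \<longlonglongrightarrow> g t" using t(1) by (rule LIMSEQ_Suc)
    ultimately show "step h g t = g t" by (rule LIMSEQ_unique)
  qed
  have g01: "AE t in GW \<mu>. g t * (1 - g t) = 0"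
  proof -
    have vb: "g t * (1 - g t) \<in> {0..1}" for t using gb[of t] by (auto intro: mult_le_one)
    have int: "integrable (GW \<mu>) (\<lambda>t. g t * (1 - g t))"
      by (rule integrable_GW_unit) (use vb in auto)
    have nn: "0 \<le> (\<integral>t. g t * (1 - g t) \<partial>GW \<mu>)" using vb by (intro integral_nonneg_AE) auto
    have "(\<integral>t. g t * (1 - g t) \<partial>GW \<mu>) = (\<integral>t. step h g t * (1 - step h g t) \<partial>GW \<mu>)"
      using fp by (intro integral_cong_AE) (auto simp: borel_measurable_GW_iff elim: eventually_mono)
    also have "\<dots> \<le> (\<integral>t. g t * (1 - g t) \<partial>GW \<mu>) * c"
      unfolding c_def by (rule step_variance_le[OF gm gb gi \<mu>])
    finally have "(\<integral>t. g t * (1 - g t) \<partial>GW \<mu>) * (1 - c) \<le> 0" by (simp add: algebra_simps)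
    with nn c have "(\<integral>t. g t * (1 - g t) \<partial>GW \<mu>) = 0"
      by (simp add: mult_le_0_iff)
    then show ?thesis
      using vb by (subst (asm) integral_nonneg_eq_0_iff_AE[OF int]) auto
  qed
  define T where "T = {t. g t = 1}"
  have T: "T \<in> sets rtree_space"
  proof -
    have "T = g -` {1} \<inter> space rtree_space" by (auto simp: T_def)
    also have "\<dots> \<in> sets rtree_space" by measurable
    finally show ?thesis .
  qed
  have ind: "g s = (if s \<in> T then 1 else 0)" if "g s * (1 - g s) = 0" for s
    using that by (auto simp: T_def)
  have "AE t in GW \<mu>. t \<in> T \<longleftrightarrow> h (length (children t)) \<le> child_count t T"
    using fp g01 AE_children[OF g01]
  proof eventually_elim
    case (elim t)
    have "g t = step h g t" using elim by simp
    also have "\<dots> = (if h (num_children t) \<le> child_count t T then 1 else 0)"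
      unfolding step_def child_count_def using elim ind by (intro ptail_indicator) auto
    finally show ?case by (auto simp: T_def num_children_def split: if_splits)
  qed
  moreover have "T \<in> sets (completion (GW \<mu>))" using T by (intro sets_completionI_sets) simp
  moreover have "measure (GW \<mu>) T = x"
  proof -
    have "x = integral\<^sup>L (GW \<mu>) g" by (simp add: gi)
    also have "\<dots> = integral\<^sup>L (GW \<mu>) (indicator T)"
    proof (rule integral_cong_AE)
      show "AE t in GW \<mu>. g t = indicator T t"
        using g01 by (rule eventually_mono) (drule ind, simp)
    qed (use T in \<open>auto simp: borel_measurable_GW_iff\<close>)
    finally show ?thesis using T by simp
  qed
  ultimately show ?thesis using T by (auto simp: tree_interpretation_def)
qed


section \<open>Unstable fixed points have no interpretation\<close>

text \<open>
Equality of the first \<open>n\<close> generations of two trees, where generation counting starts with the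
number of children of the root.
\<close>

primrec agree :: "nat \<Rightarrow> rtree \<Rightarrow> rtree \<Rightarrow> bool" where
  "agree 0 t t' = True"
| "agree (Suc n) t t' = list_all2 (agree n) (children t) (children t')"

lemma agree_refl: "agree n t t"
  by (induction n arbitrary: t) (auto intro: list.rel_refl)

lemma agree_mono: "m \<le> n \<Longrightarrow> agree n t t' \<Longrightarrow> agree m t t'"
proof (induction n arbitrary: m t t')
  case (Suc n)
  show ?case
  proof (cases m)
    case (Suc m')
    with Suc.prems have "list_all2 (agree n) (children t) (children t')" "m' \<le> n" by auto
    then have "list_all2 (agree m') (children t) (children t')"
      using Suc.IH by (auto elim!: list_all2_mono)
    then show ?thesis using Suc by simp
  qed simp
qed simp

lemma offspring_agree: "agree (Suc (length u)) t t' \<Longrightarrow> offspring u t = offspring u t'"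
proof (induction u arbitrary: t t')
  case Nil
  then show ?case by (auto dest: list_all2_lengthD)
next
  case (Cons i u)
  then have *: "list_all2 (agree (Suc (length u))) (children t) (children t')" by simp
  then have "length (children t) = length (children t')" by (rule list_all2_lengthD)
  moreover have "offspring u (children t ! i) = offspring u (children t' ! i)" if "i < length (children t)"
    using list_all2_nthD[OF * that] by (rule Cons.IH)
  ultimately show ?case by simp
qed

text \<open>
Sets that depend only on the first \<open>n\<close> generations.
\<close>

definition level_set :: "nat \<Rightarrow> rtree set \<Rightarrow> bool" where
  "level_set n S \<longleftrightarrow> S \<in> sets rtree_space \<and> (\<forall>t t'. agree n t t' \<longrightarrow> t \<in> S \<longrightarrow> t' \<in> S)"

lemma agree_sym: "agree n t t' \<Longrightarrow> agree n t' t"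
  by (induction n arbitrary: t t') (auto simp: list_all2_conv_all_nth)

lemma level_set_mono: "m \<le> n \<Longrightarrow> level_set m S \<Longrightarrow> level_set n S"
  unfolding level_set_def using agree_mono by blast

lemma level_set_compl: "level_set n S \<Longrightarrow> level_set n (- S)"
  unfolding level_set_def using agree_sym[of n] sets.compl_sets[of S rtree_space]
  by (simp add: Compl_eq_Diff_UNIV) blast

lemma level_set_Un: "level_set n S \<Longrightarrow> level_set n S' \<Longrightarrow> level_set n (S \<union> S')"
  unfolding level_set_def by auto

definition level_approx :: "nat pmf \<Rightarrow> rtree set \<Rightarrow> bool" where
  "level_approx \<mu> T \<longleftrightarrow> T \<in> sets rtree_space \<and>
     (\<forall>e>0. \<exists>n S. level_set n S \<and> measure (GW \<mu>) ((T - S) \<union> (S - T)) < e)"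

lemma level_approxD:
  assumes "level_approx \<mu> T" "e > 0"
  obtains n S where "level_set n S" "measure (GW \<mu>) ((T - S) \<union> (S - T)) < e"
  using assms unfolding level_approx_def by blast

lemma level_approx_compl:
  assumes "level_approx \<mu> T" shows "level_approx \<mu> (- T)"
  unfolding level_approx_def
proof (intro conjI allI impI)
  show "- T \<in> sets rtree_space"
    using assms sets.compl_sets[of T rtree_space] by (auto simp: level_approx_def Compl_eq_Diff_UNIV)
  fix e :: real assume "e > 0"
  then obtain n S where S: "level_set n S" "measure (GW \<mu>) ((T - S) \<union> (S - T)) < e"
    using level_approxD[OF assms] by blast
  have "(- T - - S) \<union> (- S - - T) = (T - S) \<union> (S - T)" by auto
  with S level_set_compl show "\<exists>n S. level_set n S \<and> measure (GW \<mu>) ((- T - S) \<union> (S - - T)) < e"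
    by metis
qed

lemma measure_GW_Un_le:
  assumes "A \<in> sets rtree_space" "B \<in> sets rtree_space" "C \<subseteq> A \<union> B"
  shows "measure (GW \<mu>) C \<le> measure (GW \<mu>) A + measure (GW \<mu>) B"
proof -
  interpret prob_space "GW \<mu>" by (rule prob_space_GW)
  have "measure (GW \<mu>) C \<le> measure (GW \<mu>) (A \<union> B)"
    using assms by (intro finite_measure_mono) auto
  also have "\<dots> \<le> measure (GW \<mu>) A + measure (GW \<mu>) B"
    using assms by (intro measure_Un_le) auto
  finally show ?thesis .
qed

lemma level_approx_Un:
  assumes "level_approx \<mu> T" "level_approx \<mu> T'" shows "level_approx \<mu> (T \<union> T')"
  unfolding level_approx_def
proof (intro conjI allI impI)
  have [simp]: "T \<in> sets rtree_space" "T' \<in> sets rtree_space"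
    using assms by (auto simp: level_approx_def)
  show "T \<union> T' \<in> sets rtree_space" by (intro sets.Un) simp_all
  fix e :: real assume "e > 0"
  then obtain n S m S' where S: "level_set n S" "measure (GW \<mu>) ((T - S) \<union> (S - T)) < e / 2"
    and S': "level_set m S'" "measure (GW \<mu>) ((T' - S') \<union> (S' - T')) < e / 2"
    using level_approxD[OF assms(1), of "e / 2"] level_approxD[OF assms(2), of "e / 2"] by (metis half_gt_zero)
  then have "level_set (max n m) (S \<union> S')"
    by (intro level_set_Un) (auto intro: level_set_mono[OF max.cobounded1] level_set_mono[OF max.cobounded2])
  moreover have "measure (GW \<mu>) ((T \<union> T' - (S \<union> S')) \<union> (S \<union> S' - (T \<union> T')))
      \<le> measure (GW \<mu>) ((T - S) \<union> (S - T)) + measure (GW \<mu>) ((T' - S') \<union> (S' - T'))"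
    using S(1) S'(1) by (intro measure_GW_Un_le sets.Un sets.Diff) (auto simp: level_set_def)
  ultimately show "\<exists>n S. level_set n S \<and> measure (GW \<mu>) ((T \<union> T' - S) \<union> (S - (T \<union> T'))) < e"
    using S(2) S'(2) by (intro exI[of _ "max n m"] exI[of _ "S \<union> S'"]) auto
qed

lemma level_approx_level_set:
  assumes "level_set n S" shows "level_approx \<mu> S"
  using assms unfolding level_approx_def
  by (auto intro!: exI[of _ n] exI[of _ S] simp: level_set_def)

lemma level_approx_UN:
  fixes A :: "nat \<Rightarrow> rtree set"
  assumes A: "\<And>i. level_approx \<mu> (A i)" shows "level_approx \<mu> (\<Union>i. A i)"
  unfolding level_approx_def
proof (intro conjI allI impI)
  interpret prob_space "GW \<mu>" by (rule prob_space_GW)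
  have Am[simp]: "A i \<in> sets rtree_space" for i using A[of i] by (simp add: level_approx_def)
  show U: "(\<Union>i. A i) \<in> sets rtree_space" by auto
  fix e :: real assume e: "e > 0"
  let ?B = "\<lambda>n. \<Union>i<n. A i"
  have "(\<lambda>n. measure (GW \<mu>) (?B n)) \<longlonglongrightarrow> measure (GW \<mu>) (\<Union>n. ?B n)"
    by (rule finite_Lim_measure_incseq) (auto simp: incseq_def intro: less_le_trans)
  moreover have "(\<Union>n. ?B n) = (\<Union>i. A i)" by auto
  ultimately have "\<forall>\<^sub>F n in sequentially. measure (GW \<mu>) (\<Union>i. A i) - e / 2 < measure (GW \<mu>) (?B n)"
    using e by (intro order_tendstoD) auto
  then obtain n where n: "measure (GW \<mu>) (\<Union>i. A i) - e / 2 < measure (GW \<mu>) (?B n)"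
    by (auto simp: eventually_sequentially)
  have d: "measure (GW \<mu>) ((\<Union>i. A i) - ?B n) < e / 2"
    using n U by (subst finite_measure_Diff) auto
  have "level_approx \<mu> (?B n)"
  proof (induction n)
    case 0
    then show ?case by (auto intro!: level_approx_level_set[of 0] simp: level_set_def)
  next
    case (Suc n)
    then show ?case using A[of n] by (auto simp: lessThan_Suc intro: level_approx_Un)
  qed
  then obtain m S where S: "level_set m S" "measure (GW \<mu>) ((?B n - S) \<union> (S - ?B n)) < e / 2"
    using e level_approxD[of \<mu> "?B n" "e / 2"] by (metis half_gt_zero)
  have "measure (GW \<mu>) (((\<Union>i. A i) - S) \<union> (S - (\<Union>i. A i)))
      \<le> measure (GW \<mu>) ((\<Union>i. A i) - ?B n) + measure (GW \<mu>) ((?B n - S) \<union> (S - ?B n))"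
  proof (rule measure_GW_Un_le)
    have "S \<in> sets rtree_space" "?B n \<in> sets rtree_space"
      using S(1) by (auto simp: level_set_def)
    then show "(\<Union>i. A i) - ?B n \<in> sets rtree_space" "(?B n - S) \<union> (S - ?B n) \<in> sets rtree_space"
      using sets.Diff[OF U] by (blast intro: sets.Un sets.Diff)+
  qed auto
  with d S show "\<exists>n S. level_set n S \<and> measure (GW \<mu>) (((\<Union>i. A i) - S) \<union> (S - (\<Union>i. A i))) < e"
    by (intro exI[of _ m] exI[of _ S]) auto
qed

text \<open>
The approximable sets form a \<open>\<sigma>\<close>-algebra, and the offspring number of each vertex is decided by
finitely many generations.
\<close>

lemma level_approx_measurable:
  assumes "T \<in> sets rtree_space" shows "level_approx \<mu> T"
proof -
  let ?A = "{T. level_approx \<mu> T}"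
  have "sigma_algebra UNIV ?A"
    unfolding sigma_algebra_iff2
  proof (intro conjI ballI allI impI)
    show "{} \<in> ?A" by (auto intro!: level_approx_level_set[of 0] simp: level_set_def)
    show "UNIV - T \<in> ?A" if "T \<in> ?A" for T
      using that level_approx_compl[of \<mu> T] by (simp add: Compl_eq_Diff_UNIV)
    show "\<Union> (range A) \<in> ?A" if "range A \<subseteq> ?A" for A :: "nat \<Rightarrow> rtree set"
      using that level_approx_UN[of \<mu> A] by auto
  qed auto
  then have sets_eq: "sets (sigma UNIV ?A) = ?A"
    by (simp add: sigma_algebra.sigma_sets_eq)
  have "(\<lambda>t. t) \<in> sigma UNIV ?A \<rightarrow>\<^sub>M rtree_space"
  proof (rule measurable_rtree_spaceI, rule measurableI)
    fix u and B :: "nat option set"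
    have "offspring u -` B \<inter> space rtree_space \<in> sets rtree_space"
      by (rule measurable_sets[OF measurable_offspring]) simp
    then have "level_set (Suc (length u)) (offspring u -` B)"
      unfolding level_set_def using offspring_agree by auto
    then show "offspring u -` B \<inter> space (sigma UNIV ?A) \<in> sets (sigma UNIV ?A)"
      unfolding sets_eq by (auto intro: level_approx_level_set)
  qed simp
  from measurable_sets[OF this assms] show ?thesis
    unfolding sets_eq by simp
qed

text \<open>
Suppose that \<open>\<phi>\<close> and \<open>f\<close> cannot be told apart by tests that look at \<open>n\<close> generations.  Then the same
holds for the labels that they induce at the root and tests that look at \<open>n\<close> generations of each
child, because the induced label is affine in the label of each child.
\<close>

lemma hybrid_replacement:
  fixes G :: "rtree list \<Rightarrow> real"
  assumes \<phi>: "\<phi> \<in> borel_measurable rtree_space" "\<And>s. \<phi> s \<in> {0..1}"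
    and f: "f \<in> borel_measurable rtree_space" "\<And>s. f s \<in> {0..1}"
    and same: "\<And>g C. g \<in> borel_measurable rtree_space \<Longrightarrow> (\<And>s. \<bar>g s\<bar> \<le> C) \<Longrightarrow>
        (\<And>t t'. agree n t t' \<Longrightarrow> g t = g t') \<Longrightarrow>
        (\<integral>s. \<phi> s * g s \<partial>GW \<mu>) = (\<integral>s. f s * g s \<partial>GW \<mu>)"
    and G: "(\<lambda>\<tau>. G (map \<tau> [0..<m])) \<in> borel_measurable (forest \<mu>)" "\<And>ts. \<bar>G ts\<bar> \<le> C"
      "\<And>ts ts'. list_all2 (agree n) ts ts' \<Longrightarrow> G ts = G ts'"
  shows "(\<integral>\<tau>. ptail \<phi> (map \<tau> [0..<m]) k * G (map \<tau> [0..<m]) \<partial>forest \<mu>)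
       = (\<integral>\<tau>. ptail f (map \<tau> [0..<m]) k * G (map \<tau> [0..<m]) \<partial>forest \<mu>)"
  using G
proof (induction m arbitrary: G k)
  case (Suc m)
  have C: "0 \<le> C" using Suc.prems(2)[of "[]"] by linarith
  have bnd: "\<bar>ptail p ts k * G ts'\<bar> \<le> C" if "\<And>s. p s \<in> {0..1}" for p k ts ts'
    using ptail_bounds[of p ts k, OF that] Suc.prems(2)[of ts'] by (intro unit_mult_mono) auto
  have meas: "(\<lambda>\<tau>. ptail p (map \<tau> is) k * G (map \<tau> [0..<Suc m])) \<in> borel_measurable (forest \<mu>)"
    if "p \<in> borel_measurable rtree_space" for p k "is"
    using that by (intro borel_measurable_times Suc.prems(1) measurable_wsum[OF measurable_forest_component]) auto
  have Gm: "(\<lambda>\<omega>. G (s # map \<omega> [0..<m])) \<in> borel_measurable (forest \<mu>)" for s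
    using measurable_compose[OF measurable_case_nat_fixed Suc.prems(1), of s] by (simp only: map_case_nat_upt)
  \<comment> \<open>the conditional expectation given the first tree \<open>s\<close>, apart from the effect of its own label\<close>
  define R where "R p k s = (\<integral>\<omega>. ptail p (map \<omega> [0..<m]) k * G (s # map \<omega> [0..<m]) \<partial>forest \<mu>)" for p k s
  have int: "integrable (forest \<mu>) (\<lambda>\<omega>. ptail p (map \<omega> [0..<m]) k * G (s # map \<omega> [0..<m]))"
    if "p \<in> borel_measurable rtree_space" "\<And>s. p s \<in> {0..1}" for p k s
    by (rule integrable_bounded[OF prob_space_forest _ bnd])
      (intro borel_measurable_times Gm forest_wsum_measurable borel_measurable_diff borel_measurable_const that)+
  have R_meas: "R p k \<in> borel_measurable rtree_space" if p: "p \<in> borel_measurable rtree_space" "\<And>s. p s \<in> {0..1}" for p k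
  proof -
    have "(\<lambda>s. (\<integral>\<omega>. (\<lambda>\<tau>. ptail p (map \<tau> [1..<Suc m]) k * G (map \<tau> [0..<Suc m])) (case_nat s \<omega>) \<partial>forest \<mu>))
        \<in> borel_measurable (GW \<mu>)"
      by (rule measurable_forest_head[OF meas[OF p(1)] bnd]) (rule p)
    moreover have "map (case_nat s \<omega>) [1..<Suc m] = map \<omega> [0..<m]" for s :: rtree and \<omega>
      unfolding One_nat_def map_Suc_upt[symmetric] by (simp add: comp_def)
    ultimately show ?thesis
      by (simp only: map_case_nat_upt R_def[abs_def] borel_measurable_GW_iff)
  qed
  have R_bound: "\<bar>R p k s\<bar> \<le> C" if p: "p \<in> borel_measurable rtree_space" "\<And>s. p s \<in> {0..1}" for p k s
  proof -
    interpret prob_space "forest \<mu>" by (rule prob_space_forest)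
    have "\<bar>R p k s\<bar> \<le> (\<integral>\<omega>. \<bar>ptail p (map \<omega> [0..<m]) k * G (s # map \<omega> [0..<m])\<bar> \<partial>forest \<mu>)"
      unfolding R_def by (rule integral_abs_bound)
    also have "\<dots> \<le> (\<integral>\<omega>. C \<partial>forest \<mu>)"
      by (intro integral_mono integrable_abs int[OF p] bnd p) simp
    finally show ?thesis by (simp add: prob_space)
  qed
  have split: "(\<integral>\<tau>. ptail p (map \<tau> [0..<Suc m]) k * G (map \<tau> [0..<Suc m]) \<partial>forest \<mu>)
      = (\<integral>s. p s * R p (k - 1) s + (R p k s - p s * R p k s) \<partial>GW \<mu>)"
    if p: "p \<in> borel_measurable rtree_space" "\<And>s. p s \<in> {0..1}" for p
  proof -
    have "(\<integral>\<tau>. ptail p (map \<tau> [0..<Suc m]) k * G (map \<tau> [0..<Suc m]) \<partial>forest \<mu>)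
       = (\<integral>s. (\<integral>\<omega>. ptail p (map (case_nat s \<omega>) [0..<Suc m]) k * G (map (case_nat s \<omega>) [0..<Suc m]) \<partial>forest \<mu>) \<partial>GW \<mu>)"
      by (rule integral_forest_head_outer[OF meas[OF p(1)] bnd]) (rule p)
    also have "\<dots> = (\<integral>s. p s * R p (k - 1) s + (R p k s - p s * R p k s) \<partial>GW \<mu>)"
    proof (rule Bochner_Integration.integral_cong[OF refl])
      fix s
      have "(\<integral>\<omega>. ptail p (map (case_nat s \<omega>) [0..<Suc m]) k * G (map (case_nat s \<omega>) [0..<Suc m]) \<partial>forest \<mu>)
         = (\<integral>\<omega>. p s * (ptail p (map \<omega> [0..<m]) (k - 1) * G (s # map \<omega> [0..<m]))
              + (1 - p s) * (ptail p (map \<omega> [0..<m]) k * G (s # map \<omega> [0..<m])) \<partial>forest \<mu>)"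
        by (simp only: map_case_nat_upt wsum.simps distrib_right mult.assoc)
      also have "\<dots> = p s * R p (k - 1) s + (1 - p s) * R p k s"
        unfolding R_def by (simp add: int[OF p])
      finally show "(\<integral>\<omega>. ptail p (map (case_nat s \<omega>) [0..<Suc m]) k * G (map (case_nat s \<omega>) [0..<Suc m]) \<partial>forest \<mu>)
         = p s * R p (k - 1) s + (R p k s - p s * R p k s)" by (simp add: algebra_simps)
    qed
    finally show ?thesis .
  qed
  have R_eq: "R \<phi> k s = R f k s" for k s
    unfolding R_def
  proof (rule Suc.IH[where G = "\<lambda>ts. G (s # ts)"])
    show "G (s # ts) = G (s # ts')" if "list_all2 (agree n) ts ts'" for ts ts'
      using that agree_refl by (intro Suc.prems(3)) auto
  qed (use Gm Suc.prems(2) in auto)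
  \<comment> \<open>as a function of the first tree, \<open>R f k\<close> is itself a test that looks at \<open>n\<close> generations\<close>
  have R_agree: "R f k t = R f k t'" if "agree n t t'" for k t t'
  proof -
    have "G (t # ts) = G (t' # ts)" for ts
      using that agree_refl by (intro Suc.prems(3)) (auto intro: list.rel_refl)
    then show ?thesis by (simp add: R_def)
  qed
  have iR: "integrable (GW \<mu>) (R f k)" for k
    by (rule integrable_bounded[OF prob_space_GW _ R_bound[OF f]])
       (unfold borel_measurable_GW_iff, rule R_meas[OF f])
  have ipR: "integrable (GW \<mu>) (\<lambda>s. p s * R f k s)"
    if p: "p \<in> borel_measurable rtree_space" "\<And>s. p s \<in> {0..1}" for p k
    by (rule integrable_bounded[OF prob_space_GW _ unit_mult_mono[OF p(2) R_bound[OF f]]])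
       (unfold borel_measurable_GW_iff, intro borel_measurable_times R_meas[OF f] p)
  have same': "(\<integral>s. \<phi> s * R f k s \<partial>GW \<mu>) = (\<integral>s. f s * R f k s \<partial>GW \<mu>)" for k
    by (rule same[OF R_meas[OF f] R_bound[OF f] R_agree])
  have lin: "(\<integral>s. p s * R f (k - 1) s + (R f k s - p s * R f k s) \<partial>GW \<mu>)
      = (\<integral>s. p s * R f (k - 1) s \<partial>GW \<mu>) + ((\<integral>s. R f k s \<partial>GW \<mu>) - (\<integral>s. p s * R f k s \<partial>GW \<mu>))"
    if p: "p \<in> borel_measurable rtree_space" "\<And>s. p s \<in> {0..1}" for p
    by (subst Bochner_Integration.integral_add[OF ipR[OF p] Bochner_Integration.integrable_diff[OF iR ipR[OF p]]],
        subst Bochner_Integration.integral_diff[OF iR ipR[OF p]]) (rule refl)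
  show ?case
    unfolding split[OF \<phi>] split[OF f] R_eq lin[OF \<phi>] lin[OF f] same' ..
next
  case 0
  show ?case by simp
qed

text \<open>
The \<open>n\<close>-th iterate represents the conditional probability of the interpretation given the first
\<open>n\<close> generations, phrased through test functions \<open>g\<close>.
\<close>

lemma level_iterate_is_projection:
  assumes \<phi>: "\<phi> \<in> borel_measurable rtree_space" "\<And>s. \<phi> s \<in> {0..1}"
    and fp: "AE t in GW \<mu>. \<phi> t = step h \<phi> t" and x: "integral\<^sup>L (GW \<mu>) \<phi> = x" "x \<in> {0..1}"
    and g: "g \<in> borel_measurable rtree_space" "\<And>t. \<bar>g t\<bar> \<le> C" "\<And>t t'. agree n t t' \<Longrightarrow> g t = g t'"
  shows "(\<integral>t. \<phi> t * g t \<partial>GW \<mu>) = (\<integral>t. level_iterate h x n t * g t \<partial>GW \<mu>)"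
  using g
proof (induction n arbitrary: g C)
  case 0
  have "g t = g (Node [])" for t by (rule 0(3)) simp
  then obtain c where "\<And>t. g t = c" by blast
  then show ?case by (simp add: x measure_GW_UNIV)
next
  case (Suc n)
  note fm = measurable_level_iterate[of h x n] and fb = level_iterate_bounds[OF x(2), of h n]
  have inner: "(\<integral>\<tau>. ptail \<phi> (map \<tau> [0..<m]) k * g (Node (map \<tau> [0..<m])) \<partial>forest \<mu>)
      = (\<integral>\<tau>. ptail (level_iterate h x n) (map \<tau> [0..<m]) k * g (Node (map \<tau> [0..<m])) \<partial>forest \<mu>)" for m k
  proof (rule hybrid_replacement[where G = "\<lambda>ts. g (Node ts)" and n = n and C = C, OF \<phi> fm fb])
    show "(\<lambda>\<tau>. g (Node (map \<tau> [0..<m]))) \<in> borel_measurable (forest \<mu>)"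
      by (rule measurable_at_graft[OF Suc.prems(1)])
    show "g (Node ts) = g (Node ts')" if "list_all2 (agree n) ts ts'" for ts ts'
      using that by (intro Suc.prems(3)) simp
  qed (rule Suc.IH Suc.prems(2); assumption)+
  have outer: "(\<integral>t. step h p t * g t \<partial>GW \<mu>)
      = (\<integral>m. (\<integral>\<tau>. ptail p (map \<tau> [0..<m]) (h m) * g (Node (map \<tau> [0..<m])) \<partial>forest \<mu>) \<partial>measure_pmf \<mu>)"
    if p: "p \<in> borel_measurable rtree_space" "\<And>s. p s \<in> {0..1}" for p
  proof -
    have "(\<integral>t. step h p t * g t \<partial>GW \<mu>)
        = (\<integral>m. (\<integral>\<tau>. step h p (Node (map \<tau> [0..<m])) * g (Node (map \<tau> [0..<m])) \<partial>forest \<mu>) \<partial>measure_pmf \<mu>)"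
      by (rule integral_GW_branching[OF _ unit_mult_mono[OF step_bounds[OF p(2)] Suc.prems(2)]])
         (intro borel_measurable_times measurable_step p Suc.prems(1))
    then show ?thesis by (simp add: step_def num_children_def)
  qed
  have "(\<integral>t. \<phi> t * g t \<partial>GW \<mu>) = (\<integral>t. step h \<phi> t * g t \<partial>GW \<mu>)"
    using fp \<phi>(1) Suc.prems(1)
    by (intro integral_cong_AE) (auto simp: borel_measurable_GW_iff elim!: eventually_mono)
  also have "\<dots> = (\<integral>t. step h (level_iterate h x n) t * g t \<partial>GW \<mu>)"
    unfolding outer[OF \<phi>] outer[OF fm fb] inner ..
  finally show ?case by simp
qed


lemma mean_square_ge:
  fixes f :: "rtree \<Rightarrow> real"
  assumes f: "f \<in> borel_measurable rtree_space" "\<And>s. f s \<in> {0..1}" and x: "integral\<^sup>L (GW \<mu>) f = x"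
  shows "x\<^sup>2 \<le> (\<integral>s. (f s)\<^sup>2 \<partial>GW \<mu>)"
proof -
  have i: "integrable (GW \<mu>) f" by (rule integrable_GW_unit[OF f])
  have i2: "integrable (GW \<mu>) (\<lambda>s. (f s)\<^sup>2)"
    by (rule integrable_GW_unit) (use f(1) in simp, use f(2) in \<open>auto intro: power_le_one\<close>)
  interpret prob_space "GW \<mu>" by (rule prob_space_GW)
  have "0 \<le> (\<integral>s. (f s - x)\<^sup>2 \<partial>GW \<mu>)" by simp
  also have "\<dots> = (\<integral>s. (f s)\<^sup>2 + (x\<^sup>2 - 2 * x * f s) \<partial>GW \<mu>)"
    by (simp add: power2_diff algebra_simps)
  also have "\<dots> = (\<integral>s. (f s)\<^sup>2 \<partial>GW \<mu>) + (x\<^sup>2 - 2 * x * x)"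
    using i i2 by (simp add: x measure_GW_UNIV)
  finally show ?thesis by (simp add: power2_eq_square)
qed

text \<open>
The masses \<open>x - e\<close> and \<open>1 - x - e\<close> are the probabilities that two independent draws from \<open>f s\<close> are
both 1 and both 0.
\<close>

lemma mean_square_eq:
  fixes f :: "rtree \<Rightarrow> real"
  assumes f: "f \<in> borel_measurable rtree_space" "\<And>s. f s \<in> {0..1}" and x: "integral\<^sup>L (GW \<mu>) f = x"
    and e: "(\<integral>s. f s * (1 - f s) \<partial>GW \<mu>) = e"
  shows "(\<integral>s. (f s)\<^sup>2 \<partial>GW \<mu>) = x - e" "(\<integral>s. (1 - f s)\<^sup>2 \<partial>GW \<mu>) = 1 - x - e"
proof -
  have i: "integrable (GW \<mu>) f" by (rule integrable_GW_unit[OF f])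
  have iv: "integrable (GW \<mu>) (\<lambda>s. f s * (1 - f s))"
    by (rule integrable_GW_unit) (use f(1) in simp, use f(2) in \<open>auto intro: mult_le_one\<close>)
  interpret prob_space "GW \<mu>" by (rule prob_space_GW)
  have "(\<integral>s. (f s)\<^sup>2 \<partial>GW \<mu>) = (\<integral>s. f s - f s * (1 - f s) \<partial>GW \<mu>)"
    by (simp add: power2_eq_square algebra_simps)
  also have "\<dots> = x - e" using i iv by (simp add: x e)
  finally show "(\<integral>s. (f s)\<^sup>2 \<partial>GW \<mu>) = x - e" .
  have "(\<integral>s. (1 - f s)\<^sup>2 \<partial>GW \<mu>) = (\<integral>s. 1 - f s - f s * (1 - f s) \<partial>GW \<mu>)"
    by (simp add: power2_eq_square algebra_simps)
  also have "\<dots> = 1 - x - e" using i iv by (simp add: x e measure_GW_UNIV)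
  finally show "(\<integral>s. (1 - f s)\<^sup>2 \<partial>GW \<mu>) = 1 - x - e" .
qed

lemma step_variance_ge:
  fixes f :: "rtree \<Rightarrow> real"
  assumes f: "f \<in> borel_measurable rtree_space" "\<And>s. f s \<in> {0..1}" "integral\<^sup>L (GW \<mu>) f = x"
    and e: "(\<integral>s. f s * (1 - f s) \<partial>GW \<mu>) = e" and \<mu>: "\<mu> \<in> Pi_inf"
  shows "e * pivotal_mean \<mu> h (x - e) (1 - x - e) \<le> (\<integral>t. step h f t * (1 - step h f t) \<partial>GW \<mu>)"
proof -
  note [measurable] = f(1)
  have e0: "0 \<le> e" unfolding e[symmetric] using f(2) by (intro integral_nonneg_AE AE_I2) auto
  have "(\<integral>s. f s * (1 - f s) \<partial>GW \<mu>) * pivotal_mean \<mu> h (x - e) (1 - x - e) \<le> (\<integral>t. step h f t * (1 - step h f t) \<partial>GW \<mu>)"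
  proof (rule pivotal_mean_le_integral[where a = "\<lambda>s. (f s)\<^sup>2" and b = "\<lambda>s. (1 - f s)\<^sup>2"
        and a' = "\<lambda>s. (f s)\<^sup>2" and b' = "\<lambda>s. (1 - f s)\<^sup>2" and C = 1])
    show "(\<lambda>s. f s * (1 - f s)) \<in> borel_measurable rtree_space" "(\<lambda>s. (f s)\<^sup>2) \<in> borel_measurable rtree_space"
      "(\<lambda>s. (1 - f s)\<^sup>2) \<in> borel_measurable rtree_space" "(\<lambda>s. (f s)\<^sup>2) \<in> borel_measurable rtree_space"
      "(\<lambda>s. (1 - f s)\<^sup>2) \<in> borel_measurable rtree_space"
      "(\<lambda>t. step h f t * (1 - step h f t)) \<in> borel_measurable rtree_space"
      by measurable
    show "f s * (1 - f s) \<in> {0..1}" "(f s)\<^sup>2 \<in> {0..1}" "(1 - f s)\<^sup>2 \<in> {0..1}" "(f s)\<^sup>2 \<in> {0..1}" "(1 - f s)\<^sup>2 \<in> {0..1}" for s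
      using f(2)[of s] by (auto intro: mult_le_one power_le_one)
    show "\<bar>step h f t * (1 - step h f t)\<bar> \<le> 1" for t
      using step_bounds[of f h t, OF f(2)] by (auto intro: mult_le_one simp: abs_mult)
    show "pivot_sum (\<lambda>s. f s * (1 - f s)) (\<lambda>s. (f s)\<^sup>2) (\<lambda>s. (1 - f s)\<^sup>2) (\<lambda>s. (f s)\<^sup>2) (\<lambda>s. (1 - f s)\<^sup>2) pivot0
        (children t) (h (num_children t)) \<le> step h f t * (1 - step h f t)" for t
      unfolding step_def by (rule ptail_var_lower[OF f(2)])
  qed (use e0 in \<open>simp_all add: \<mu> mean_square_eq[OF f e]\<close>)
  then show ?thesis by (simp add: e)
qed

lemma integral_pmf_sums:
  fixes g :: "nat \<Rightarrow> real"
  assumes "integrable (measure_pmf \<mu>) g"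
  shows "(\<lambda>n. pmf \<mu> n * g n) sums integral\<^sup>L (measure_pmf \<mu>) g"
proof -
  have "integrable (count_space UNIV) (\<lambda>n. pmf \<mu> n * g n)"
    using assms by (simp add: measure_pmf_eq_density integrable_density)
  then have "(\<lambda>n. pmf \<mu> n * g n) sums integral\<^sup>L (count_space UNIV) (\<lambda>n. pmf \<mu> n * g n)"
    by (rule sums_integral_count_space_nat)
  also have "integral\<^sup>L (count_space UNIV) (\<lambda>n. pmf \<mu> n * g n) = integral\<^sup>L (measure_pmf \<mu>) g"
    by (simp add: measure_pmf_eq_density integral_density)
  finally show ?thesis .
qed

lemma pivotal_mean_sums:
  assumes "\<mu> \<in> Pi_inf" "0 \<le> \<alpha>" "0 \<le> \<beta>" "\<alpha> + \<beta> \<le> 1"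
  shows "(\<lambda>n. pmf \<mu> n * (real n * bsum \<alpha> \<beta> pivot0 (n - 1) (h n))) sums pivotal_mean \<mu> h \<alpha> \<beta>"
  unfolding pivotal_mean_def
  by (intro integral_pmf_sums integrable_degree_bsum assms) (auto simp: pivot0_eq)

lemma pivotal_mean_ge_partial:
  assumes "\<mu> \<in> Pi_inf" "0 \<le> \<alpha>" "0 \<le> \<beta>" "\<alpha> + \<beta> \<le> 1"
  shows "(\<Sum>n<N. pmf \<mu> n * (real n * bsum \<alpha> \<beta> pivot0 (n - 1) (h n))) \<le> pivotal_mean \<mu> h \<alpha> \<beta>"
proof -
  note s = pivotal_mean_sums[OF assms, of h]
  have "(\<Sum>n<N. pmf \<mu> n * (real n * bsum \<alpha> \<beta> pivot0 (n - 1) (h n)))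
      \<le> (\<Sum>n. pmf \<mu> n * (real n * bsum \<alpha> \<beta> pivot0 (n - 1) (h n)))"
    by (intro sum_le_suminf sums_summable[OF s] mult_nonneg_nonneg bsum_nonneg) (auto simp: assms pivot0_eq)
  then show ?thesis using sums_unique[OF s] by simp
qed

text \<open>
The quantities \<open>e n\<close> below are the mean conditional variances of the interpretation given \<open>n\<close>
generations.  Approximation by level sets forces them to 0, while near 0 they cannot decrease when
the mean number of pivotal children exceeds 1.
\<close>

theorem unstable_fixed_point_no_interpretation:
  assumes \<mu>: "\<mu> \<in> Pi_inf" and T: "T \<in> sets rtree_space"
    and fp: "AE t in GW \<mu>. indicator T t = step h (indicator T) t"
    and x: "measure (GW \<mu>) T = x" "0 < x" "x < 1"
  shows "pivotal_mean \<mu> h x (1 - x) \<le> 1"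
proof (rule ccontr)
  assume "\<not> pivotal_mean \<mu> h x (1 - x) \<le> 1"
  then have unstable: "1 < pivotal_mean \<mu> h x (1 - x)" by simp
  interpret prob_space "GW \<mu>" by (rule prob_space_GW)
  define \<phi> :: "rtree \<Rightarrow> real" where "\<phi> = indicator T"
  have \<phi>: "\<phi> \<in> borel_measurable rtree_space" "\<And>t. \<phi> t \<in> {0..1}"
    using T by (auto simp: \<phi>_def indicator_def)
  have \<phi>x: "integral\<^sup>L (GW \<mu>) \<phi> = x" using T x(1) by (simp add: \<phi>_def)
  have x01: "x \<in> {0..1}" using x by auto
  have fp': "AE t in GW \<mu>. \<phi> t = step h \<phi> t" using fp by (simp add: \<phi>_def)
  have "x = integral\<^sup>L (GW \<mu>) (step h \<phi>)"
    unfolding \<phi>x[symmetric] using fp' \<phi>(1) by (intro integral_cong_AE) (auto simp: borel_measurable_GW_iff)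
  then have fixed: "Psi \<mu> h x = x" using integral_step[OF \<phi> \<phi>x, of h] by simp
  let ?f = "level_iterate h x"
  note fm = measurable_level_iterate[of h x] and fb = level_iterate_bounds[OF x01, of h] and fi = integral_level_iterate[OF x01 fixed]
  define e where "e n = (\<integral>t. ?f n t * (1 - ?f n t) \<partial>GW \<mu>)" for n
  have e_nonneg: "0 \<le> e n" for n
    unfolding e_def using fb[of n] by (intro integral_nonneg_AE AE_I2) auto
  have sq: "(\<integral>s. (?f n s)\<^sup>2 \<partial>GW \<mu>) = x - e n" "(\<integral>s. (1 - ?f n s)\<^sup>2 \<partial>GW \<mu>) = 1 - x - e n" for n
    using mean_square_eq[OF fm fb fi, of n "e n"] by (auto simp: e_def)
  have \<alpha>: "0 < x - e n" for n
    using mean_square_ge[OF fm fb fi, of n] x by (simp add: sq) (smt (verit) zero_less_power)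
  have \<beta>: "0 < 1 - x - e n" for n
  proof -
    have "(1 - x)\<^sup>2 \<le> (\<integral>s. (1 - ?f n s)\<^sup>2 \<partial>GW \<mu>)"
    proof (rule mean_square_ge)
      show "(\<lambda>s. 1 - ?f n s) \<in> borel_measurable rtree_space" by measurable
      show "1 - ?f n s \<in> {0..1}" for s using fb[of n s] by auto
      show "(\<integral>s. 1 - ?f n s \<partial>GW \<mu>) = 1 - x"
        by (simp add: measure_GW_UNIV integrable_GW_unit[OF fm fb] fi)
    qed
    moreover have "0 < (1 - x)\<^sup>2" using x by simp
    ultimately show ?thesis unfolding sq by linarith
  qed
  have ab1: "(x - e n) + (1 - x - e n) \<le> 1" for n using e_nonneg[of n] by simp
  have e_Suc: "e n * pivotal_mean \<mu> h (x - e n) (1 - x - e n) \<le> e (Suc n)" for n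
    using step_variance_ge[OF fm fb fi _ \<mu>, of n "e n" h] by (simp add: e_def)
  let ?term = "\<lambda>\<alpha> \<beta> i. pmf \<mu> i * (real i * bsum \<alpha> \<beta> pivot0 (i - 1) (h i))"
  have sums: "?term x (1 - x) sums pivotal_mean \<mu> h x (1 - x)"
    using x by (intro pivotal_mean_sums[OF \<mu>]) auto
  then have "\<forall>\<^sub>F N in sequentially. 1 < (\<Sum>i<N. ?term x (1 - x) i)"
    unfolding sums_def using unstable by (rule order_tendstoD)
  \<comment> \<open>passing to a finite partial sum that exceeds 1 makes continuity in the weights evident\<close>
  then obtain N where N: "1 < (\<Sum>i<N. ?term x (1 - x) i)"
    by (auto simp: eventually_sequentially)
  \<comment> \<open>the iterates never become deterministic: some term of the partial sum stays positive\<close>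
  have e_pos: "0 < e n" for n
  proof (induction n)
    case 0
    show ?case using x by (simp add: e_def measure_GW_UNIV)
  next
    case (Suc n)
    obtain i where i: "i < N" "0 < ?term x (1 - x) i"
    proof (rule ccontr)
      assume "\<not> thesis"
      then have "?term x (1 - x) i \<le> 0" if "i < N" for i
        using that \<open>\<And>i. i < N \<Longrightarrow> 0 < ?term x (1 - x) i \<Longrightarrow> thesis\<close> by (meson not_less)
      then have "(\<Sum>i<N. ?term x (1 - x) i) \<le> 0" by (intro sum_nonpos) auto
      with N show False by simp
    qed
    moreover have "0 \<le> bsum x (1 - x) pivot0 (i - 1) (h i)"
      using x by (intro bsum_nonneg) (auto simp: pivot0_eq)
    ultimately have "0 < pmf \<mu> i" "0 < real i" "0 < bsum x (1 - x) pivot0 (i - 1) (h i)"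
      using pmf_nonneg[of \<mu> i] by (auto simp: zero_less_mult_iff)
    moreover from this(3) have "0 < bsum (x - e n) (1 - x - e n) pivot0 (i - 1) (h i)"
      by (rule bsum_pos_transfer) (use \<alpha>[of n] \<beta>[of n] x in \<open>auto simp: pivot0_eq\<close>)
    ultimately have "0 < ?term (x - e n) (1 - x - e n) i"
      by (intro mult_pos_pos)
    also have "\<dots> \<le> (\<Sum>i<N. ?term (x - e n) (1 - x - e n) i)"
      using i(1) \<alpha>[of n] \<beta>[of n]
      by (intro member_le_sum mult_nonneg_nonneg bsum_nonneg) (auto simp: pivot0_eq)
    also have "\<dots> \<le> pivotal_mean \<mu> h (x - e n) (1 - x - e n)"
      using \<alpha>[of n] \<beta>[of n] by (intro pivotal_mean_ge_partial \<mu> ab1) auto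
    finally show ?case using Suc e_Suc[of n] by (smt (verit) mult_pos_pos)
  qed
  \<comment> \<open>\<open>?f m\<close> is the best mean-square predictor of \<open>\<phi>\<close> from \<open>m\<close> generations, hence better than \<open>S\<close>\<close>
  have e_small: "\<exists>n. \<forall>m\<ge>n. e m < d" if d: "0 < d" for d
  proof -
    obtain n S where S: "level_set n S" "measure (GW \<mu>) ((T - S) \<union> (S - T)) < d"
      using level_approxD[OF level_approx_measurable[OF T] d] by blast
    have "e m < d" if "n \<le> m" for m
    proof -
      have Sm: "level_set m S" using level_set_mono[OF that S(1)] .
      have Ss[measurable]: "S \<in> sets rtree_space" using S by (simp add: level_set_def)
      define g :: "rtree \<Rightarrow> real" where "g = indicator S"
      have gm[measurable]: "g \<in> borel_measurable rtree_space" and gb: "g t \<in> {0..1}" for t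
        by (auto simp: g_def indicator_def)
      have geq: "(\<integral>t. \<phi> t * g t \<partial>GW \<mu>) = (\<integral>t. ?f m t * g t \<partial>GW \<mu>)"
      proof (rule level_iterate_is_projection[OF \<phi> fp' \<phi>x x01 gm])
        show "\<bar>g t\<bar> \<le> 1" for t using gb[of t] by auto
        show "g t = g t'" if "agree m t t'" for t t'
          using Sm that agree_sym[OF that] by (auto simp: level_set_def g_def indicator_def)
      qed
      have ig: "integrable (GW \<mu>) (\<lambda>t. p t * g t)" if "p \<in> borel_measurable rtree_space" "\<And>t. p t \<in> {0..1}" for p :: "rtree \<Rightarrow> real"
        using that gb by (intro integrable_GW_unit borel_measurable_times gm) (auto intro: mult_le_one)
      have i2: "integrable (GW \<mu>) (\<lambda>t. (p t)\<^sup>2)" if "p \<in> borel_measurable rtree_space" "\<And>t. p t \<in> {0..1}" for p :: "rtree \<Rightarrow> real"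
        using that by (intro integrable_GW_unit borel_measurable_power) (auto intro: power_le_one)
      have expand: "(\<integral>t. (p t - g t)\<^sup>2 \<partial>GW \<mu>) = (\<integral>t. (p t)\<^sup>2 \<partial>GW \<mu>) + ((\<integral>t. (g t)\<^sup>2 \<partial>GW \<mu>) - 2 * (\<integral>t. p t * g t \<partial>GW \<mu>))"
        if p: "p \<in> borel_measurable rtree_space" "\<And>t. p t \<in> {0..1}" for p :: "rtree \<Rightarrow> real"
      proof -
        have "(\<integral>t. (p t - g t)\<^sup>2 \<partial>GW \<mu>) = (\<integral>t. (p t)\<^sup>2 + ((g t)\<^sup>2 - 2 * (p t * g t)) \<partial>GW \<mu>)"
          by (simp add: power2_diff algebra_simps)
        then show ?thesis using i2[OF p] i2[OF gm gb] ig[OF p] by simp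
      qed
      have "\<phi> t = (\<phi> t)\<^sup>2" for t by (auto simp: \<phi>_def indicator_def)
      then have \<phi>2: "(\<integral>t. (\<phi> t)\<^sup>2 \<partial>GW \<mu>) = x" using \<phi>x by simp
      have "0 \<le> (\<integral>t. (?f m t - g t)\<^sup>2 \<partial>GW \<mu>)" by simp
      then have "e m \<le> (\<integral>t. (\<phi> t - g t)\<^sup>2 \<partial>GW \<mu>)"
        unfolding expand[OF fm fb] expand[OF \<phi>] geq \<phi>2 sq by simp
      also have "\<dots> = (\<integral>t. indicator ((T - S) \<union> (S - T)) t \<partial>GW \<mu>)"
        by (rule Bochner_Integration.integral_cong) (auto simp: \<phi>_def g_def indicator_def)
      also have "\<dots> = measure (GW \<mu>) ((T - S) \<union> (S - T))"
        by simp
      also note S(2)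
      finally show ?thesis .
    qed
    then show ?thesis by blast
  qed
  define K where "K d = (\<Sum>i<N. ?term (x - d) (1 - x - d) i)" for d
  have "continuous_on UNIV K"
    unfolding K_def[abs_def] by (intro continuous_intros)
  then have "(K \<longlongrightarrow> K 0) (at 0)" by (simp add: continuous_on_def)
  moreover have "1 < K 0" using N by (simp add: K_def)
  ultimately have "\<forall>\<^sub>F d in at 0. 1 < K d" by (rule order_tendstoD)
  then obtain d0 where d0: "0 < d0" "\<And>d. d \<noteq> 0 \<Longrightarrow> dist d 0 < d0 \<Longrightarrow> 1 < K d"
    unfolding eventually_at by auto
  obtain n where n: "\<And>m. n \<le> m \<Longrightarrow> e m < d0" using e_small[OF d0(1)] by blast
  have mono: "e m \<le> e (Suc m)" if "n \<le> m" for m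
  proof -
    have "1 \<le> K (e m)" using d0(2)[of "e m"] e_pos[of m] n[OF that] by simp
    also have "\<dots> \<le> pivotal_mean \<mu> h (x - e m) (1 - x - e m)"
      unfolding K_def using \<alpha>[of m] \<beta>[of m] by (intro pivotal_mean_ge_partial \<mu> ab1) auto
    finally have "e m * 1 \<le> e m * pivotal_mean \<mu> h (x - e m) (1 - x - e m)"
      using e_nonneg by (intro mult_left_mono)
    also note e_Suc
    finally show ?thesis by simp
  qed
  have ge: "e n \<le> e m" if "n \<le> m" for m
    using that by (induction m rule: dec_induct) (auto intro: order_trans mono)
  obtain n' where "\<And>m. n' \<le> m \<Longrightarrow> e m < e n" using e_small[OF e_pos] by blast
  then have "e (max n n') < e n" by (meson max.cobounded2)
  moreover have "e n \<le> e (max n n')" by (rule ge) simp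
  ultimately show False by simp
qed


section \<open>The automaton map as a smooth function\<close>

lemma binomial_tail:
  assumes x: "x \<in> {0..1}"
  shows "measure_pmf.prob (binomial_pmf n x) {k. k \<ge> j} = bsum x (1 - x) tail0 n j"
proof (induction n arbitrary: j)
  case 0
  show ?case using x by (simp add: binomial_pmf_0 tail0_def)
next
  case (Suc n)
  have eq: "binomial_pmf (Suc n) x = bernoulli_pmf x \<bind> (\<lambda>b. map_pmf (\<lambda>k. (if b then 1 else 0) + k) (binomial_pmf n x))"
    using x by (simp add: binomial_pmf_Suc map_pmf_def)
  let ?E = "\<lambda>b. emeasure (map_pmf (\<lambda>k. (if b then 1 else 0) + k) (binomial_pmf n x)) {k. k \<ge> j}"
  have t: "?E True = ennreal (bsum x (1 - x) tail0 n (j - 1))"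
  proof -
    have "?E True = ennreal (measure_pmf.prob (binomial_pmf n x) {k. k \<ge> j - 1})"
      unfolding measure_pmf.emeasure_eq_measure measure_map_pmf
      by (rule arg_cong[where f = "\<lambda>A. ennreal (measure_pmf.prob _ A)"]) auto
    then show ?thesis by (simp add: Suc)
  qed
  have f: "?E False = ennreal (bsum x (1 - x) tail0 n j)"
  proof -
    have "?E False = ennreal (measure_pmf.prob (binomial_pmf n x) {k. k \<ge> j})"
      unfolding measure_pmf.emeasure_eq_measure measure_map_pmf
      by (rule arg_cong[where f = "\<lambda>A. ennreal (measure_pmf.prob _ A)"]) auto
    then show ?thesis by (simp add: Suc)
  qed
  have nn: "0 \<le> bsum x (1 - x) tail0 m j" for m j
    using x by (intro bsum_nonneg) (auto simp: tail0_def)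
  have "ennreal (measure_pmf.prob (binomial_pmf (Suc n) x) {k. k \<ge> j}) = ?E True * x + ?E False * (1 - x)"
    unfolding measure_pmf.emeasure_eq_measure[symmetric] eq using x by (simp only: emeasure_bind_pmf) simp
  also have "\<dots> = ennreal (bsum x (1 - x) tail0 (Suc n) j)"
    unfolding t f using x nn by (simp add: mult.commute flip: ennreal_mult ennreal_plus)
  finally show ?case
    using nn[of "Suc n" j] by (simp del: bsum.simps)
qed

lemma tail0_abs: "\<bar>tail0 k\<bar> \<le> 1" by (simp add: tail0_def)
lemma pivot0_abs: "\<bar>pivot0 k\<bar> \<le> 1" by (simp add: pivot0_eq)
lemma bdiff_pivot0_abs: "\<bar>bdiff pivot0 k\<bar> \<le> 1" by (simp add: bdiff_pivot0_eq)

lemma bsum_unit_abs_le: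
  assumes "x \<in> {0..1}" "\<And>k. \<bar>c k\<bar> \<le> m"
  shows "\<bar>bsum x (1 - x) c n k\<bar> \<le> m"
  using assms by (intro bsum_abs_le) auto

text \<open>
A common form for \<open>\<Psi>\<close> and its first two derivatives: by \<open>DERIV_bsum\<close>, differentiation multiplies
the weight \<open>w n\<close> by \<open>m n\<close>, differences \<open>c\<close> and lowers \<open>m n\<close> by 1.
\<close>

definition bmix :: "nat pmf \<Rightarrow> (nat \<Rightarrow> real) \<Rightarrow> (nat \<Rightarrow> real) \<Rightarrow> (nat \<Rightarrow> nat) \<Rightarrow> (nat \<Rightarrow> nat) \<Rightarrow> real \<Rightarrow> real" where
  "bmix \<mu> w c m h x = (\<integral>n. w n * bsum x (1 - x) c (m n) (h n) \<partial>measure_pmf \<mu>)"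

lemma integrable_bmix:
  assumes w: "integrable (measure_pmf \<mu>) w" and c: "\<And>k. \<bar>c k\<bar> \<le> 1" and x: "x \<in> {0..1}"
  shows "integrable (measure_pmf \<mu>) (\<lambda>n. w n * bsum x (1 - x) c (m n) (h n))"
proof (rule Bochner_Integration.integrable_bound[OF w])
  show "AE n in measure_pmf \<mu>. norm (w n * bsum x (1 - x) c (m n) (h n)) \<le> norm (w n)"
  proof (rule AE_I2)
    fix n
    have "\<bar>bsum x (1 - x) c (m n) (h n)\<bar> \<le> 1" by (rule bsum_unit_abs_le[OF x c])
    then show "norm (w n * bsum x (1 - x) c (m n) (h n)) \<le> norm (w n)"
      by (simp add: abs_mult mult_left_le)
  qed
qed simp

lemma uniform_limit_bmix:
  assumes w: "integrable (measure_pmf \<mu>) w" and c: "\<And>k. \<bar>c k\<bar> \<le> 1"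
  shows "uniform_limit {0..1} (\<lambda>N x. \<Sum>n<N. pmf \<mu> n * (w n * bsum x (1 - x) c (m n) (h n)))
    (bmix \<mu> w c m h) sequentially"
proof -
  have "uniform_limit {0..1} (\<lambda>N x. \<Sum>n<N. pmf \<mu> n * (w n * bsum x (1 - x) c (m n) (h n)))
    (\<lambda>x. \<Sum>n. pmf \<mu> n * (w n * bsum x (1 - x) c (m n) (h n))) sequentially"
  proof (rule Weierstrass_m_test)
    show "summable (\<lambda>n. pmf \<mu> n * \<bar>w n\<bar>)"
      using integral_pmf_sums[of \<mu> "\<lambda>n. \<bar>w n\<bar>"] w by (auto dest: sums_summable)
    fix n and x :: real assume "x \<in> {0..1}"
    then have "\<bar>bsum x (1 - x) c (m n) (h n)\<bar> \<le> 1" by (rule bsum_unit_abs_le[OF _ c])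
    then show "norm (pmf \<mu> n * (w n * bsum x (1 - x) c (m n) (h n))) \<le> pmf \<mu> n * \<bar>w n\<bar>"
      by (auto simp: abs_mult intro!: mult_left_mono mult_left_le)
  qed
  moreover have "(\<Sum>n. pmf \<mu> n * (w n * bsum x (1 - x) c (m n) (h n))) = bmix \<mu> w c m h x" if "x \<in> {0..1}" for x
    unfolding bmix_def by (rule sums_unique[symmetric, OF integral_pmf_sums[OF integrable_bmix[OF w c that]]])
  ultimately show ?thesis
    by (metis (no_types, lifting) uniform_limit_cong')
qed

lemma continuous_on_bmix:
  assumes "integrable (measure_pmf \<mu>) w" "\<And>k. \<bar>c k\<bar> \<le> 1"
  shows "continuous_on {0..1} (bmix \<mu> w c m h)"
  by (rule uniform_limit_theorem[OF _ uniform_limit_bmix[OF assms]])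
    (auto intro!: continuous_intros always_eventually)

lemma has_derivative_bmix:
  assumes w: "integrable (measure_pmf \<mu>) w" and wm: "integrable (measure_pmf \<mu>) (\<lambda>n. w n * real (m n))"
    and c: "\<And>k. \<bar>c k\<bar> \<le> 1" and c': "\<And>k. \<bar>bdiff c k\<bar> \<le> 1" and x: "x \<in> {0..1}"
  shows "(bmix \<mu> w c m h has_real_derivative bmix \<mu> (\<lambda>n. w n * real (m n)) (bdiff c) (\<lambda>n. m n - 1) h x) (at x within {0..1})"
proof -
  let ?f = "\<lambda>n x. pmf \<mu> n * (w n * bsum x (1 - x) c (m n) (h n))"
  have "\<exists>g. \<forall>x\<in>{0..1}. (\<lambda>n. ?f n x) sums g x \<and>
      (g has_field_derivative bmix \<mu> (\<lambda>n. w n * real (m n)) (bdiff c) (\<lambda>n. m n - 1) h x) (at x within {0..1})"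
  proof (rule has_field_derivative_series)
    show "uniform_limit {0..1} (\<lambda>N x. \<Sum>n<N. pmf \<mu> n * ((w n * real (m n)) * bsum x (1 - x) (bdiff c) (m n - 1) (h n)))
      (bmix \<mu> (\<lambda>n. w n * real (m n)) (bdiff c) (\<lambda>n. m n - 1) h) sequentially"
      by (rule uniform_limit_bmix[OF wm c'])
    show "(?f n has_real_derivative pmf \<mu> n * ((w n * real (m n)) * bsum x (1 - x) (bdiff c) (m n - 1) (h n))) (at x within {0..1})" for n x
      by (auto intro!: derivative_eq_intros DERIV_bsum)
    show "summable (\<lambda>n. ?f n 0)"
      by (rule sums_summable[OF integral_pmf_sums[OF integrable_bmix[OF w c]]]) simp
  qed auto
  then obtain g where g: "\<And>x. x \<in> {0..1} \<Longrightarrow> (\<lambda>n. ?f n x) sums g x"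
    "\<And>x. x \<in> {0..1} \<Longrightarrow> (g has_field_derivative bmix \<mu> (\<lambda>n. w n * real (m n)) (bdiff c) (\<lambda>n. m n - 1) h x) (at x within {0..1})"
    by blast
  have "g y = bmix \<mu> w c m h y" if "y \<in> {0..1}" for y
    using sums_unique2[OF g(1)[OF that] integral_pmf_sums[OF integrable_bmix[OF w c that]]]
    by (simp add: bmix_def)
  then show ?thesis
    using g(2)[OF x] x by (auto intro: has_field_derivative_transform_within[where d = 1])
qed

text \<open>
The first and second derivatives of \<open>Psi \<mu> h\<close> on the unit interval.
\<close>

definition Psi1 :: "nat pmf \<Rightarrow> (nat \<Rightarrow> nat) \<Rightarrow> real \<Rightarrow> real" where
  "Psi1 \<mu> h = bmix \<mu> real pivot0 (\<lambda>n. n - 1) h"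

definition Psi2 :: "nat pmf \<Rightarrow> (nat \<Rightarrow> nat) \<Rightarrow> real \<Rightarrow> real" where
  "Psi2 \<mu> h = bmix \<mu> (\<lambda>n. real n * real (n - 1)) (bdiff pivot0) (\<lambda>n. n - 1 - 1) h"

lemma Psi_eq_bmix: "Psi \<mu> h = bmix \<mu> (\<lambda>_. 1) tail0 (\<lambda>n. n) h"
  by (simp add: fun_eq_iff Psi_def bmix_def)

lemma pivotal_mean_eq_Psi1: "pivotal_mean \<mu> h x (1 - x) = Psi1 \<mu> h x"
  by (simp add: pivotal_mean_def Psi1_def bmix_def)

lemma integrable_moment: "\<mu> \<in> Pi_inf \<Longrightarrow> integrable (measure_pmf \<mu>) (\<lambda>n. real n ^ j)"
  by (simp add: Pi_inf_def)

lemma integrable_degree: "\<mu> \<in> Pi_inf \<Longrightarrow> integrable (measure_pmf \<mu>) real"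
  using integrable_moment[of \<mu> 1] by simp

lemma falling_le_square: "real n * real (n - 1) \<le> real n ^ 2"
  by (simp add: power2_eq_square mult_left_mono)

lemma integrable_falling: "\<mu> \<in> Pi_inf \<Longrightarrow> integrable (measure_pmf \<mu>) (\<lambda>n. real n * real (n - 1))"
  using falling_le_square
  by (intro Bochner_Integration.integrable_bound[OF integrable_moment[of \<mu> 2]] AE_I2) auto

lemma DERIV_Psi:
  assumes "\<mu> \<in> Pi_inf" "x \<in> {0..1}"
  shows "(Psi \<mu> h has_real_derivative Psi1 \<mu> h x) (at x within {0..1})"
  using has_derivative_bmix[of \<mu> "\<lambda>_. 1" "\<lambda>n. n" tail0 x h] integrable_degree[OF assms(1)] assms(2)
  by (simp add: tail0_abs pivot0_abs Psi_eq_bmix Psi1_def)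

lemma DERIV_Psi1:
  assumes "\<mu> \<in> Pi_inf" "x \<in> {0..1}"
  shows "(Psi1 \<mu> h has_real_derivative Psi2 \<mu> h x) (at x within {0..1})"
  unfolding Psi1_def Psi2_def
  by (intro has_derivative_bmix pivot0_abs bdiff_pivot0_abs integrable_degree integrable_falling assms)

lemma continuous_on_Psi1: "\<mu> \<in> Pi_inf \<Longrightarrow> continuous_on {0..1} (Psi1 \<mu> h)"
  unfolding Psi1_def by (intro continuous_on_bmix integrable_degree pivot0_abs)

lemma continuous_on_Psi2: "\<mu> \<in> Pi_inf \<Longrightarrow> continuous_on {0..1} (Psi2 \<mu> h)"
  unfolding Psi2_def by (intro continuous_on_bmix integrable_falling bdiff_pivot0_abs)

lemma continuous_on_Psi: "\<mu> \<in> Pi_inf \<Longrightarrow> continuous_on {0..1} (Psi \<mu> h)"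
  unfolding Psi_eq_bmix by (intro continuous_on_bmix tail0_abs) simp

lemma automaton_map_eq_Psi:
  assumes "x \<in> {0..1}"
  shows "automaton_map \<mu> h x = Psi \<mu> h x"
proof -
  have "(\<lambda>n. pmf \<mu> n * (1 * bsum x (1 - x) tail0 n (h n))) sums Psi \<mu> h x"
    unfolding Psi_eq_bmix bmix_def
    by (rule integral_pmf_sums[OF integrable_bmix[OF _ tail0_abs assms]]) simp
  then show ?thesis
    by (simp add: automaton_map_def binomial_tail[OF assms] sums_iff)
qed

lemma Psi_0:
  assumes "\<And>n. h n \<ge> 1"
  shows "Psi \<mu> h 0 = 0"
proof -
  have "tail0 (h n) = 0" for n
    using assms[of n] by (simp add: tail0_def)
  then show ?thesis by (simp add: Psi_def bsum_0)
qed

lemma Psi_mean_value: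
  assumes \<mu>: "\<mu> \<in> Pi_inf" and ab: "0 \<le> a" "a < b" "b \<le> 1"
  shows "\<exists>\<xi>. a < \<xi> \<and> \<xi> < b \<and> Psi \<mu> h b - Psi \<mu> h a = Psi1 \<mu> h \<xi> * (b - a)"
    and "\<exists>\<xi>. a < \<xi> \<and> \<xi> < b \<and> Psi1 \<mu> h b - Psi1 \<mu> h a = Psi2 \<mu> h \<xi> * (b - a)"
proof -
  have *: "\<exists>\<xi>. a < \<xi> \<and> \<xi> < b \<and> f b - f a = f' \<xi> * (b - a)"
    if "\<And>x. x \<in> {0..1} \<Longrightarrow> (f has_real_derivative f' x) (at x within {0..1})" for f f'
  proof -
    have "(f has_derivative (\<lambda>h. f' x * h)) (at x within {a..b})" if "a \<le> x" "x \<le> b" for x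
      using \<open>\<And>x. x \<in> {0..1} \<Longrightarrow> (f has_real_derivative f' x) (at x within {0..1})\<close>[of x] that ab
      by (auto simp: has_field_derivative_def intro: has_derivative_subset)
    from mvt_simple[OF ab(2) this] show ?thesis by auto
  qed
  show "\<exists>\<xi>. a < \<xi> \<and> \<xi> < b \<and> Psi \<mu> h b - Psi \<mu> h a = Psi1 \<mu> h \<xi> * (b - a)"
    by (rule *[OF DERIV_Psi[OF \<mu>]])
  show "\<exists>\<xi>. a < \<xi> \<and> \<xi> < b \<and> Psi1 \<mu> h b - Psi1 \<mu> h a = Psi2 \<mu> h \<xi> * (b - a)"
    by (rule *[OF DERIV_Psi1[OF \<mu>]])
qed

section \<open>Dependence on the child distribution\<close>

text \<open>
The metric \<open>d_moment j\<close> ignores the mass at 0, which is harmless because \<open>v 0 = 0\<close> for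
\<open>j \<ge> 1\<close>.
\<close>

lemma moment_dist_bound:
  assumes \<mu>: "\<mu> \<in> Pi_inf" and \<pi>: "\<pi> \<in> Pi_inf" and j: "j \<ge> 1" and v: "\<And>n. \<bar>v n\<bar> \<le> real n ^ j"
  shows "\<bar>(\<integral>n. v n \<partial>measure_pmf \<pi>) - (\<integral>n. v n \<partial>measure_pmf \<mu>)\<bar> \<le> d_moment j \<pi> \<mu>"
proof -
  let ?F = "\<lambda>n. real n ^ j * \<bar>pmf \<pi> n - pmf \<mu> n\<bar>"
  have int: "integrable (measure_pmf \<nu>) v" if "\<nu> \<in> Pi_inf" for \<nu>
    by (rule Bochner_Integration.integrable_bound[OF integrable_moment[OF that, of j]]) (auto simp: v)
  have diff: "(\<lambda>n. pmf \<pi> n * v n - pmf \<mu> n * v n) sums ((\<integral>n. v n \<partial>measure_pmf \<pi>) - (\<integral>n. v n \<partial>measure_pmf \<mu>))"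
    by (intro sums_diff integral_pmf_sums int \<mu> \<pi>)
  have "infsum ?F UNIV = d_moment j \<pi> \<mu>"
    unfolding d_moment_def using j by (intro infsum_cong_neutral) auto
  then have F: "?F sums d_moment j \<pi> \<mu>"
    using has_sum_imp_sums[OF has_sum_infsum[OF d_moment_summable[OF \<pi> \<mu>, of j UNIV]]] by simp
  have le: "\<bar>pmf \<pi> n * v n - pmf \<mu> n * v n\<bar> \<le> ?F n" for n
  proof -
    have "\<bar>pmf \<pi> n * v n - pmf \<mu> n * v n\<bar> = \<bar>v n\<bar> * \<bar>pmf \<pi> n - pmf \<mu> n\<bar>"
      by (simp add: abs_mult[symmetric] algebra_simps)
    then show ?thesis using v[of n] by (simp add: mult_right_mono)
  qed
  have s: "summable (\<lambda>n. \<bar>pmf \<pi> n * v n - pmf \<mu> n * v n\<bar>)"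
    by (rule summable_comparison_test[OF _ sums_summable[OF F]]) (use le in auto)
  have "\<bar>\<Sum>n. pmf \<pi> n * v n - pmf \<mu> n * v n\<bar> \<le> (\<Sum>n. \<bar>pmf \<pi> n * v n - pmf \<mu> n * v n\<bar>)"
    by (rule summable_rabs[OF s])
  also have "\<dots> \<le> (\<Sum>n. ?F n)" by (intro suminf_le le s sums_summable[OF F])
  finally show ?thesis using sums_unique[OF F] sums_unique[OF diff] by simp
qed

lemma Psi1_dist:
  assumes "\<mu> \<in> Pi_inf" "\<pi> \<in> Pi_inf" "x \<in> {0..1}"
  shows "\<bar>Psi1 \<pi> h x - Psi1 \<mu> h x\<bar> \<le> d_moment 1 \<pi> \<mu>"
  unfolding Psi1_def bmix_def
proof (rule moment_dist_bound[OF assms(1,2)])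
  fix n
  have "\<bar>bsum x (1 - x) pivot0 (n - 1) (h n)\<bar> \<le> 1" by (rule bsum_unit_abs_le[OF assms(3) pivot0_abs])
  then show "\<bar>real n * bsum x (1 - x) pivot0 (n - 1) (h n)\<bar> \<le> real n ^ 1"
    by (simp add: abs_mult mult_left_le)
qed simp

lemma Psi2_dist:
  assumes "\<mu> \<in> Pi_inf" "\<pi> \<in> Pi_inf" "x \<in> {0..1}"
  shows "\<bar>Psi2 \<pi> h x - Psi2 \<mu> h x\<bar> \<le> d_moment 2 \<pi> \<mu>"
  unfolding Psi2_def bmix_def
proof (rule moment_dist_bound[OF assms(1,2)])
  fix n
  have "\<bar>bsum x (1 - x) (bdiff pivot0) (n - 1 - 1) (h n)\<bar> \<le> 1" by (rule bsum_unit_abs_le[OF assms(3) bdiff_pivot0_abs])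
  then have "\<bar>real n * real (n - 1) * bsum x (1 - x) (bdiff pivot0) (n - 1 - 1) (h n)\<bar> \<le> real n * real (n - 1)"
    by (simp add: abs_mult mult_left_le)
  then show "\<bar>real n * real (n - 1) * bsum x (1 - x) (bdiff pivot0) (n - 1 - 1) (h n)\<bar> \<le> real n ^ 2"
    using falling_le_square[of n] by linarith
qed simp

lemma openin_moment_balls:
  assumes "\<mu> \<in> Pi_inf"
  shows "openin Pi_inf_topology {\<pi> \<in> Pi_inf. d_moment j \<pi> \<mu> < \<delta>}"
proof -
  interpret Metric_space Pi_inf "d_moment j" by (rule Metric_space_d_moment)
  let ?X = "product_topology (\<lambda>n. Metric_space.mtopology Pi_inf (d_moment n)) (UNIV :: nat set)"
  have "openin ?X {f \<in> topspace ?X. f j \<in> mball \<mu> \<delta>}"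
    by (rule openin_continuous_map_preimage[OF continuous_map_product_projection]) auto
  moreover have "{\<pi> \<in> Pi_inf. d_moment j \<pi> \<mu> < \<delta>} = (\<lambda>\<pi> n. \<pi>) -` {f \<in> topspace ?X. f j \<in> mball \<mu> \<delta>} \<inter> Pi_inf"
    using assms by (auto simp: mball_def commute Metric_space.topspace_mtopology[OF Metric_space_d_moment])
  ultimately show ?thesis
    unfolding Pi_inf_topology_def openin_pullback_topology by blast
qed

text \<open>
Sequential convergence in all the metrics at once is convergence in the product topology.
\<close>

lemma eventually_in_neighbourhood:
  assumes U: "openin Pi_inf_topology U" "\<mu> \<in> U" and s: "\<And>j. \<sigma> j \<in> Pi_inf"
    and lim: "\<And>n. (\<lambda>j. d_moment n (\<sigma> j) \<mu>) \<longlonglongrightarrow> 0"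
  shows "\<forall>\<^sub>F j in sequentially. \<sigma> j \<in> U"
proof -
  let ?X = "product_topology (\<lambda>n. Metric_space.mtopology Pi_inf (d_moment n)) (UNIV :: nat set)"
  obtain V where V: "openin ?X V" "U = (\<lambda>\<mu> n. \<mu>) -` V \<inter> Pi_inf"
    using U(1) unfolding Pi_inf_topology_def openin_pullback_topology by blast
  have \<mu>: "\<mu> \<in> Pi_inf" using U(2) V(2) by auto
  have "limitin ?X (\<lambda>j n. \<sigma> j) (\<lambda>n. \<mu>) sequentially"
    unfolding limitin_componentwise
  proof (intro conjI ballI)
    show "limitin (Metric_space.mtopology Pi_inf (d_moment n)) (\<lambda>j. \<sigma> j) \<mu> sequentially" for n
      unfolding Metric_space.limitin_metric[OF Metric_space_d_moment]
      using \<mu> s order_tendstoD(2)[OF lim] by auto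
  qed (auto simp: s PiE_iff Metric_space.topspace_mtopology[OF Metric_space_d_moment])
  then have "\<forall>\<^sub>F j in sequentially. (\<lambda>n. \<sigma> j) \<in> V"
    using V U(2) by (auto simp: limitin_def)
  then show ?thesis by (rule eventually_mono) (simp add: V(2) s)
qed

text \<open>
The convex combination \<open>(1 - s) \<mu> + s \<nu>\<close>.  Perturbations of this form converge to \<open>\<mu>\<close> in every
\<open>d_moment n\<close>, and \<open>Psi\<close>, \<open>Psi1\<close>, \<open>Psi2\<close> are affine in them.
\<close>

definition mix :: "real \<Rightarrow> nat pmf \<Rightarrow> nat pmf \<Rightarrow> nat pmf" where
  "mix s \<mu> \<nu> = bind_pmf (bernoulli_pmf s) (\<lambda>b. if b then \<nu> else \<mu>)"

lemma pmf_mix: "s \<in> {0..1} \<Longrightarrow> pmf (mix s \<mu> \<nu>) n = (1 - s) * pmf \<mu> n + s * pmf \<nu> n"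
  by (simp add: mix_def pmf_bind)

lemma integrable_pmf_iff:
  fixes g :: "nat \<Rightarrow> real"
  shows "integrable (measure_pmf \<mu>) g \<longleftrightarrow> integrable (count_space UNIV) (\<lambda>n. pmf \<mu> n * g n)"
  by (simp add: measure_pmf_eq_density integrable_density)

lemma
  fixes g :: "nat \<Rightarrow> real"
  assumes s: "s \<in> {0..1}" and g: "integrable (measure_pmf \<mu>) g" "integrable (measure_pmf \<nu>) g"
  shows integrable_mix: "integrable (measure_pmf (mix s \<mu> \<nu>)) g"
    and integral_mix: "(\<integral>n. g n \<partial>measure_pmf (mix s \<mu> \<nu>)) = (1 - s) * (\<integral>n. g n \<partial>measure_pmf \<mu>) + s * (\<integral>n. g n \<partial>measure_pmf \<nu>)"
proof -
  have eq: "pmf (mix s \<mu> \<nu>) n * g n = (1 - s) * (pmf \<mu> n * g n) + s * (pmf \<nu> n * g n)" for n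
    by (simp add: pmf_mix[OF s] algebra_simps)
  show i: "integrable (measure_pmf (mix s \<mu> \<nu>)) g"
    using g by (simp only: integrable_pmf_iff eq Bochner_Integration.integrable_add integrable_mult_right)
  have "(\<lambda>n. pmf (mix s \<mu> \<nu>) n * g n) sums ((1 - s) * (\<integral>n. g n \<partial>measure_pmf \<mu>) + s * (\<integral>n. g n \<partial>measure_pmf \<nu>))"
    unfolding eq by (intro sums_add sums_mult integral_pmf_sums g)
  with integral_pmf_sums[OF i]
  show "(\<integral>n. g n \<partial>measure_pmf (mix s \<mu> \<nu>)) = (1 - s) * (\<integral>n. g n \<partial>measure_pmf \<mu>) + s * (\<integral>n. g n \<partial>measure_pmf \<nu>)"
    by (rule sums_unique2)
qed

lemma mix_Pi_inf: "s \<in> {0..1} \<Longrightarrow> \<mu> \<in> Pi_inf \<Longrightarrow> \<nu> \<in> Pi_inf \<Longrightarrow> mix s \<mu> \<nu> \<in> Pi_inf"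
  by (simp add: Pi_inf_def integrable_mix)

lemma d_moment_mix:
  assumes s: "s \<in> {0..1}"
  shows "d_moment n (mix s \<mu> \<nu>) \<mu> = s * d_moment n \<nu> \<mu>"
proof -
  have "pmf (mix s \<mu> \<nu>) k - pmf \<mu> k = s * (pmf \<nu> k - pmf \<mu> k)" for k
    by (simp add: pmf_mix[OF s] algebra_simps)
  then have "d_moment n (mix s \<mu> \<nu>) \<mu> = (\<Sum>\<^sub>\<infinity>k\<in>{1..}. s * (real k ^ n * \<bar>pmf \<nu> k - pmf \<mu> k\<bar>))"
    unfolding d_moment_def using s by (simp add: abs_mult mult.left_commute)
  then show ?thesis by (simp add: infsum_cmult_right' d_moment_def)
qed

lemma bmix_mix:
  assumes "s \<in> {0..1}" "x \<in> {0..1}" "integrable (measure_pmf \<mu>) w" "integrable (measure_pmf \<nu>) w" "\<And>k. \<bar>c k\<bar> \<le> 1"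
  shows "bmix (mix s \<mu> \<nu>) w c m h x = (1 - s) * bmix \<mu> w c m h x + s * bmix \<nu> w c m h x"
  unfolding bmix_def by (intro integral_mix integrable_bmix assms)

lemma
  assumes "s \<in> {0..1}" "x \<in> {0..1}" "\<mu> \<in> Pi_inf" "\<nu> \<in> Pi_inf"
  shows Psi_mix: "Psi (mix s \<mu> \<nu>) h x = (1 - s) * Psi \<mu> h x + s * Psi \<nu> h x"
    and Psi1_mix: "Psi1 (mix s \<mu> \<nu>) h x = (1 - s) * Psi1 \<mu> h x + s * Psi1 \<nu> h x"
    and Psi2_mix: "Psi2 (mix s \<mu> \<nu>) h x = (1 - s) * Psi2 \<mu> h x + s * Psi2 \<nu> h x"
  unfolding Psi_eq_bmix Psi1_def Psi2_def
  by (intro bmix_mix assms tail0_abs pivot0_abs bdiff_pivot0_abs integrable_degree integrable_falling; simp)+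

lemma eventually_mix_in_neighbourhood:
  assumes "openin Pi_inf_topology U" "\<mu> \<in> U" "\<mu> \<in> Pi_inf" "\<nu> \<in> Pi_inf"
  shows "\<forall>\<^sub>F j in sequentially. mix (inverse (real (Suc j))) \<mu> \<nu> \<in> U"
proof (rule eventually_in_neighbourhood[OF assms(1,2)])
  have s: "inverse (real (Suc j)) \<in> {0..1}" for j by (simp add: field_simps)
  show "mix (inverse (real (Suc j))) \<mu> \<nu> \<in> Pi_inf" for j
    by (intro mix_Pi_inf s assms)
  show "(\<lambda>j. d_moment n (mix (inverse (real (Suc j))) \<mu> \<nu>) \<mu>) \<longlonglongrightarrow> 0" for n
    unfolding d_moment_mix[OF s] by (rule tendsto_mult_left_zero[OF LIMSEQ_inverse_real_of_nat])
qed


section \<open>Criticality\<close>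

text \<open>
An interpretation is only measurable for the completed measure, so it is first replaced by a
measurable set that differs from it by a null set; by \<open>AE_children\<close> the child counts agree almost
surely too.
\<close>

lemma interpretation_fixed_point:
  assumes T: "tree_interpretation \<pi> h T" and x: "x = measure (completion (GW \<pi>)) T" "0 < x" "x < 1"
    and \<pi>: "\<pi> \<in> Pi_inf"
  shows "Psi \<pi> h x = x" "Psi1 \<pi> h x \<le> 1"
proof -
  have TC: "T \<in> sets (completion (GW \<pi>))"
    and AE_T: "AE t in GW \<pi>. t \<in> T \<longleftrightarrow> child_count t T \<ge> h (length (children t))"
    using T by (auto simp: tree_interpretation_def)
  define S where "S = main_part (GW \<pi>) T"
  have S: "S \<in> sets rtree_space" using main_part_sets[OF TC] by (simp add: S_def)
  have Sx: "measure (GW \<pi>) S = x" using TC by (simp add: x(1) S_def measure_def)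
  obtain N where N: "N \<in> null_sets (GW \<pi>)" "null_part (GW \<pi>) T \<subseteq> N"
    using null_part[OF TC] by blast
  have TS: "T = S \<union> null_part (GW \<pi>) T" using main_part_null_part_Un[OF TC] by (simp add: S_def)
  have eq: "AE t in GW \<pi>. t \<in> T \<longleftrightarrow> t \<in> S"
    using AE_not_in[OF N(1)] by (rule eventually_mono) (use N(2) TS in blast)
  have fp: "AE t in GW \<pi>. indicator S t = step h (indicator S) t"
    using AE_T eq AE_children[OF eq]
  proof eventually_elim
    case (elim t)
    have "step h (indicator S) t = (if h (num_children t) \<le> child_count t S then 1 else 0)"
      unfolding step_def child_count_def by (rule ptail_indicator) (simp add: indicator_def)
    moreover have "child_count t S = child_count t T"
      unfolding child_count_def using elim(3) by (metis (mono_tags, lifting) filter_cong)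
    ultimately show ?case using elim(1,2) by (simp add: num_children_def indicator_def)
  qed
  show "Psi1 \<pi> h x \<le> 1"
    using unstable_fixed_point_no_interpretation[OF \<pi> S fp Sx x(2,3)] by (simp add: pivotal_mean_eq_Psi1)
  have "x = integral\<^sup>L (GW \<pi>) (indicator S)" using S Sx by simp
  also have "\<dots> = integral\<^sup>L (GW \<pi>) (step h (indicator S))"
    using fp S by (intro integral_cong_AE) (auto simp: borel_measurable_GW_iff)
  also have "\<dots> = Psi \<pi> h x"
    using S Sx by (intro integral_step) auto
  finally show "Psi \<pi> h x = x" by simp
qed

lemma critical_small_fixed_point:
  assumes "critical \<mu> h" "\<mu> \<in> U" "openin Pi_inf_topology U" "0 < \<epsilon>"
  shows "\<exists>\<pi>\<in>U. \<exists>x. \<pi> \<in> Pi_inf \<and> 0 < x \<and> x < \<epsilon> \<and> x < 1 \<and> Psi \<pi> h x = x \<and> Psi1 \<pi> h x \<le> 1"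
proof -
  have "0 < min \<epsilon> 1" using assms(4) by simp
  then obtain \<pi> T where \<pi>: "\<pi> \<in> U" and T: "tree_interpretation \<pi> h T"
    "0 < measure (completion (GW \<pi>)) T" "measure (completion (GW \<pi>)) T < min \<epsilon> 1"
    using assms unfolding critical_def by blast
  have "\<pi> \<in> Pi_inf"
    using assms(3) \<pi> unfolding Pi_inf_topology_def openin_pullback_topology by blast
  with interpretation_fixed_point[OF T(1) refl] T \<pi> show ?thesis
    by (intro bexI[of _ \<pi>] exI[of _ "measure (completion (GW \<pi>)) T"]) auto
qed

lemma criticalI:
  assumes "\<And>\<epsilon> U. 0 < \<epsilon> \<Longrightarrow> openin Pi_inf_topology U \<Longrightarrow> \<mu> \<in> U \<Longrightarrow>
    \<exists>\<pi>\<in>U. \<exists>x. \<pi> \<in> Pi_inf \<and> 0 < x \<and> x < \<epsilon> \<and> x \<le> 1 \<and> Psi \<pi> h x = x \<and> Psi1 \<pi> h x < 1"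
  shows "critical \<mu> h"
  unfolding critical_def
proof (intro allI impI)
  fix \<epsilon> :: real and U assume "0 < \<epsilon>" "openin Pi_inf_topology U \<and> \<mu> \<in> U"
  then obtain \<pi> x where \<pi>: "\<pi> \<in> U" "\<pi> \<in> Pi_inf" and x: "0 < x" "x < \<epsilon>" "x \<le> 1" "Psi \<pi> h x = x" "Psi1 \<pi> h x < 1"
    using assms by blast
  then obtain T where "T \<in> sets rtree_space" "tree_interpretation \<pi> h T" "measure (GW \<pi>) T = x"
    using stable_fixed_point_interpretation[of \<pi> x h] by (auto simp: pivotal_mean_eq_Psi1)
  then show "\<exists>\<pi>\<in>U. \<exists>\<T>. tree_interpretation \<pi> h \<T> \<and> 0 < measure (completion (GW \<pi>)) \<T> \<and> measure (completion (GW \<pi>)) \<T> < \<epsilon>"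
    using \<pi>(1) x by (intro bexI[of _ \<pi>] exI[of _ T]) (auto simp: measure_completion)
qed

lemma close_to_value_at_0:
  fixes f :: "real \<Rightarrow> real"
  assumes "continuous_on {0..1} f" "0 < e" "0 < b"
  shows "\<exists>\<delta>. 0 < \<delta> \<and> \<delta> < b \<and> \<delta> < 1 \<and> (\<forall>x. 0 \<le> x \<longrightarrow> x \<le> \<delta> \<longrightarrow> \<bar>f x - f 0\<bar> < e)"
proof -
  obtain d where d: "0 < d" "\<And>x. x \<in> {0..1} \<Longrightarrow> dist x 0 < d \<Longrightarrow> dist (f x) (f 0) < e"
    using assms(1,2) unfolding continuous_on_iff by (metis atLeastAtMost_iff order_refl zero_le_one)
  define \<delta> where "\<delta> = min d (min b 1) / 2"
  have "0 < \<delta>" "\<delta> < d" "\<delta> < b" "\<delta> < 1" using d(1) assms(3) by (auto simp: \<delta>_def min_def)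
  then show ?thesis
    using d(2) by (intro exI[of _ \<delta>]) (auto simp: dist_real_def)
qed

text \<open>
Nearby distributions have arbitrarily small fixed points \<open>x\<close> of slope at most 1.  Between 0 and \<open>x\<close>
the slope is 1 somewhere, which gives the first claim in the limit.  A positive second derivative
would persist for nearby distributions and make the slope at \<open>x\<close> exceed 1.
\<close>

lemma critical_derivatives:
  assumes h: "\<And>n. h n \<ge> 1" and \<mu>: "\<mu> \<in> Pi_inf" and crit: "critical \<mu> h"
  shows "Psi1 \<mu> h 0 = 1" "Psi2 \<mu> h 0 \<le> 0"
proof -
  have near: "\<exists>\<pi> x. \<pi> \<in> Pi_inf \<and> d_moment j \<pi> \<mu> < e \<and> 0 < x \<and> x < \<delta> \<and> x < 1 \<and> Psi \<pi> h x = x \<and> Psi1 \<pi> h x \<le> 1"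
    if "0 < e" "0 < \<delta>" for j e \<delta>
  proof -
    have "d_moment j \<mu> \<mu> < e" using that by (simp add: d_moment_def)
    then have "\<mu> \<in> {\<pi> \<in> Pi_inf. d_moment j \<pi> \<mu> < e}" using \<mu> by simp
    from critical_small_fixed_point[OF crit this openin_moment_balls[OF \<mu>] that(2)] show ?thesis by blast
  qed
  have slope: "\<exists>\<xi>. 0 < \<xi> \<and> \<xi> < x \<and> Psi1 \<pi> h \<xi> = 1" if "\<pi> \<in> Pi_inf" "0 < x" "x < 1" "Psi \<pi> h x = x" for \<pi> x
    using Psi_mean_value(1)[OF that(1), of 0 x h] that Psi_0[OF h] by auto
  show "Psi1 \<mu> h 0 = 1"
  proof (rule ccontr)
    define a where "a = \<bar>Psi1 \<mu> h 0 - 1\<bar> / 2"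
    assume "Psi1 \<mu> h 0 \<noteq> 1"
    then have a: "0 < a" by (simp add: a_def)
    obtain \<delta> where \<delta>: "0 < \<delta>" "\<delta> < 1" "\<And>x. 0 \<le> x \<Longrightarrow> x \<le> \<delta> \<Longrightarrow> \<bar>Psi1 \<mu> h x - Psi1 \<mu> h 0\<bar> < a"
      using close_to_value_at_0[OF continuous_on_Psi1[OF \<mu>] a, of 1] by auto
    obtain \<pi> x where \<pi>: "\<pi> \<in> Pi_inf" "d_moment 1 \<pi> \<mu> < a" and x: "0 < x" "x < \<delta>" "x < 1" "Psi \<pi> h x = x"
      using near[OF a \<delta>(1), of 1] by blast
    obtain \<xi> where \<xi>: "0 < \<xi>" "\<xi> < x" "Psi1 \<pi> h \<xi> = 1" using slope[OF \<pi>(1) x(1,3,4)] by blast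
    have "\<bar>Psi1 \<pi> h \<xi> - Psi1 \<mu> h \<xi>\<bar> \<le> d_moment 1 \<pi> \<mu>"
      using \<xi> x \<delta> by (intro Psi1_dist \<mu> \<pi>) auto
    moreover have "\<bar>Psi1 \<mu> h \<xi> - Psi1 \<mu> h 0\<bar> < a" using \<xi> x by (intro \<delta>(3)) auto
    ultimately show False using \<xi>(3) \<pi>(2) a_def by (simp add: abs_if split: if_splits)
  qed
  show "Psi2 \<mu> h 0 \<le> 0"
  proof (rule ccontr)
    define a where "a = Psi2 \<mu> h 0 / 2"
    assume "\<not> Psi2 \<mu> h 0 \<le> 0"
    then have a: "0 < a" by (simp add: a_def)
    obtain \<delta> where \<delta>: "0 < \<delta>" "\<delta> < 1" "\<And>x. 0 \<le> x \<Longrightarrow> x \<le> \<delta> \<Longrightarrow> \<bar>Psi2 \<mu> h x - Psi2 \<mu> h 0\<bar> < a"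
      using close_to_value_at_0[OF continuous_on_Psi2[OF \<mu>] a, of 1] by auto
    obtain \<pi> x where \<pi>: "\<pi> \<in> Pi_inf" "d_moment 2 \<pi> \<mu> < a" and x: "0 < x" "x < \<delta>" "x < 1" "Psi \<pi> h x = x" "Psi1 \<pi> h x \<le> 1"
      using near[OF a \<delta>(1), of 2] by blast
    have pos: "0 < Psi2 \<pi> h y" if "0 \<le> y" "y \<le> \<delta>" for y
    proof -
      have "\<bar>Psi2 \<pi> h y - Psi2 \<mu> h y\<bar> \<le> d_moment 2 \<pi> \<mu>"
        using that \<delta> by (intro Psi2_dist \<mu> \<pi>) auto
      with \<delta>(3)[OF that] \<pi>(2) show ?thesis by (simp add: a_def abs_if split: if_splits)
    qed
    obtain \<xi> where \<xi>: "0 < \<xi>" "\<xi> < x" "Psi1 \<pi> h \<xi> = 1" using slope[OF \<pi>(1) x(1,3,4)] by blast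
    obtain \<eta> where \<eta>: "\<xi> < \<eta>" "\<eta> < x" "Psi1 \<pi> h x - Psi1 \<pi> h \<xi> = Psi2 \<pi> h \<eta> * (x - \<xi>)"
      using Psi_mean_value(2)[OF \<pi>(1), of \<xi> x h] \<xi> x by auto
    have "0 < Psi2 \<pi> h \<eta> * (x - \<xi>)" using pos[of \<eta>] \<eta> \<xi> x by (intro mult_pos_pos) auto
    then show False using \<eta>(3) \<xi>(3) x(5) by simp
  qed
qed

lemma bsum_bdiff_pivot0:
  "bsum \<alpha> \<beta> (bdiff pivot0) n 0 = 0" "bsum \<alpha> \<beta> (bdiff pivot0) n 1 = - (\<beta> ^ n)"
proof -
  show 0: "bsum \<alpha> \<beta> (bdiff pivot0) n 0 = 0" for n
    by (induction n) (auto simp: bdiff_pivot0_eq)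
  show "bsum \<alpha> \<beta> (bdiff pivot0) n 1 = - (\<beta> ^ n)"
    using 0 by (induction n) (auto simp: bdiff_pivot0_eq)
qed

lemma return_pmf_Pi_inf: "return_pmf k \<in> Pi_inf"
  by (simp add: Pi_inf_def integrable_measure_pmf_finite)

lemma Psi1_at_0: "Psi1 \<mu> h 0 = (\<integral>n. real n * pivot0 (h n) \<partial>measure_pmf \<mu>)"
  by (simp add: Psi1_def bmix_def bsum_0)

lemma Psi2_at_0: "Psi2 \<mu> h 0 = (\<integral>n. real n * real (n - 1) * bdiff pivot0 (h n) \<partial>measure_pmf \<mu>)"
  by (simp add: Psi2_def bmix_def bsum_0)

text \<open>
The map of \<open>\<mu>\<close> lies below the diagonal at some small \<open>\<delta>\<close>.  Mixing in a small point mass at \<open>k\<close> keeps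
this, keeps concavity on \<open>[0, \<delta>]\<close> and raises the slope at 0 above 1, so that the new map crosses
the diagonal from above to below between 0 and \<open>\<delta>\<close>.
\<close>

lemma critical_if_strictly_concave:
  assumes h: "\<And>n. h n \<ge> 1" and \<mu>: "\<mu> \<in> Pi_inf"
    and slope: "Psi1 \<mu> h 0 = 1" and curv: "Psi2 \<mu> h 0 < 0" and k: "2 \<le> k" "h k = 1"
  shows "critical \<mu> h"
proof (rule criticalI)
  fix \<epsilon> :: real and U assume \<epsilon>: "0 < \<epsilon>" and U: "openin Pi_inf_topology U" "\<mu> \<in> U"
  define \<nu> where "\<nu> = return_pmf k"
  have \<nu>: "\<nu> \<in> Pi_inf" by (simp add: \<nu>_def return_pmf_Pi_inf)
  have \<nu>1: "Psi1 \<nu> h 0 = real k" by (simp add: Psi1_at_0 \<nu>_def k pivot0_eq)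
  have \<nu>2: "Psi2 \<nu> h x \<le> 0" if "x \<le> 1" for x
    using that k(2) bsum_bdiff_pivot0(2)[of x "1 - x" "k - 1 - 1"]
    by (simp add: Psi2_def bmix_def \<nu>_def)
  obtain \<delta> where \<delta>: "0 < \<delta>" "\<delta> < \<epsilon>" "\<delta> < 1"
    "\<And>x. 0 \<le> x \<Longrightarrow> x \<le> \<delta> \<Longrightarrow> \<bar>Psi2 \<mu> h x - Psi2 \<mu> h 0\<bar> < - Psi2 \<mu> h 0"
    using close_to_value_at_0[OF continuous_on_Psi2[OF \<mu>] _ \<epsilon>, of "- Psi2 \<mu> h 0" h] curv by auto
  have \<mu>2: "Psi2 \<mu> h x < 0" if "0 \<le> x" "x \<le> \<delta>" for x
    using \<delta>(4)[OF that] by (simp add: abs_if split: if_splits)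
  have below: "Psi \<mu> h \<delta> < \<delta>"
  proof -
    obtain \<xi> where \<xi>: "0 < \<xi>" "\<xi> < \<delta>" "Psi \<mu> h \<delta> = Psi1 \<mu> h \<xi> * \<delta>"
      using Psi_mean_value(1)[OF \<mu>, of 0 \<delta> h] \<delta> Psi_0[OF h] by auto
    obtain \<eta> where \<eta>: "0 < \<eta>" "\<eta> < \<xi>" "Psi1 \<mu> h \<xi> - 1 = Psi2 \<mu> h \<eta> * \<xi>"
      using Psi_mean_value(2)[OF \<mu>, of 0 \<xi> h] \<delta> \<xi> slope by auto
    have "Psi2 \<mu> h \<eta> * \<xi> < 0" using \<mu>2[of \<eta>] \<eta> \<xi> by (intro mult_neg_pos) auto
    then have "Psi1 \<mu> h \<xi> < 1" using \<eta>(3) by simp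
    then show ?thesis using \<xi>(3) \<delta>(1) by simp
  qed
  let ?s = "\<lambda>j. inverse (real (Suc j))"
  have "(\<lambda>j. (1 - ?s j) * Psi \<mu> h \<delta> + ?s j * Psi \<nu> h \<delta>) \<longlonglongrightarrow> (1 - 0) * Psi \<mu> h \<delta> + 0 * Psi \<nu> h \<delta>"
    by (intro tendsto_intros LIMSEQ_inverse_real_of_nat)
  then have "\<forall>\<^sub>F j in sequentially. (1 - ?s j) * Psi \<mu> h \<delta> + ?s j * Psi \<nu> h \<delta> < \<delta>"
    using below by (intro order_tendstoD(2)) auto
  moreover have "\<forall>\<^sub>F j in sequentially. mix (?s j) \<mu> \<nu> \<in> U"
    by (rule eventually_mix_in_neighbourhood[OF U \<mu> \<nu>])
  ultimately have "\<forall>\<^sub>F j in sequentially. (1 - ?s j) * Psi \<mu> h \<delta> + ?s j * Psi \<nu> h \<delta> < \<delta> \<and> mix (?s j) \<mu> \<nu> \<in> U \<and> 1 \<le> j"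
    by (intro eventually_conj eventually_ge_at_top)
  then obtain j where j: "(1 - ?s j) * Psi \<mu> h \<delta> + ?s j * Psi \<nu> h \<delta> < \<delta>" "mix (?s j) \<mu> \<nu> \<in> U" "1 \<le> j"
    by (auto simp: eventually_sequentially)
  define s where "s = ?s j"
  have s: "0 < s" "s < 1" "s \<in> {0..1}" using j(3) by (auto simp: s_def field_simps)
  define \<pi> where "\<pi> = mix s \<mu> \<nu>"
  have \<pi>: "\<pi> \<in> Pi_inf" unfolding \<pi>_def by (intro mix_Pi_inf s \<mu> \<nu>)
  have \<pi>\<delta>: "Psi \<pi> h \<delta> < \<delta>"
    using j(1) \<delta> unfolding \<pi>_def by (subst Psi_mix[OF s(3) _ \<mu> \<nu>]) (auto simp: s_def)
  have \<pi>1: "1 < Psi1 \<pi> h 0"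
  proof -
    have "Psi1 \<pi> h 0 = 1 + s * (real k - 1)"
      unfolding \<pi>_def by (subst Psi1_mix[OF s(3) _ \<mu> \<nu>]) (auto simp: slope \<nu>1 algebra_simps)
    then show ?thesis using s(1) k(1) by simp
  qed
  have \<pi>2: "Psi2 \<pi> h x < 0" if "0 \<le> x" "x \<le> \<delta>" for x
  proof -
    have "(1 - s) * Psi2 \<mu> h x < 0" "s * Psi2 \<nu> h x \<le> 0"
      using \<mu>2[OF that] \<nu>2[of x] s that \<delta> by (auto intro: mult_pos_neg mult_nonneg_nonpos)
    then show ?thesis
      unfolding \<pi>_def using that \<delta> by (subst Psi2_mix[OF s(3) _ \<mu> \<nu>]) auto
  qed
  obtain b where b: "0 < b" "b < \<delta>" "\<And>x. 0 \<le> x \<Longrightarrow> x \<le> b \<Longrightarrow> \<bar>Psi1 \<pi> h x - Psi1 \<pi> h 0\<bar> < Psi1 \<pi> h 0 - 1"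
    using close_to_value_at_0[OF continuous_on_Psi1[OF \<pi>] _ \<delta>(1), of "Psi1 \<pi> h 0 - 1" h] \<pi>1 by auto
  have above: "b < Psi \<pi> h b"
  proof -
    obtain \<xi> where \<xi>: "0 < \<xi>" "\<xi> < b" "Psi \<pi> h b = Psi1 \<pi> h \<xi> * b"
      using Psi_mean_value(1)[OF \<pi>, of 0 b h] b \<delta> Psi_0[OF h] by auto
    have "1 < Psi1 \<pi> h \<xi>" using b(3)[of \<xi>] \<xi> by (simp add: abs_if split: if_splits)
    then show ?thesis using \<xi>(3) b(1) by simp
  qed
  have "\<exists>x\<ge>b. x \<le> \<delta> \<and> Psi \<pi> h x - x = 0"
  proof (rule IVT2')
    show "continuous_on {b..\<delta>} (\<lambda>x. Psi \<pi> h x - x)"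
      using b \<delta> by (intro continuous_intros continuous_on_subset[OF continuous_on_Psi[OF \<pi>]]) auto
  qed (use above \<pi>\<delta> b in auto)
  then obtain x where x: "b \<le> x" "x \<le> \<delta>" "Psi \<pi> h x = x" by auto
  obtain \<xi> where \<xi>: "0 < \<xi>" "\<xi> < x" "Psi1 \<pi> h \<xi> = 1"
    using Psi_mean_value(1)[OF \<pi>, of 0 x h] x b \<delta> Psi_0[OF h] by auto
  obtain \<eta> where \<eta>: "\<xi> < \<eta>" "\<eta> < x" "Psi1 \<pi> h x - 1 = Psi2 \<pi> h \<eta> * (x - \<xi>)"
    using Psi_mean_value(2)[OF \<pi>, of \<xi> x h] \<xi> x \<delta> by auto
  have "Psi2 \<pi> h \<eta> * (x - \<xi>) < 0" using \<pi>2[of \<eta>] \<eta> \<xi> x by (intro mult_neg_pos) auto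
  then have "Psi1 \<pi> h x < 1" using \<eta>(3) by simp
  then show "\<exists>\<pi>\<in>U. \<exists>x. \<pi> \<in> Pi_inf \<and> 0 < x \<and> x < \<epsilon> \<and> x \<le> 1 \<and> Psi \<pi> h x = x \<and> Psi1 \<pi> h x < 1"
    using j(2) \<pi> x b \<delta> by (intro bexI[of _ \<pi>] exI[of _ x]) (auto simp: \<pi>_def s_def)
qed

text \<open>
The slope at 0 is \<open>\<Sum> n \<mu>(n)\<close> over the \<open>n\<close> with \<open>h n = 1\<close>.  If only \<open>n \<le> 1\<close> contributed, slope 1
would force \<open>\<mu>\<close> to be the point mass at 1.
\<close>

lemma branching_vertex_exists:
  assumes nondeg: "\<exists>m\<in>set_pmf \<mu>. \<exists>n\<in>set_pmf \<mu>. m \<noteq> n" and slope: "Psi1 \<mu> h 0 = 1"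
  shows "\<exists>k\<ge>2. k \<in> set_pmf \<mu> \<and> h k = 1"
proof (rule ccontr)
  assume no: "\<not> ?thesis"
  have "1 = (\<integral>n. real n * pivot0 (h n) \<partial>measure_pmf \<mu>)" using slope by (simp add: Psi1_at_0)
  also have "\<dots> = (\<Sum>n\<in>{1}. pmf \<mu> n *\<^sub>R (real n * pivot0 (h n)))"
  proof (rule integral_measure_pmf)
    fix n assume n: "n \<in> set_pmf \<mu>" "real n * pivot0 (h n) \<noteq> 0"
    then have "n \<noteq> 0" "h n = 1" by (auto simp: pivot0_eq split: if_splits)
    with no n(1) have "\<not> 2 \<le> n" by blast
    with \<open>n \<noteq> 0\<close> show "n \<in> {1}" by auto
  qed simp
  also have "\<dots> \<le> pmf \<mu> 1" by (simp add: pivot0_eq)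
  finally have one: "1 \<le> pmf \<mu> 1" .
  obtain m where m: "m \<in> set_pmf \<mu>" "m \<noteq> 1" using nondeg by metis
  have "pmf \<mu> 1 + pmf \<mu> m = measure_pmf.prob \<mu> {1, m}"
    using m(2) by (simp add: measure_measure_pmf_finite)
  also have "\<dots> \<le> 1" by simp
  finally show False using one pmf_positive[OF m(1)] by simp
qed

lemma integrable_indicator_times:
  "integrable (measure_pmf \<mu>) (\<lambda>n. indicator {m} n * (c :: real))"
  by (intro integrable_mult_left measure_pmf.integrable_const_bound[where B = 1]) (auto simp: indicator_def)

text \<open>
In \<open>\<Psi>''(0)\<close> only the \<open>n\<close> with \<open>h n = 2\<close> count positively, and \<open>k\<close> contributes a negative term
that has to be compensated.
\<close>

lemma threshold_two_vertex_exists: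
  assumes \<mu>: "\<mu> \<in> Pi_inf" and k: "2 \<le> k" "k \<in> set_pmf \<mu>" "h k = 1" and curv: "0 \<le> Psi2 \<mu> h 0"
  shows "\<exists>m\<ge>2. m \<in> set_pmf \<mu> \<and> h m = 2"
proof (rule ccontr)
  assume no: "\<not> ?thesis"
  let ?g = "\<lambda>n. real n * real (n - 1) * bdiff pivot0 (h n)"
  have "integrable (measure_pmf \<mu>) (\<lambda>n. real n * real (n - 1) * bsum 0 (1 - 0) (bdiff pivot0) n (h n))"
    by (rule integrable_bmix[OF integrable_falling[OF \<mu>] bdiff_pivot0_abs]) simp
  then have ig: "integrable (measure_pmf \<mu>) ?g" by (simp add: bsum_0)
  have le: "?g n \<le> - (indicator {k} n * (real k * real (k - 1)))" if n: "n \<in> set_pmf \<mu>" for n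
  proof (cases "n = k")
    case False
    have "bdiff pivot0 (h n) \<le> 0 \<or> real n * real (n - 1) = 0"
      using no n by (cases "2 \<le> n") (auto simp: bdiff_pivot0_eq)
    then show ?thesis using False by (auto simp: mult_nonneg_nonpos)
  qed (use k in \<open>simp add: bdiff_pivot0_eq\<close>)
  have "Psi2 \<mu> h 0 \<le> (\<integral>n. - (indicator {k} n * (real k * real (k - 1))) \<partial>measure_pmf \<mu>)"
    unfolding Psi2_at_0
    by (intro integral_mono_AE ig Bochner_Integration.integrable_minus integrable_indicator_times AE_pmfI le)
  also have "\<dots> = - (pmf \<mu> k * (real k * real (k - 1)))"
    by (simp add: measure_pmf_single)
  also have "\<dots> < 0" using pmf_positive[OF k(2)] k(1) by simp
  finally show False using curv by simp
qed

text \<open>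
An \<open>m\<close> with \<open>h m = 2\<close> is invisible in \<open>\<Psi>'(0)\<close>, and 0 is invisible in both derivatives.
\<close>

lemma remove_mass_lowers_curvature:
  assumes \<mu>: "\<mu> \<in> Pi_inf" and m: "2 \<le> m" "m \<in> set_pmf \<mu>" "h m = 2"
  defines "\<nu> \<equiv> map_pmf (\<lambda>n. if n = m then 0 else n) \<mu>"
  shows "\<nu> \<in> Pi_inf" "Psi1 \<nu> h 0 = Psi1 \<mu> h 0" "Psi2 \<nu> h 0 < Psi2 \<mu> h 0"
proof -
  let ?r = "\<lambda>n. if n = m then 0 else n"
  show "\<nu> \<in> Pi_inf"
    unfolding Pi_inf_def mem_Collect_eq
  proof
    fix j
    have "integrable (measure_pmf \<mu>) (\<lambda>n. real (?r n) ^ j)"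
      by (rule Bochner_Integration.integrable_bound[OF integrable_moment[OF \<mu>, of j]])
         (auto intro!: AE_I2 power_mono)
    then show "integrable (measure_pmf \<nu>) (\<lambda>n. real n ^ j)"
      unfolding \<nu>_def by (simp add: integrable_map_pmf_eq)
  qed
  have "real (?r n) * pivot0 (h (?r n)) = real n * pivot0 (h n)" for n
    using m(3) by (simp add: pivot0_eq)
  then show "Psi1 \<nu> h 0 = Psi1 \<mu> h 0"
    unfolding Psi1_at_0 \<nu>_def integral_map_pmf by simp
  let ?g = "\<lambda>n. real n * real (n - 1) * bdiff pivot0 (h n)"
  have "integrable (measure_pmf \<mu>) (\<lambda>n. real n * real (n - 1) * bsum 0 (1 - 0) (bdiff pivot0) n (h n))"
    by (rule integrable_bmix[OF integrable_falling[OF \<mu>] bdiff_pivot0_abs]) simp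
  then have ig: "integrable (measure_pmf \<mu>) ?g" by (simp add: bsum_0)
  have "?g (?r n) = ?g n - indicator {m} n * (real m * real (m - 1))" for n
    using m(3) by (simp add: bdiff_pivot0_eq)
  then have "Psi2 \<nu> h 0 = (\<integral>n. ?g n - indicator {m} n * (real m * real (m - 1)) \<partial>measure_pmf \<mu>)"
    unfolding Psi2_at_0 \<nu>_def integral_map_pmf by simp
  also have "\<dots> = Psi2 \<mu> h 0 - pmf \<mu> m * (real m * real (m - 1))"
    unfolding Psi2_at_0 Bochner_Integration.integral_diff[OF ig integrable_indicator_times]
    by (simp add: measure_pmf_single)
  also have "\<dots> < Psi2 \<mu> h 0" using pmf_positive[OF m(2)] m(1) by simp
  finally show "Psi2 \<nu> h 0 < Psi2 \<mu> h 0" .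
qed

text \<open>
Criticality passes to limits of child distributions.  If the curvature vanishes, \<open>\<mu>\<close> is such a limit
of distributions with slope 1 and negative curvature.
\<close>

lemma critical_if_derivatives:
  assumes h: "\<And>n. h n \<ge> 1" and \<mu>: "\<mu> \<in> Pi_inf"
    and nondeg: "\<exists>m\<in>set_pmf \<mu>. \<exists>n\<in>set_pmf \<mu>. m \<noteq> n"
    and slope: "Psi1 \<mu> h 0 = 1" and curv: "Psi2 \<mu> h 0 \<le> 0"
  shows "critical \<mu> h"
proof -
  obtain k where k: "2 \<le> k" "k \<in> set_pmf \<mu>" "h k = 1"
    using branching_vertex_exists[OF nondeg slope] by blast
  show ?thesis
  proof (cases "Psi2 \<mu> h 0 < 0")
    case True
    then show ?thesis using critical_if_strictly_concave[where h = h and k = k, OF h \<mu> slope _ k(1,3)] by blast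
  next
    case False
    then obtain m where m: "2 \<le> m" "m \<in> set_pmf \<mu>" "h m = 2"
      using threshold_two_vertex_exists[where h = h, OF \<mu> k] by auto
    define \<nu> where "\<nu> = map_pmf (\<lambda>n. if n = m then 0 else n) \<mu>"
    note \<nu> = remove_mass_lowers_curvature[where h = h, OF \<mu> m, folded \<nu>_def]
    let ?s = "\<lambda>j. inverse (real (Suc j))"
    have s: "?s j \<in> {0..1}" for j by (simp add: field_simps)
    have crit: "critical (mix (?s j) \<mu> \<nu>) h" for j
    proof (rule critical_if_strictly_concave[where h = h and k = k, OF h _ _ _ k(1,3)])
      show "mix (?s j) \<mu> \<nu> \<in> Pi_inf" by (intro mix_Pi_inf s \<mu> \<nu>)
      show "Psi1 (mix (?s j) \<mu> \<nu>) h 0 = 1"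
        by (subst Psi1_mix[OF s _ \<mu> \<nu>(1)]) (auto simp: \<nu>(2) slope)
      have "(1 - ?s j) * Psi2 \<mu> h 0 \<le> 0"
        using s[of j] curv by (intro mult_nonneg_nonpos) auto
      moreover have "?s j * Psi2 \<nu> h 0 < 0"
        using \<nu>(3) curv by (intro mult_pos_neg) auto
      ultimately show "Psi2 (mix (?s j) \<mu> \<nu>) h 0 < 0"
        by (subst Psi2_mix[OF s _ \<mu> \<nu>(1)]) auto
    qed
    show ?thesis
      unfolding critical_def
    proof (intro allI impI, elim conjE)
      fix \<epsilon> :: real and U assume \<epsilon>: "0 < \<epsilon>" and U: "openin Pi_inf_topology U" "\<mu> \<in> U"
      obtain j where "mix (?s j) \<mu> \<nu> \<in> U"
        using eventually_mix_in_neighbourhood[OF U \<mu> \<nu>(1)] by (auto simp: eventually_sequentially)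
      with crit[of j] \<epsilon> U(1)
      show "\<exists>\<pi>\<in>U. \<exists>\<T>. tree_interpretation \<pi> h \<T> \<and> 0 < measure (completion (GW \<pi>)) \<T> \<and> measure (completion (GW \<pi>)) \<T> < \<epsilon>"
        unfolding critical_def by blast
    qed
  qed
qed

text \<open>
One-sided derivatives are unique, so the existentially quantified ones are \<open>Psi1\<close> and \<open>Psi2\<close>.
\<close>

lemma automaton_map_derivatives_iff:
  assumes \<mu>: "\<mu> \<in> Pi_inf"
  shows "(\<exists>\<Psi>' D.
       (\<forall>x\<in>{0..1}. (automaton_map \<mu> h has_real_derivative \<Psi>' x) (at x within {0..1})) \<and>
       (\<Psi>' has_real_derivative D) (at 0 within {0..1}) \<and> \<Psi>' 0 = 1 \<and> D \<le> 0)
     \<longleftrightarrow> Psi1 \<mu> h 0 = 1 \<and> Psi2 \<mu> h 0 \<le> 0" (is "?L \<longleftrightarrow> ?R")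
proof -
  have D: "(automaton_map \<mu> h has_real_derivative Psi1 \<mu> h x) (at x within {0..1})" if "x \<in> {0..1}" for x
    using DERIV_Psi[OF \<mu> that, of h] that automaton_map_eq_Psi[of _ \<mu> h]
    by (auto intro: has_field_derivative_transform_within[where d = 1])
  have nb: "at x within {0..1} \<noteq> bot" if "x \<in> {0..1}" for x :: real
    using that by (simp add: trivial_limit_within)
  show ?thesis
  proof
    assume ?L
    then obtain \<Psi>' d where L: "\<And>x. x \<in> {0..1} \<Longrightarrow> (automaton_map \<mu> h has_real_derivative \<Psi>' x) (at x within {0..1})"
      "(\<Psi>' has_real_derivative d) (at 0 within {0..1})" "\<Psi>' 0 = 1" "d \<le> 0" by blast
    have eq: "\<Psi>' x = Psi1 \<mu> h x" if "x \<in> {0..1}" for x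
      by (rule has_field_derivative_unique[OF L(1)[OF that] D[OF that] nb[OF that]])
    have "(Psi1 \<mu> h has_real_derivative d) (at 0 within {0..1})"
      by (rule has_field_derivative_transform_within[OF L(2), where d = 1]) (auto intro: eq)
    moreover have "(Psi1 \<mu> h has_real_derivative Psi2 \<mu> h 0) (at 0 within {0..1})"
      by (rule DERIV_Psi1[OF \<mu>]) simp
    ultimately have "d = Psi2 \<mu> h 0"
      by (rule has_field_derivative_unique) (rule nb, simp)
    then show ?R using L eq[of 0] by simp
  next
    assume ?R
    then show ?L
      using D DERIV_Psi1[OF \<mu>, of 0 h] by (intro exI[of _ "Psi1 \<mu> h"] exI[of _ "Psi2 \<mu> h 0"]) auto
  qed
qed

theorem theorem1p5:
  fixes \<mu> :: "nat pmf" and h :: "nat \<Rightarrow> nat"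
  assumes "\<And>l. h l \<ge> 1"
    and "\<mu> \<in> Pi_inf"
    and "\<exists>m\<in>set_pmf \<mu>. \<exists>n\<in>set_pmf \<mu>. m \<noteq> n"
  shows "critical \<mu> h \<longleftrightarrow>
    (\<exists>\<Psi>' D.
       (\<forall>x\<in>{0..1}. (automaton_map \<mu> h has_real_derivative \<Psi>' x) (at x within {0..1})) \<and>
       (\<Psi>' has_real_derivative D) (at 0 within {0..1}) \<and>
       \<Psi>' 0 = 1 \<and> D \<le> 0)"
  unfolding automaton_map_derivatives_iff[OF assms(2)]
  using critical_derivatives[of h \<mu>, OF assms(1,2)] critical_if_derivatives[of h \<mu>, OF assms] by blast

end
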